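(* For all $A,B\in\mathcal{W}^+$ (equivalently, for all dominant alcoves $A,B$), the Laurent polynomial $$t_{B,A}=\sum_{C\in\mathcal{W}^+} n_{C,A}\,\overline{m^{C,B}}\in\mathbb{Z}[v^{\pm1}]$$ is self-dual, i.e. $\overline{t_{B,A}}=t_{B,A}$, where $\overline{\phantom{x}}$ is the ring involution of $\mathbb{Z}[v^{\pm 1}]$ with $v\mapsto v^{-1}$.
   Context: Affine Weyl group. Let $R$ be a root system in a Euclidean space $E$, with positive roots $R^+$, half-sum of positive roots $\rho$, and Weyl group $W$. Let $l$ be an odd positive integer ($l\neq 3$ if $R$ has a $G_2$-component). Let $X=\{\lambda\in E:\langle\lambda,\alpha^\vee\rangle\in\mathbb{Z}\ \forall\alpha\in R^+\}$ and $X^+=\{\lambda\in E:\langle\lambda,\alpha^\vee\rangle\in\mathbb{Z}_{\ge0}\ \forall\alpha\in R^+\}$. The affine Weyl group is $\mathcal{W}=l\mathbb{Z}R\rtimes W$, acting by the dot action $w\cdot\lambda=w(\lambda+\rho)-\rho$. The bottom alcove is $C_{\mathrm{bot}}=\{\lambda\in X:0<\langle\lambda+\rho,\alpha^\vee\rangle<l\ \forall\alpha\in R^+\}$; alcoves are the images $w\cdot C_{\mathrm{bot}}$, and dominant alcoves are those meeting $X^+$. $\mathcal{W}$ is a Coxeter group with simple generators $\mathcal{S}$ the reflections in the walls of $C_{\mathrm{bot}}$, length function $\ell$ and Bruhat order; $S=\mathcal{S}\cap W$. Let $\mathcal{W}^+=\{x\in\mathcal{W}:(x\cdot C_{\mathrm{bot}})\cap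 X^+\neq\emptyset\}$, a set of representatives of $W\backslash\mathcal{W}$, in bijection with dominant alcoves via $x\mapsto x\cdot C_{\mathrm{bot}}$; dominant alcoves and elements of $\mathcal{W}^+$ are used interchangeably as indices. Hecke algebra and modules. Let $\mathcal{L}=\mathbb{Z}[v^{\pm1}]$ and let $\mathcal{H}$ be the Hecke algebra of $(\mathcal{W},\mathcal{S})$: the $\mathcal{L}$-algebra with generators $H_s$ ($s\in\mathcal{S}$), the braid relations, and $H_s^2=1+(v^{-1}-v)H_s$. It has $\mathcal{L}$-basis $\{H_x\}_{x\in\mathcal{W}}$, where $H_x$ is the product of the $H_s$ along a reduced word for $x$. Dualization is the ring involution $H\mapsto\overline{H}$ of $\mathcal{H}$ with $\overline{v}=v^{-1}$ and $\overline{H_x}=(H_{x^{-1}})^{-1}$. Let $\mathcal{H}_W\le\mathcal{H}$ be the Hecke algebra of $(W,S)$. For $u\in\{-v,v^{-1}\}$ let $\mathcal{L}(u)$ be $\mathcal{L}$ viewed as a right $\mathcal{H}_W$-module via the homomorphism $\mathcal{H}_W\to\mathcal{L}$, $H_s\mapsto u$. Put $\mathcal{M}=\mathcal{L}(v^{-1})\otimes_{\mathcal{H}_W}\mathcal{H}$ and $\mathcal{N}=\mathcal{L}(-v)\otimes_{\mathcal{H}_W}\mathcal{H}$, with $\mathcal{L}$-bases $M_x=1\otimes H_x$ and $N_x=1\otimes H_x$ ($x\in\mathcal{W}^+$) respectively. Dualization extends to $\mathcal{M}$ and to $\mathcal{N}$ by $\overline{a\otimes H}=\overline{a}\otimes\overline{H}$.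 An element fixed by dualization is called self-dual. Kazhdan–Lusztig polynomials (existence and uniqueness known). $\{m_{y,x}\}_{x,y\in\mathcal{W}^+}$ is the unique family in $\mathbb{Z}[v]$ such that $m_{x,x}=1$; $m_{y,x}\in v\mathbb{Z}[v]$ if $y<x$; $m_{y,x}=0$ unless $y\le x$; and $\underline{M}_x=\sum_y m_{y,x}M_y$ is self-dual in $\mathcal{M}$ for all $x$. The family $\{n_{y,x}\}_{x,y\in\mathcal{W}^+}$ is defined by the same conditions with $\mathcal{N}$, $N_y$ and $\underline{N}_x=\sum_y n_{y,x}N_y$ in place of $\mathcal{M}$, $M_y$, $\underline{M}_x$. The inverse polynomials $m^{y,x}$ ($x,y\in\mathcal{W}^+$, with $m^{y,x}=0$ unless $y\ge x$) are defined by $\sum_{z\in\mathcal{W}^+}(-1)^{\ell(z)+\ell(x)}m^{z,x}m_{z,y}=\delta_{x,y}$ for all $x,y\in\mathcal{W}^+$. *)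

theory Defs
  imports
    "HOL-Analysis.Analysis"
    "HOL-Library.Poly_Mapping"
    "HOL-Algebra.QuotRing"
    "HOL-Algebra.Generated_Rings"
    "HOL-Algebra.Free_Abelian_Groups"
    "HOL-Algebra.Module"
begin

section \<open>Root systems\<close>

definition pairing :: "'e::euclidean_space \<Rightarrow> 'e \<Rightarrow> real" where
  "pairing x \<alpha> = 2 * (x \<bullet> \<alpha>) / (\<alpha> \<bullet> \<alpha>)"

definition refl_root :: "'e::euclidean_space \<Rightarrow> 'e \<Rightarrow> 'e" where
  "refl_root \<alpha> x = x - pairing x \<alpha> *\<^sub>R \<alpha>"

definition root_system :: "'e::euclidean_space set \<Rightarrow> bool" where
  "root_system R \<longleftrightarrow>
     finite R \<and> span R = UNIV \<and> 0 \<notin> R \<and>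
     (\<forall>\<alpha>\<in>R. \<forall>c. c *\<^sub>R \<alpha> \<in> R \<longrightarrow> c = 1 \<or> c = -1) \<and>
     (\<forall>\<alpha>\<in>R. refl_root \<alpha> ` R = R) \<and>
     (\<forall>\<alpha>\<in>R. \<forall>\<beta>\<in>R. pairing \<beta> \<alpha> \<in> \<int>)"

definition positive_system :: "'e::euclidean_space set \<Rightarrow> 'e set \<Rightarrow> bool" where
  "positive_system R Rp \<longleftrightarrow>
     (\<exists>\<gamma>. (\<forall>\<alpha>\<in>R. \<alpha> \<bullet> \<gamma> \<noteq> 0) \<and> Rp = {\<alpha>\<in>R. 0 < \<alpha> \<bullet> \<gamma>})"

text \<open>In type \<open>G\<^sub>2\<close> with simple roots \<open>\<alpha>\<close> (short) and \<open>\<beta>\<close> (long), the two equations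
  say \<open>\<langle>\<beta>,\<alpha>\<^sup>\<or>\<rangle> = -3\<close> and \<open>\<langle>\<alpha>,\<beta>\<^sup>\<or>\<rangle> = -1\<close>.\<close>

definition type_G2 :: "'e::euclidean_space set \<Rightarrow> bool" where
  "type_G2 \<Psi> \<longleftrightarrow>
     (\<exists>\<alpha> \<beta>. \<alpha> \<noteq> 0 \<and> \<beta> \<noteq> 0 \<and> pairing \<beta> \<alpha> = -3 \<and> pairing \<alpha> \<beta> = -1 \<and>
        (let Q = {\<alpha>, \<beta>, \<alpha> + \<beta>, 2 *\<^sub>R \<alpha> + \<beta>, 3 *\<^sub>R \<alpha> + \<beta>, 3 *\<^sub>R \<alpha> + 2 *\<^sub>R \<beta>}
         in \<Psi> = Q \<union> uminus ` Q))"

definition has_G2_component :: "'e::euclidean_space set \<Rightarrow> bool" where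
  "has_G2_component R \<longleftrightarrow>
     (\<exists>\<Psi>\<subseteq>R. type_G2 \<Psi> \<and> (\<forall>\<alpha>\<in>\<Psi>. \<forall>\<beta>\<in>R - \<Psi>. \<alpha> \<bullet> \<beta> = 0))"

definition half_sum :: "'e::euclidean_space set \<Rightarrow> 'e" where
  "half_sum Rp = (1/2) *\<^sub>R (\<Sum>\<alpha>\<in>Rp. \<alpha>)"

definition weights :: "'e::euclidean_space set \<Rightarrow> 'e set" where
  "weights Rp = {x. \<forall>\<alpha>\<in>Rp. pairing x \<alpha> \<in> \<int>}"

definition dominant_weights :: "'e::euclidean_space set \<Rightarrow> 'e set" where
  "dominant_weights Rp = {x. \<forall>\<alpha>\<in>Rp. pairing x \<alpha> \<in> \<nat>}"


section \<open>The affine Weyl group and its alcoves\<close>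

text \<open>Reflections are involutions, so the monoid they generate is a group.\<close>

inductive_set weyl_group :: "'e::euclidean_space set \<Rightarrow> ('e \<Rightarrow> 'e) set"
  for R :: "'e set" where
  "id \<in> weyl_group R"
| "\<alpha> \<in> R \<Longrightarrow> w \<in> weyl_group R \<Longrightarrow> refl_root \<alpha> \<circ> w \<in> weyl_group R"

definition root_lattice :: "'e::euclidean_space set \<Rightarrow> 'e set" where
  "root_lattice R = {(\<Sum>\<alpha>\<in>R. of_int (c \<alpha>) *\<^sub>R \<alpha>) |c :: 'e \<Rightarrow> int. True}"

text \<open>The semidirect product of the scaled root lattice and the Weyl group, realised as a
  group of (undotted) affine transformations of the Euclidean space.\<close>

definition affine_weyl_group :: "'e::euclidean_space set \<Rightarrow> nat \<Rightarrow> ('e \<Rightarrow> 'e) set" where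
  "affine_weyl_group R l =
     {(\<lambda>x. w x + real l *\<^sub>R \<gamma>) |w \<gamma>. w \<in> weyl_group R \<and> \<gamma> \<in> root_lattice R}"

definition dot_action :: "'e::euclidean_space set \<Rightarrow> ('e \<Rightarrow> 'e) \<Rightarrow> 'e \<Rightarrow> 'e" where
  "dot_action Rp w x = w (x + half_sum Rp) - half_sum Rp"

definition open_bottom_alcove :: "'e::euclidean_space set \<Rightarrow> nat \<Rightarrow> 'e set" where
  "open_bottom_alcove Rp l =
     {x. \<forall>\<alpha>\<in>Rp. 0 < pairing (x + half_sum Rp) \<alpha> \<and> pairing (x + half_sum Rp) \<alpha> < real l}"

definition bottom_alcove :: "'e::euclidean_space set \<Rightarrow> nat \<Rightarrow> 'e set" where
  "bottom_alcove Rp l = weights Rp \<inter> open_bottom_alcove Rp l"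

definition hyperplane :: "'e::euclidean_space set \<Rightarrow> nat \<Rightarrow> 'e \<Rightarrow> int \<Rightarrow> 'e set" where
  "hyperplane Rp l \<alpha> k = {x. pairing (x + half_sum Rp) \<alpha> = real l * of_int k}"

text \<open>The bottom alcove itself is a discrete set of weights; its walls are the reflection
  hyperplanes supporting a codimension-one face of the simplex (or product of simplices) in
  which these weights lie.\<close>

definition is_wall :: "'e::euclidean_space set \<Rightarrow> nat \<Rightarrow> 'e \<Rightarrow> int \<Rightarrow> bool" where
  "is_wall Rp l \<alpha> k \<longleftrightarrow>
     affine hull (closure (open_bottom_alcove Rp l) \<inter> hyperplane Rp l \<alpha> k) = hyperplane Rp l \<alpha> k"

text \<open>The element of the affine Weyl group whose \<^emph>\<open>dot action\<close> is the orthogonal reflection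
  in \<open>hyperplane Rp l \<alpha> k\<close>; undotted, it fixes the translate of that hyperplane by
  \<open>half_sum Rp\<close> (see \<open>dot_action_affine_reflection\<close>).\<close>

definition affine_reflection :: "nat \<Rightarrow> 'e::euclidean_space \<Rightarrow> int \<Rightarrow> 'e \<Rightarrow> 'e" where
  "affine_reflection l \<alpha> k x = x - (pairing x \<alpha> - real l * of_int k) *\<^sub>R \<alpha>"

lemma dot_action_affine_reflection:
  "dot_action Rp (affine_reflection l \<alpha> k) x =
     x - (pairing (x + half_sum Rp) \<alpha> - real l * of_int k) *\<^sub>R \<alpha>"
  by (simp add: dot_action_def affine_reflection_def)

definition simple_reflections :: "'e::euclidean_space set \<Rightarrow> nat \<Rightarrow> ('e \<Rightarrow> 'e) set" where
  "simple_reflections Rp l = {affine_reflection l \<alpha> k |\<alpha> k. \<alpha> \<in> Rp \<and> is_wall Rp l \<alpha> k}"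

definition finite_simple_reflections ::
    "'e::euclidean_space set \<Rightarrow> 'e set \<Rightarrow> nat \<Rightarrow> ('e \<Rightarrow> 'e) set" where
  "finite_simple_reflections R Rp l = simple_reflections Rp l \<inter> weyl_group R"

definition dominant_elements ::
    "'e::euclidean_space set \<Rightarrow> 'e set \<Rightarrow> nat \<Rightarrow> ('e \<Rightarrow> 'e) set" where
  "dominant_elements R Rp l =
     {x \<in> affine_weyl_group R l. dot_action Rp x ` bottom_alcove Rp l \<inter> dominant_weights Rp \<noteq> {}}"


section \<open>Length and Bruhat order\<close>

text \<open>In this and the following sections, \<open>S\<close> is a set of involutions, the Coxeter generators
  of the group that consists of their products.\<close>

definition word_prod :: "('e \<Rightarrow> 'e) list \<Rightarrow> 'e \<Rightarrow> 'e" where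
  "word_prod ws = foldr (\<circ>) ws id"

definition cox_length :: "('e \<Rightarrow> 'e) set \<Rightarrow> ('e \<Rightarrow> 'e) \<Rightarrow> nat" where
  "cox_length S x = (LEAST k. \<exists>ws. set ws \<subseteq> S \<and> length ws = k \<and> word_prod ws = x)"

definition reduced_word :: "('e \<Rightarrow> 'e) set \<Rightarrow> ('e \<Rightarrow> 'e) \<Rightarrow> ('e \<Rightarrow> 'e) list \<Rightarrow> bool" where
  "reduced_word S x ws \<longleftrightarrow> set ws \<subseteq> S \<and> word_prod ws = x \<and> length ws = cox_length S x"

definition cox_reflections :: "('e \<Rightarrow> 'e) set \<Rightarrow> ('e \<Rightarrow> 'e) set" where
  "cox_reflections S = {word_prod ws \<circ> s \<circ> inv_into UNIV (word_prod ws) |ws s. set ws \<subseteq> S \<and> s \<in> S}"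

definition bruhat_le :: "('e \<Rightarrow> 'e) set \<Rightarrow> ('e \<Rightarrow> 'e) \<Rightarrow> ('e \<Rightarrow> 'e) \<Rightarrow> bool" where
  "bruhat_le S =
     (\<lambda>y x. \<exists>t\<in>cox_reflections S. x = y \<circ> t \<and> cox_length S y < cox_length S x)\<^sup>*\<^sup>*"


section \<open>Laurent polynomials\<close>

text \<open>The group ring of the integers: the coefficient of \<open>v\<^sup>k\<close> in \<open>p\<close> is \<open>lookup p k\<close>.\<close>

type_synonym laurent = "int \<Rightarrow>\<^sub>0 int"

definition vpow :: "int \<Rightarrow> laurent" where
  "vpow k = Poly_Mapping.single k 1"

definition bar :: "laurent \<Rightarrow> laurent" where
  "bar = Poly_Mapping.map_key uminus"

lemma lookup_bar: "Poly_Mapping.lookup (bar p) k = Poly_Mapping.lookup p (- k)"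
  by (simp add: bar_def Poly_Mapping.map_key.rep_eq inj_def)

definition polys_v :: "laurent set" where
  "polys_v = {p. \<forall>k\<in>Poly_Mapping.keys p. 0 \<le> k}"

definition v_polys_v :: "laurent set" where
  "v_polys_v = {p. \<forall>k\<in>Poly_Mapping.keys p. 0 < k}"


section \<open>The Hecke algebra\<close>

datatype 'g word = Word (letters: "'g list")

instantiation word :: (type) monoid_add
begin

definition zero_word :: "'a word" where
  "zero_word = Word []"

definition plus_word :: "'a word \<Rightarrow> 'a word \<Rightarrow> 'a word" where
  "plus_word a b = Word (letters a @ letters b)"

instance
  by standard (simp_all add: zero_word_def plus_word_def)

end

text \<open>Noncommutative polynomials with Laurent coefficients: with words as a monoid under
  concatenation, this is the monoid algebra.\<close>

type_synonym 'g ncpoly = "'g word \<Rightarrow>\<^sub>0 laurent"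

definition free_algebra :: "'g set \<Rightarrow> 'g ncpoly ring" where
  "free_algebra S =
     \<lparr>carrier = {p. \<forall>w\<in>Poly_Mapping.keys p. set (letters w) \<subseteq> S}, mult = (*), one = 1, ring.zero = 0, add = (+)\<rparr>"

definition nc_word :: "'g list \<Rightarrow> 'g ncpoly" where
  "nc_word ws = Poly_Mapping.single (Word ws) 1"

definition nc_const :: "laurent \<Rightarrow> 'g ncpoly" where
  "nc_const a = Poly_Mapping.single 0 a"

text \<open>\<open>alternating k s t\<close> is the word \<open>s t s \<dots>\<close> with \<open>k\<close> letters.\<close>

fun alternating :: "nat \<Rightarrow> 'g \<Rightarrow> 'g \<Rightarrow> 'g list" where
  "alternating 0 s t = []"
| "alternating (Suc k) s t = s # alternating k t s"

definition has_order :: "('e \<Rightarrow> 'e) \<Rightarrow> nat \<Rightarrow> bool" where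
  "has_order f k \<longleftrightarrow> 0 < k \<and> f ^^ k = id \<and> (\<forall>j. 0 < j \<and> j < k \<longrightarrow> f ^^ j \<noteq> id)"

definition hecke_relations :: "('e \<Rightarrow> 'e) set \<Rightarrow> ('e \<Rightarrow> 'e) ncpoly set" where
  "hecke_relations S =
     {nc_word [s] * nc_word [s] - (1 + nc_const (vpow (-1) - vpow 1) * nc_word [s]) |s. s \<in> S} \<union>
     {nc_word (alternating k s t) - nc_word (alternating k t s) |s t k.
        s \<in> S \<and> t \<in> S \<and> s \<noteq> t \<and> has_order (s \<circ> t) k}"

definition hecke_ideal :: "('e \<Rightarrow> 'e) set \<Rightarrow> ('e \<Rightarrow> 'e) ncpoly set" where
  "hecke_ideal S = genideal (free_algebra S) (hecke_relations S)"

type_synonym 'e hecke_elem = "('e \<Rightarrow> 'e) ncpoly set"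

definition hecke :: "('e \<Rightarrow> 'e) set \<Rightarrow> 'e hecke_elem ring" where
  "hecke S = free_algebra S Quot hecke_ideal S"

definition hecke_class :: "('e \<Rightarrow> 'e) set \<Rightarrow> ('e \<Rightarrow> 'e) ncpoly \<Rightarrow> 'e hecke_elem" where
  "hecke_class S p = hecke_ideal S +>\<^bsub>free_algebra S\<^esub> p"

definition hecke_const :: "('e \<Rightarrow> 'e) set \<Rightarrow> laurent \<Rightarrow> 'e hecke_elem" where
  "hecke_const S a = hecke_class S (nc_const a)"

definition hecke_gen :: "('e \<Rightarrow> 'e) set \<Rightarrow> ('e \<Rightarrow> 'e) \<Rightarrow> 'e hecke_elem" where
  "hecke_gen S s = hecke_class S (nc_word [s])"

text \<open>The standard basis element; by Matsumoto's theorem it does not depend on the choice of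
  the reduced word.\<close>

definition hecke_basis :: "('e \<Rightarrow> 'e) set \<Rightarrow> ('e \<Rightarrow> 'e) \<Rightarrow> 'e hecke_elem" where
  "hecke_basis S x = hecke_class S (nc_word (SOME ws. reduced_word S x ws))"

text \<open>The dualization is only constrained on the carrier, where it is unique. The group
  generated by \<open>S\<close> consists of the values of \<open>word_prod\<close>.\<close>

definition is_dualization :: "('e \<Rightarrow> 'e) set \<Rightarrow> ('e hecke_elem \<Rightarrow> 'e hecke_elem) \<Rightarrow> bool" where
  "is_dualization S d \<longleftrightarrow>
     d \<in> ring_hom (hecke S) (hecke S) \<and>
     (\<forall>h\<in>carrier (hecke S). d (d h) = h) \<and>
     d (hecke_const S (vpow 1)) = hecke_const S (vpow (-1)) \<and>
     (\<forall>x. (\<exists>ws. set ws \<subseteq> S \<and> word_prod ws = x) \<longrightarrow>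
        d (hecke_basis S x) = inv\<^bsub>hecke S\<^esub> (hecke_basis S (inv_into UNIV x)))"


section \<open>Modules induced from a parabolic subalgebra\<close>

text \<open>For \<open>S0 \<subseteq> S\<close>, the Hecke algebra of the parabolic subgroup generated by \<open>S0\<close>, as a
  subalgebra of \<open>hecke S\<close>.\<close>

definition hecke_sub :: "('e \<Rightarrow> 'e) set \<Rightarrow> ('e \<Rightarrow> 'e) set \<Rightarrow> 'e hecke_elem set" where
  "hecke_sub S S0 = generate_ring (hecke S) (range (hecke_const S) \<union> hecke_gen S ` S0)"

definition is_character ::
    "('e \<Rightarrow> 'e) set \<Rightarrow> ('e \<Rightarrow> 'e) set \<Rightarrow> laurent \<Rightarrow> ('e hecke_elem \<Rightarrow> laurent) \<Rightarrow> bool" where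
  "is_character S S0 u \<phi> \<longleftrightarrow>
     (\<forall>g\<in>hecke_sub S S0. \<forall>h\<in>hecke_sub S S0.
        \<phi> (g \<oplus>\<^bsub>hecke S\<^esub> h) = \<phi> g + \<phi> h \<and> \<phi> (g \<otimes>\<^bsub>hecke S\<^esub> h) = \<phi> g * \<phi> h) \<and>
     (\<forall>a. \<phi> (hecke_const S a) = a) \<and>
     (\<forall>s\<in>S0. \<phi> (hecke_gen S s) = u)"

text \<open>Unique on \<open>hecke_sub S S0\<close>, the only place where it is used below.\<close>

definition character ::
    "('e \<Rightarrow> 'e) set \<Rightarrow> ('e \<Rightarrow> 'e) set \<Rightarrow> laurent \<Rightarrow> 'e hecke_elem \<Rightarrow> laurent" where
  "character S S0 u = (SOME \<phi>. is_character S S0 u \<phi>)"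

text \<open>The tensor product of the Laurent polynomials, on which \<open>hecke_sub S S0\<close> acts from the right through
  \<open>character S S0 u\<close>, with the left module \<open>hecke S\<close>: the free abelian group on pairs
  modulo biadditivity and balancedness.\<close>

type_synonym 'e tensor_rep = "(laurent \<times> 'e hecke_elem) \<Rightarrow>\<^sub>0 int"

definition tensor_free :: "('e \<Rightarrow> 'e) set \<Rightarrow> 'e tensor_rep monoid" where
  "tensor_free S = free_Abelian_group (UNIV \<times> carrier (hecke S))"

definition tensor_relations ::
    "('e \<Rightarrow> 'e) set \<Rightarrow> ('e \<Rightarrow> 'e) set \<Rightarrow> laurent \<Rightarrow> 'e tensor_rep set" where
  "tensor_relations S S0 u =
     {frag_of (a + b, h) - frag_of (a, h) - frag_of (b, h) |a b h. h \<in> carrier (hecke S)} \<union>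
     {frag_of (a, g \<oplus>\<^bsub>hecke S\<^esub> h) - frag_of (a, g) - frag_of (a, h) |a g h.
        g \<in> carrier (hecke S) \<and> h \<in> carrier (hecke S)} \<union>
     {frag_of (a * character S S0 u g, h) - frag_of (a, g \<otimes>\<^bsub>hecke S\<^esub> h) |a g h.
        g \<in> hecke_sub S S0 \<and> h \<in> carrier (hecke S)}"

definition tensor_kernel ::
    "('e \<Rightarrow> 'e) set \<Rightarrow> ('e \<Rightarrow> 'e) set \<Rightarrow> laurent \<Rightarrow> 'e tensor_rep set" where
  "tensor_kernel S S0 u = generate (tensor_free S) (tensor_relations S S0 u)"

definition tensor_class ::
    "('e \<Rightarrow> 'e) set \<Rightarrow> ('e \<Rightarrow> 'e) set \<Rightarrow> laurent \<Rightarrow> 'e tensor_rep \<Rightarrow> 'e tensor_rep set" where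
  "tensor_class S S0 u c = tensor_kernel S S0 u #>\<^bsub>tensor_free S\<^esub> c"

text \<open>The additive map of the tensor product given on pure tensors by \<open>f\<close>, meaningful whenever
  the additive extension of \<open>f\<close> to the free abelian group preserves the relations (the union
  is then a single class).\<close>

definition tensor_map ::
    "('e \<Rightarrow> 'e) set \<Rightarrow> ('e \<Rightarrow> 'e) set \<Rightarrow> laurent \<Rightarrow>
     (laurent \<times> 'e hecke_elem \<Rightarrow> laurent \<times> 'e hecke_elem) \<Rightarrow> 'e tensor_rep set \<Rightarrow> 'e tensor_rep set"
  where
  "tensor_map S S0 u f X = (\<Union>c\<in>X. tensor_class S S0 u (frag_extend (\<lambda>p. frag_of (f p)) c))"

text \<open>A module record over the Laurent polynomials; its \<open>mult\<close> and \<open>one\<close> fields carry no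
  meaning.\<close>

definition induced_module ::
    "('e \<Rightarrow> 'e) set \<Rightarrow> ('e \<Rightarrow> 'e) set \<Rightarrow> laurent \<Rightarrow> (laurent, 'e tensor_rep set) module" where
  "induced_module S S0 u =
     (let Q = tensor_free S Mod tensor_kernel S S0 u in
      \<lparr>carrier = carrier Q, mult = undefined, one = undefined,
       ring.zero = \<one>\<^bsub>Q\<^esub>, add = mult Q,
       smult = (\<lambda>a. tensor_map S S0 u (\<lambda>(b, h). (a * b, h)))\<rparr>)"

definition induced_basis ::
    "('e \<Rightarrow> 'e) set \<Rightarrow> ('e \<Rightarrow> 'e) set \<Rightarrow> laurent \<Rightarrow> ('e \<Rightarrow> 'e) \<Rightarrow> 'e tensor_rep set" where
  "induced_basis S S0 u x = tensor_class S S0 u (frag_of (1, hecke_basis S x))"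

definition self_dual ::
    "('e \<Rightarrow> 'e) set \<Rightarrow> ('e \<Rightarrow> 'e) set \<Rightarrow> laurent \<Rightarrow> ('e hecke_elem \<Rightarrow> 'e hecke_elem) \<Rightarrow>
     'e tensor_rep set \<Rightarrow> bool" where
  "self_dual S S0 u d X \<longleftrightarrow> tensor_map S S0 u (\<lambda>(a, h). (bar a, d h)) X = X"


section \<open>Parabolic Kazhdan-Lusztig polynomials and their inverses\<close>

text \<open>The index set \<open>Wp\<close> is the set of distinguished coset representatives. The argument \<open>u\<close>
  selects the module: \<open>u = vpow (-1)\<close> gives the family \<open>m\<^sub>y\<^sub>,\<^sub>x\<close>, written \<open>m y x\<close>, and
  \<open>u = - vpow 1\<close> gives \<open>n\<^sub>y\<^sub>,\<^sub>x\<close>. Sums over \<open>Wp\<close> with finitely many nonzero terms are taken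
  over the support, since \<open>Wp\<close> is infinite.\<close>

definition kl_element ::
    "('e \<Rightarrow> 'e) set \<Rightarrow> ('e \<Rightarrow> 'e) set \<Rightarrow> ('e \<Rightarrow> 'e) set \<Rightarrow> laurent \<Rightarrow>
     (('e \<Rightarrow> 'e) \<Rightarrow> ('e \<Rightarrow> 'e) \<Rightarrow> laurent) \<Rightarrow> ('e \<Rightarrow> 'e) \<Rightarrow> 'e tensor_rep set" where
  "kl_element S S0 Wp u m x =
     (\<Oplus>\<^bsub>induced_module S S0 u\<^esub> y \<in> {y \<in> Wp. m y x \<noteq> 0}.
        m y x \<odot>\<^bsub>induced_module S S0 u\<^esub> induced_basis S S0 u y)"

definition is_kl_family ::
    "('e \<Rightarrow> 'e) set \<Rightarrow> ('e \<Rightarrow> 'e) set \<Rightarrow> ('e \<Rightarrow> 'e) set \<Rightarrow> laurent \<Rightarrow>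
     ('e hecke_elem \<Rightarrow> 'e hecke_elem) \<Rightarrow> (('e \<Rightarrow> 'e) \<Rightarrow> ('e \<Rightarrow> 'e) \<Rightarrow> laurent) \<Rightarrow> bool" where
  "is_kl_family S S0 Wp u d m \<longleftrightarrow>
     (\<forall>x\<in>Wp. \<forall>y\<in>Wp. m y x \<in> polys_v) \<and>
     (\<forall>x\<in>Wp. m x x = 1) \<and>
     (\<forall>x\<in>Wp. \<forall>y\<in>Wp. bruhat_le S y x \<and> y \<noteq> x \<longrightarrow> m y x \<in> v_polys_v) \<and>
     (\<forall>x\<in>Wp. \<forall>y\<in>Wp. \<not> bruhat_le S y x \<longrightarrow> m y x = 0) \<and>
     (\<forall>x\<in>Wp. self_dual S S0 u d (kl_element S S0 Wp u m x))"

text \<open>\<open>minv y x\<close> stands for \<open>m\<^sup>y\<^sup>,\<^sup>x\<close>.\<close>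

definition is_inverse_family ::
    "('e \<Rightarrow> 'e) set \<Rightarrow> ('e \<Rightarrow> 'e) set \<Rightarrow>
     (('e \<Rightarrow> 'e) \<Rightarrow> ('e \<Rightarrow> 'e) \<Rightarrow> laurent) \<Rightarrow> (('e \<Rightarrow> 'e) \<Rightarrow> ('e \<Rightarrow> 'e) \<Rightarrow> laurent) \<Rightarrow> bool" where
  "is_inverse_family S Wp m minv \<longleftrightarrow>
     (\<forall>x\<in>Wp. \<forall>y\<in>Wp. \<not> bruhat_le S x y \<longrightarrow> minv y x = 0) \<and>
     (\<forall>x\<in>Wp. \<forall>y\<in>Wp.
        (\<Sum>z | z \<in> Wp \<and> minv z x * m z y \<noteq> 0.
           (-1) ^ (cox_length S z + cox_length S x) * minv z x * m z y) = (if x = y then 1 else 0))"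

definition t_poly ::
    "('e \<Rightarrow> 'e) set \<Rightarrow> (('e \<Rightarrow> 'e) \<Rightarrow> ('e \<Rightarrow> 'e) \<Rightarrow> laurent) \<Rightarrow>
     (('e \<Rightarrow> 'e) \<Rightarrow> ('e \<Rightarrow> 'e) \<Rightarrow> laurent) \<Rightarrow> ('e \<Rightarrow> 'e) \<Rightarrow> ('e \<Rightarrow> 'e) \<Rightarrow> laurent" where
  "t_poly Wp n minv B A =
     (\<Sum>C | C \<in> Wp \<and> n C A * bar (minv C B) \<noteq> 0. n C A * bar (minv C B))"

end

(* Let the Hecke algebra act from the right on the Laurent-polynomial valued functions on the affine
   Weyl group.  The function w |-> u^l(w) on the finite parabolic subgroup, extended by 0, is an
   eigenvector f for the character u, so the maps a (x) h |-> a (f.h)(z) are well defined on the induced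
   module; for distinguished z they are dual to its standard basis.  The semilinear involution
   v |-> v^-1, H_s |-> -H_s exchanges the characters v^-1 and -v and commutes with the dualization, so it
   carries the self-dual elements given by the m_{y,x} to self-dual elements of the module N.  The t_{B,A}
   are the coefficients, with respect to the latter, of the self-dual element of N given by the n_{y,A},
   and are therefore self-dual.  That the reflections in the walls of the alcove form a Coxeter system
   comes from the cocycle sending w to the set of hyperplanes that separate the alcove from its image
   under w. *)
theory Submission
  imports Defs
begin

section \<open>Coxeter groups from reflection cocycles\<close>

text \<open>The Hecke algebra and both modules are given by generators and relations, so an equality
  of classes becomes an identity of Laurent polynomials only under a functional that kills every
  relation. Evaluations of functions on the group are such functionals, and they take the place of
  linear independence of the standard basis. The price is that operators on functions must satisfy
  the braid relations, which rests on the lengths of alternating words; hence the need for a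
  geometric description of length. The geometry hinges on one property of a wall: its part in the
  closed alcove spans the whole hyperplane. Therefore a simple reflection moves the base alcove
  across its own hyperplane only, and polyhedra theory shows that there are enough walls. In the
  final computation, consider the functional on N with N_C -> bar(m^{C,B}). Up to the sign (-1)^l(B)
  it is the coordinate at the transported self-dual element of index B, and t_{B,A} is its value at
  the self-dual element of index A.\<close>

abbreviation winv :: "('a \<Rightarrow> 'b) \<Rightarrow> 'b \<Rightarrow> 'a" where
  "winv \<equiv> inv_into UNIV"

section \<open>Words and the groups they generate\<close>

definition gen_group :: "('a \<Rightarrow> 'a) set \<Rightarrow> ('a \<Rightarrow> 'a) set" where
  "gen_group S = {word_prod ws |ws. set ws \<subseteq> S}"

text \<open>Induction eta-expands function-valued arguments, whereupon \<open>comp_apply\<close> would unfold compositions.\<close>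

bundle opaque_comp = comp_apply [simp del] id_apply [simp del]

context includes opaque_comp
begin

lemma word_prod_Nil [simp]: "word_prod [] = id"
  and word_prod_Cons [simp]: "word_prod (s # ws) = s \<circ> word_prod ws"
  by (simp_all add: word_prod_def id_apply comp_apply)

lemma word_prod_append [simp]: "word_prod (xs @ ys) = word_prod xs \<circ> word_prod ys"
  by (induction xs) (simp_all add: comp_assoc)

lemma word_prod_in_gen_group: "set ws \<subseteq> S \<Longrightarrow> word_prod ws \<in> gen_group S"
  unfolding gen_group_def by blast

lemma gen_groupE:
  assumes "w \<in> gen_group S"
  obtains ws where "set ws \<subseteq> S" "w = word_prod ws"
  using assms unfolding gen_group_def by blast

lemma id_in_gen_group [simp]: "id \<in> gen_group S"
  using word_prod_in_gen_group[of "[]" S] by simp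

lemma gen_in_gen_group: "s \<in> S \<Longrightarrow> s \<in> gen_group S"
  using word_prod_in_gen_group[of "[s]" S] by simp

lemma gen_group_comp [simp]:
  assumes "v \<in> gen_group S" "w \<in> gen_group S"
  shows "v \<circ> w \<in> gen_group S"
proof -
  obtain xs ys where "set xs \<subseteq> S" "v = word_prod xs" "set ys \<subseteq> S" "w = word_prod ys"
    using assms by (elim gen_groupE)
  then show ?thesis using word_prod_in_gen_group[of "xs @ ys" S] by simp
qed

lemma gen_group_induct [consumes 1, case_names id step]:
  assumes "w \<in> gen_group S" "P id"
    "\<And>s w. s \<in> S \<Longrightarrow> w \<in> gen_group S \<Longrightarrow> P w \<Longrightarrow> P (s \<circ> w)"
  shows "P w"
proof -
  obtain ws where "set ws \<subseteq> S" "w = word_prod ws" using assms(1) by (elim gen_groupE)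
  moreover have "set ws \<subseteq> S \<Longrightarrow> P (word_prod ws)" for ws
    by (induction ws) (auto simp: assms word_prod_in_gen_group)
  ultimately show ?thesis by simp
qed

lemma gen_group_mono: "S \<subseteq> T \<Longrightarrow> gen_group S \<subseteq> gen_group T"
  unfolding gen_group_def by blast

lemma finite_gen_group_bounded_words:
  "finite S \<Longrightarrow> finite {word_prod ws |ws. set ws \<subseteq> S \<and> length ws \<le> k}"
  using finite_lists_length_le[of S k] by (simp add: setcompr_eq_image)

lemma word_prod_rev:
  assumes "\<And>s. s \<in> S \<Longrightarrow> s \<circ> s = id" "set ws \<subseteq> S"
  shows "word_prod (rev ws) \<circ> word_prod ws = id"
  using assms(2)
proof (induction ws)
  case (Cons s ws)
  have "word_prod (rev (s # ws)) \<circ> word_prod (s # ws)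
      = word_prod (rev ws) \<circ> (s \<circ> s) \<circ> word_prod ws" by (simp add: comp_assoc)
  also have "\<dots> = word_prod (rev ws) \<circ> word_prod ws"
    using Cons.prems assms(1)[of s] by simp
  also have "\<dots> = id" using Cons by (simp only: set_simps insert_subset)
  finally show ?case .
qed simp

lemma alternating_add:
  "alternating (m + n) s t =
     alternating m s t @ (if even m then alternating n s t else alternating n t s)"
  by (induction m arbitrary: s t) auto

lemma rev_alternating:
  "rev (alternating k s t) = (if even k then alternating k t s else alternating k s t)"
proof (induction k arbitrary: s t)
  case (Suc k)
  have "alternating (Suc k) a b = alternating k a b @ [if even k then a else b]" for a b :: 'a
    using alternating_add[of k 1 a b] by simp
  from this[of s t] this[of t s] show ?case using Suc[of t s] Suc[of s t] by (cases "even k") simp_all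
qed simp

lemma length_alternating [simp]: "length (alternating k s t) = k"
  by (induction k arbitrary: s t) auto

lemma set_alternating: "set (alternating k s t) \<subseteq> {s, t}"
  by (induction k arbitrary: s t) auto

lemma word_prod_alternating_double: "word_prod (alternating (2 * k) s t) = (s \<circ> t) ^^ k"
  by (induction k) (auto simp: comp_assoc)

end

text \<open>A map \<open>N\<close> behaving like the set of reflecting hyperplanes (encoded by their reflections)
  that separate a base chamber from its image under \<open>w\<close>; its existence makes the group generated
  by \<open>S\<close> a Coxeter group.\<close>

locale reflection_cocycle =
  fixes S :: "('a \<Rightarrow> 'a) set" and N :: "('a \<Rightarrow> 'a) \<Rightarrow> ('a \<Rightarrow> 'a) set"
  assumes invol: "s \<in> S \<Longrightarrow> s \<circ> s = id"
    and N_id [simp]: "N id = {}"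
    and N_step: "s \<in> S \<Longrightarrow> w \<in> gen_group S \<Longrightarrow> t \<in> N (s \<circ> w) \<longleftrightarrow> (t = s) \<noteq> (s \<circ> t \<circ> s \<in> N w)"

begin

context includes opaque_comp
begin

section \<open>Inverses, length and the exchange condition\<close>

abbreviation G where "G \<equiv> gen_group S"

lemma invol2: "s \<in> S \<Longrightarrow> s \<circ> (s \<circ> x) = x"
  by (metis comp_assoc id_comp invol)

lemma gen_in [simp]: "s \<in> S \<Longrightarrow> s \<in> G"
  by (rule gen_in_gen_group)

text \<open>Reversing a word inverts it because the letters are involutions, and a two-sided inverse
  pins down \<open>inv_into\<close>. The subset \<open>T\<close> lets the same argument serve the
  parabolic subgroup.\<close>

lemma subgroup_inverse:
  assumes "T \<subseteq> S" "w \<in> gen_group T"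
  shows "winv w \<in> gen_group T \<and> winv w \<circ> w = id \<and> w \<circ> winv w = id"
proof -
  obtain ws where ws: "set ws \<subseteq> T" "w = word_prod ws" using assms by (elim gen_groupE)
  have 1: "word_prod (rev ws) \<circ> w = id"
    using ws assms word_prod_rev[of S ws] invol by auto
  have 2: "w \<circ> word_prod (rev ws) = id"
    using ws assms word_prod_rev[of S "rev ws"] invol by auto
  have "winv w = word_prod (rev ws)" using inv_unique_comp[OF 2 1] .
  then show ?thesis using 1 2 ws word_prod_in_gen_group[of "rev ws" T] by simp
qed

lemma inv_in [simp]: "w \<in> G \<Longrightarrow> winv w \<in> G"
  and inv_left [simp]: "w \<in> G \<Longrightarrow> winv w \<circ> w = id"
  and inv_right [simp]: "w \<in> G \<Longrightarrow> w \<circ> winv w = id"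
  using subgroup_inverse[of S w] by auto

lemma inv_cancel: "w \<in> G \<Longrightarrow> winv w \<circ> (w \<circ> x) = x" "w \<in> G \<Longrightarrow> w \<circ> (winv w \<circ> x) = x"
  by (metis comp_assoc id_comp inv_left, metis comp_assoc id_comp inv_right)

lemma inv_comp: "v \<in> G \<Longrightarrow> w \<in> G \<Longrightarrow> winv (v \<circ> w) = winv w \<circ> winv v"
  by (rule inv_unique_comp) (simp_all add: comp_assoc inv_cancel)

lemma inv_gen: "s \<in> S \<Longrightarrow> winv s = s"
  by (rule inv_unique_comp) (simp_all add: invol)

lemma inv_inv: "w \<in> G \<Longrightarrow> winv (winv w) = w"
  by (rule inv_unique_comp) simp_all

lemmas group_simps = comp_assoc invol invol2 inv_cancel inv_comp inv_gen inv_inv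

lemma inv_word_prod:
  assumes "set ws \<subseteq> S" shows "winv (word_prod ws) = word_prod (rev ws)"
  using assms by (induction ws) (simp_all add: group_simps word_prod_in_gen_group)

text \<open>The rule for one generator propagates along a word for \<open>v\<close>. With exclusive
  or read as addition mod 2, this is the cocycle identity N(vw) = N(v) + v N(w) v^-1.\<close>

lemma N_mult:
  assumes "v \<in> G" "w \<in> G"
  shows "t \<in> N (v \<circ> w) \<longleftrightarrow> (t \<in> N v) \<noteq> (winv v \<circ> t \<circ> v \<in> N w)"
  using assms(1)
proof (induction v arbitrary: t rule: gen_group_induct)
  case (step s v)
  have "winv (s \<circ> v) \<circ> t \<circ> (s \<circ> v) = winv v \<circ> (s \<circ> t \<circ> s) \<circ> v"
    using step by (simp add: group_simps)
  moreover have "t \<in> N (s \<circ> v \<circ> w) \<longleftrightarrow> (t = s) \<noteq> (s \<circ> t \<circ> s \<in> N (v \<circ> w))"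
    using N_step[of s "v \<circ> w" t] step assms(2) by (simp add: comp_assoc)
  ultimately show ?case using N_step[of s v t] step.IH[of "s \<circ> t \<circ> s"] step.hyps by metis
qed simp

lemma N_gen: "s \<in> S \<Longrightarrow> N s = {s}"
  using N_step[of s id] by auto

text \<open>By the cocycle identity and N(s) = {s}, passing from w to ws toggles the single
  reflection w s w^-1. Whether it already lies in N(w) decides between descent and ascent; this
  membership test stands for "ws is shorter than w" from here on.\<close>

lemma N_right:
  assumes "w \<in> G" "s \<in> S"
  shows "t \<in> N (w \<circ> s) \<longleftrightarrow> (t \<in> N w) \<noteq> (t = w \<circ> s \<circ> winv w)"
proof -
  have "winv w \<circ> t \<circ> w = s \<longleftrightarrow> t = w \<circ> s \<circ> winv w"
  proof
    assume "winv w \<circ> t \<circ> w = s"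
    then have "w \<circ> s \<circ> winv w = w \<circ> (winv w \<circ> t \<circ> w) \<circ> winv w" by simp
    then show "t = w \<circ> s \<circ> winv w" using assms by (simp add: group_simps)
  qed (use assms in \<open>simp add: group_simps\<close>)
  then show ?thesis using N_mult[of w s t] assms by (simp add: N_gen)
qed

lemma finite_N [simp]: "w \<in> G \<Longrightarrow> finite (N w)"
proof (induction w rule: gen_group_induct)
  case (step s w)
  have "N (s \<circ> w) \<subseteq> {s} \<union> (\<lambda>t. s \<circ> t \<circ> s) ` N w"
  proof
    fix t assume "t \<in> N (s \<circ> w)"
    then have "t = s \<or> s \<circ> t \<circ> s \<in> N w" using N_step step by blast
    moreover have "t = s \<circ> (s \<circ> t \<circ> s) \<circ> s" using step by (simp add: group_simps)
    ultimately show "t \<in> {s} \<union> (\<lambda>t. s \<circ> t \<circ> s) ` N w" by blast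
  qed
  then show ?case using step by (meson finite.emptyI finite.insertI finite_UnI finite_imageI finite_subset)
qed simp

text \<open>The second claim makes the truncated subtraction in the first one exact.\<close>

lemma card_N_right:
  assumes "w \<in> G" "s \<in> S"
  shows "card (N (w \<circ> s)) = (if w \<circ> s \<circ> winv w \<in> N w then card (N w) - 1 else card (N w) + 1)"
    and "w \<circ> s \<circ> winv w \<in> N w \<Longrightarrow> 0 < card (N w)"
proof -
  have "N (w \<circ> s) = (if w \<circ> s \<circ> winv w \<in> N w then N w - {w \<circ> s \<circ> winv w}
      else insert (w \<circ> s \<circ> winv w) (N w))"
    using N_right[OF assms] by auto
  then show "card (N (w \<circ> s)) = (if w \<circ> s \<circ> winv w \<in> N w then card (N w) - 1 else card (N w) + 1)"
    using assms by simp
  show "w \<circ> s \<circ> winv w \<in> N w \<Longrightarrow> 0 < card (N w)"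
    using assms finite_N by (auto simp: card_gt_0_iff)
qed

lemma card_N_mult_word:
  assumes "w \<in> G" "set ws \<subseteq> S"
  shows "card (N (w \<circ> word_prod ws)) \<le> card (N w) + length ws"
  using assms
proof (induction ws arbitrary: w)
  case (Cons s ws)
  have "card (N (w \<circ> s)) \<le> card (N w) + 1" using card_N_right(1)[of w s] Cons by auto
  moreover have "card (N ((w \<circ> s) \<circ> word_prod ws)) \<le> card (N (w \<circ> s)) + length ws"
    using Cons by simp
  ultimately show ?case by (simp add: comp_assoc)
qed simp

lemma card_N_word: "set ws \<subseteq> S \<Longrightarrow> card (N (word_prod ws)) \<le> length ws"
  using card_N_mult_word[of id ws] by simp

text \<open>Membership in N is the parity of the number of times the word crosses t. If it is odd,
  some letter performs a crossing, and multiplying by t deletes that letter; this works for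
  arbitrary words.\<close>

lemma exchange:
  assumes "set ws \<subseteq> S" "t \<in> N (word_prod ws)"
  shows "\<exists>vs. set vs \<subseteq> S \<and> length ws = Suc (length vs) \<and> t \<circ> word_prod ws = word_prod vs"
  using assms
proof (induction ws arbitrary: t)
  case (Cons s ws)
  show ?case
  proof (cases "t = s")
    case True
    then show ?thesis using Cons.prems by (intro exI[of _ ws]) (simp add: group_simps)
  next
    case False
    then have "s \<circ> t \<circ> s \<in> N (word_prod ws)"
      using Cons.prems N_step[of s "word_prod ws" t] by (simp add: word_prod_in_gen_group)
    then obtain vs where vs: "set vs \<subseteq> S" "length ws = Suc (length vs)"
        "s \<circ> t \<circ> s \<circ> word_prod ws = word_prod vs"
      using Cons.IH[of "s \<circ> t \<circ> s"] Cons.prems by auto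
    have "t \<circ> word_prod (s # ws) = s \<circ> (s \<circ> t \<circ> s \<circ> word_prod ws)"
      using Cons.prems by (simp add: group_simps)
    then show ?thesis using vs Cons.prems by (intro exI[of _ "s # vs"]) simp
  qed
qed simp

text \<open>The word is built letter by letter: an ascent appends the letter, a descent is absorbed
  by \<open>exchange\<close>, which returns a word one letter shorter. Together with
  \<open>card_N_word\<close> this identifies Coxeter length with the size of N.\<close>

lemma ex_word_card_N:
  assumes "w \<in> G"
  shows "\<exists>ws. set ws \<subseteq> S \<and> word_prod ws = w \<and> length ws = card (N w)"
proof -
  obtain us where "set us \<subseteq> S" "w = word_prod us" using assms by (elim gen_groupE)
  moreover have "set us \<subseteq> S \<Longrightarrow> \<exists>ws. set ws \<subseteq> S \<and> word_prod ws = word_prod us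
      \<and> length ws = card (N (word_prod us))" for us
  proof (induction us rule: rev_induct)
    case (snoc s us)
    then obtain ws where ws: "set ws \<subseteq> S" "word_prod ws = word_prod us"
        "length ws = card (N (word_prod us))" by auto
    let ?w = "word_prod us" and ?r = "word_prod us \<circ> s \<circ> winv (word_prod us)"
    have w: "?w \<in> G" "s \<in> S" using snoc.prems by (auto simp: word_prod_in_gen_group)
    show ?case
    proof (cases "?r \<in> N ?w")
      case True
      then obtain vs where vs: "set vs \<subseteq> S" "length ws = Suc (length vs)" "?r \<circ> ?w = word_prod vs"
        using exchange[of ws ?r] ws by auto
      then have "word_prod vs = ?w \<circ> s" using w by (simp add: group_simps)
      then show ?thesis using vs ws True card_N_right(1)[OF w] by (intro exI[of _ vs]) simp
    next
      case False
      then show ?thesis using ws w card_N_right(1)[OF w] by (intro exI[of _ "ws @ [s]"]) simp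
    qed
  qed simp
  ultimately show ?thesis by blast
qed

lemma cox_length_eq: "w \<in> G \<Longrightarrow> cox_length S w = card (N w)"
  unfolding cox_length_def
  using ex_word_card_N[of w] card_N_word by (intro Least_equality) metis+

lemma reduced_word_iff:
  "reduced_word S w ws \<longleftrightarrow> set ws \<subseteq> S \<and> word_prod ws = w \<and> length ws = card (N w)"
  unfolding reduced_word_def using cox_length_eq word_prod_in_gen_group by metis

lemma reduced_word_some: "w \<in> G \<Longrightarrow> reduced_word S w (SOME ws. reduced_word S w ws)"
  by (rule someI_ex) (simp only: reduced_word_iff ex_word_card_N)

lemma card_N_inv:
  assumes "w \<in> G" shows "card (N (winv w)) = card (N w)"
proof -
  have *: "card (N (winv w)) \<le> card (N w)" if w: "w \<in> G" for w
  proof -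
    obtain ws where ws: "set ws \<subseteq> S" "word_prod ws = w" "length ws = card (N w)"
      using ex_word_card_N[OF w] by blast
    have "winv w = word_prod (rev ws)" using inv_word_prod ws by auto
    then show ?thesis using card_N_word[of "rev ws"] ws by simp
  qed
  show ?thesis using *[OF assms] *[of "winv w"] assms by (simp add: inv_inv)
qed

lemma card_N_eq_0: "w \<in> G \<Longrightarrow> N w = {} \<Longrightarrow> w = id"
  using ex_word_card_N[of w] by auto

lemma reduced_snoc:
  assumes "set (ws @ [s]) \<subseteq> S" "card (N (word_prod (ws @ [s]))) = Suc (length ws)"
  shows "card (N (word_prod ws)) = length ws"
    and "word_prod ws \<circ> s \<circ> winv (word_prod ws) \<notin> N (word_prod ws)"
proof -
  have w: "word_prod ws \<in> G" "s \<in> S" using assms by (auto simp: word_prod_in_gen_group)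
  have "card (N (word_prod ws)) \<le> length ws" using assms card_N_word by simp
  moreover have "card (N (word_prod ws \<circ> s)) = Suc (length ws)" using assms(2) by simp
  moreover have "\<not> P \<and> c = n" if "c \<le> n" "c' = Suc n" "c' = (if P then c - 1 else c + 1)"
    for P and c c' n :: nat
    using that by (auto split: if_splits)
  ultimately have "word_prod ws \<circ> s \<circ> winv (word_prod ws) \<notin> N (word_prod ws) \<and>
      card (N (word_prod ws)) = length ws"
    using card_N_right(1)[OF w] by blast
  then show "card (N (word_prod ws)) = length ws"
    "word_prod ws \<circ> s \<circ> winv (word_prod ws) \<notin> N (word_prod ws)" by blast+
qed

lemma reduced_Cons:
  assumes "set (s # ws) \<subseteq> S" "card (N (word_prod (s # ws))) = Suc (length ws)"
  shows "card (N (word_prod ws)) = length ws" and "s \<notin> N (word_prod ws)"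
proof -
  have w: "word_prod ws \<in> G" "s \<in> S" using assms by (auto simp: word_prod_in_gen_group)
  obtain vs where vs: "set vs \<subseteq> S" "word_prod vs = word_prod ws" "length vs = card (N (word_prod ws))"
    using ex_word_card_N[OF w(1)] by blast
  have "card (N (word_prod (s # vs))) \<le> Suc (length vs)" using card_N_word[of "s # vs"] vs w by simp
  then have "length ws \<le> card (N (word_prod ws))" using vs assms by simp
  then show "card (N (word_prod ws)) = length ws" using card_N_word[of ws] assms by simp
  show "s \<notin> N (word_prod ws)"
  proof
    assume "s \<in> N (word_prod ws)"
    then obtain us where "set us \<subseteq> S" "length ws = Suc (length us)" "s \<circ> word_prod ws = word_prod us"
      using exchange[of ws s] assms by auto
    then show False using card_N_word[of us] assms(2) by simp
  qed
qed

section \<open>Bruhat order and finiteness of length balls\<close>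

lemma cox_reflections_gen:
  assumes "t \<in> cox_reflections S" shows "t \<in> G \<and> t \<circ> t = id"
proof -
  obtain ws s where ws: "set ws \<subseteq> S" "s \<in> S" "t = word_prod ws \<circ> s \<circ> winv (word_prod ws)"
    using assms unfolding cox_reflections_def by blast
  then show ?thesis by (simp add: group_simps word_prod_in_gen_group)
qed

text \<open>Induction from \<open>x\<close> downwards: t is an involution in the group, so z = yt
  gives y = zt and membership passes from z to y. With \<open>finite_length_le\<close> the length
  bound makes every Bruhat interval below \<open>x\<close> finite, and with it the Kazhdan-Lusztig
  sums.\<close>

lemma bruhat_le_length:
  assumes "bruhat_le S y x" "x \<in> G"
  shows "y \<in> G \<and> (y = x \<or> cox_length S y < cox_length S x)"
  using assms unfolding bruhat_le_def
proof (induction rule: converse_rtranclp_induct)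
  case (step y z)
  then obtain t where t: "t \<in> cox_reflections S" "z = y \<circ> t" "cox_length S y < cox_length S z" by blast
  have "z \<circ> t = y \<circ> (t \<circ> t)" using t by (simp add: comp_assoc)
  then have "y = z \<circ> t" using cox_reflections_gen[of t] t by simp
  moreover have "z \<in> G" "z = x \<or> cox_length S z < cox_length S x" using step by auto
  ultimately show ?case using t cox_reflections_gen[of t] gen_group_comp[of z S t] by auto
qed simp

lemma finite_length_le:
  assumes "finite S" shows "finite {w \<in> G. cox_length S w \<le> k}"
proof (rule finite_subset[OF _ finite_gen_group_bounded_words[OF assms, of k]])
  show "{w \<in> G. cox_length S w \<le> k} \<subseteq> {word_prod ws |ws. set ws \<subseteq> S \<and> length ws \<le> k}"
    using ex_word_card_N by (fastforce simp: cox_length_eq)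
qed

section \<open>Alternating words and the braid relations in the group\<close>

lemma alternating_reflection:
  assumes "s \<in> S" "t \<in> S"
  shows "word_prod (alternating i s t) \<circ> (if even i then s else t) \<circ> winv (word_prod (alternating i s t))
    = (s \<circ> t) ^^ i \<circ> s"
  using assms
proof (induction i arbitrary: s t)
  case (Suc i)
  have sub: "word_prod (alternating i t s) \<in> G"
    using set_alternating[of i t s] Suc.prems by (intro word_prod_in_gen_group) auto
  have pow: "s \<circ> ((t \<circ> s) ^^ i \<circ> t) = (s \<circ> t) ^^ Suc i" for i
    by (induction i) (simp_all add: comp_assoc)
  have "word_prod (alternating (Suc i) s t) \<circ> (if even (Suc i) then s else t)
      \<circ> winv (word_prod (alternating (Suc i) s t))
    = s \<circ> (word_prod (alternating i t s) \<circ> (if even i then t else s)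
      \<circ> winv (word_prod (alternating i t s))) \<circ> s"
    using Suc.prems sub by (simp add: group_simps)
  also have "\<dots> = s \<circ> ((t \<circ> s) ^^ i \<circ> t) \<circ> s" using Suc by simp
  finally show ?case by (simp only: pow)
qed (simp add: comp_assoc)

text \<open>Letter number i, counted from 0, crosses the reflection (st)^i s. For i below the order
  of st these are pairwise different, so each letter adds a new element to N.\<close>

lemma alternating_reduced:
  assumes "s \<in> S" "t \<in> S" "has_order (s \<circ> t) k" "i \<le> k"
  shows "card (N (word_prod (alternating i s t))) = i"
proof -
  let ?r = "\<lambda>i. (s \<circ> t) ^^ i \<circ> s"
  have pow_inj: "(s \<circ> t) ^^ a \<noteq> (s \<circ> t) ^^ b" if "a < b" "b < k" for a b
  proof
    assume eq: "(s \<circ> t) ^^ a = (s \<circ> t) ^^ b"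
    have "(s \<circ> t) ^^ a \<in> G" for a by (induction a) (simp_all add: assms)
    moreover have "(s \<circ> t) ^^ b = (s \<circ> t) ^^ a \<circ> (s \<circ> t) ^^ (b - a)"
      using that by (simp add: funpow_add[symmetric])
    ultimately have "(s \<circ> t) ^^ (b - a) = id"
      using eq inv_cancel(1)[of "(s \<circ> t) ^^ a" "(s \<circ> t) ^^ (b - a)"] by simp
    then show False using assms(3) that unfolding has_order_def
      by (metis less_imp_diff_less zero_less_diff)
  qed
  have r_inj: "?r a \<noteq> ?r b" if "a < b" "b < k" for a b
  proof
    assume "?r a = ?r b"
    then have "(?r a) \<circ> s = (?r b) \<circ> s" by simp
    then show False using pow_inj[OF that] assms by (simp add: group_simps)
  qed
  have "N (word_prod (alternating i s t)) \<subseteq> ?r ` {..<i} \<and> card (N (word_prod (alternating i s t))) = i"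
    using assms(4)
  proof (induction i)
    case (Suc i)
    let ?w = "word_prod (alternating i s t)" and ?x = "if even i then s else t"
    have w: "?w \<in> G" "?x \<in> S"
      using set_alternating[of i s t] assms by (auto intro!: word_prod_in_gen_group)
    have e: "word_prod (alternating (Suc i) s t) = ?w \<circ> ?x"
      using alternating_add[of i 1 s t] by simp
    have r: "?w \<circ> ?x \<circ> winv ?w = ?r i" by (rule alternating_reflection[OF assms(1,2)])
    have "?r i \<notin> N ?w" using Suc r_inj[of _ i] by fastforce
    moreover have "N ?w \<subseteq> ?r ` {..<Suc i}" using Suc by fastforce
    ultimately show ?case
      unfolding e using card_N_right(1)[OF w] N_right[OF w] Suc unfolding r by auto
  qed simp
  then show ?thesis by simp
qed

lemma has_order_commute:
  assumes "s \<in> S" "t \<in> S" "has_order (s \<circ> t) k" shows "has_order (t \<circ> s) k"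
proof -
  have conj: "(b \<circ> a) ^^ j = b \<circ> (a \<circ> b) ^^ j \<circ> b" if "a \<in> S" "b \<in> S" for a b j
    using that by (induction j) (simp_all add: group_simps)
  have triv: "(b \<circ> a) ^^ j = id" if "a \<in> S" "b \<in> S" "(a \<circ> b) ^^ j = id" for a b j
    using conj[OF that(1,2), of j] that by (simp add: invol)
  have "((t \<circ> s) ^^ j = id) = ((s \<circ> t) ^^ j = id)" for j
    using triv[of s t j] triv[of t s j] assms by blast
  then show ?thesis using assms unfolding has_order_def by auto
qed

text \<open>The alternating word of length 2k spells (st)^k = id, so its second half is the inverse
  of the first, that is, the first half reversed. The parity of k decides both which word the second
  half is and what reversal does; in either case the two words of length k agree.\<close>

lemma alternating_eq:
  assumes "s \<in> S" "t \<in> S" "has_order (s \<circ> t) k"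
  shows "word_prod (alternating k s t) = word_prod (alternating k t s)"
proof -
  let ?A = "alternating k s t" and ?B = "alternating k t s"
  have sub: "set ?A \<subseteq> S" "set ?B \<subseteq> S"
    using set_alternating[of k s t] set_alternating[of k t s] assms by auto
  have "(s \<circ> t) ^^ k = id" using assms(3) unfolding has_order_def by blast
  then have "word_prod (alternating (k + k) s t) = id"
    by (simp only: word_prod_alternating_double mult_2[symmetric])
  then have 1: "word_prod ?A \<circ> word_prod (if even k then ?A else ?B) = id"
    by (simp only: alternating_add word_prod_append)
  have 2: "word_prod (rev ?A) \<circ> word_prod ?A = id"
    using word_prod_rev[of S ?A] invol sub(1) by blast
  have "word_prod (rev ?A) = word_prod (rev ?A) \<circ> (word_prod ?A \<circ> word_prod (if even k then ?A else ?B))"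
    using 1 by (simp only: comp_id)
  also have "\<dots> = word_prod (if even k then ?A else ?B)"
    by (simp only: comp_assoc[symmetric] 2 id_comp)
  finally show ?thesis unfolding rev_alternating by (cases "even k") simp_all
qed

end

end

section \<open>The Hecke algebra and its regular representation\<close>

lemma poly_mapping_add_induct [case_names single add]:
  fixes p :: "'a \<Rightarrow>\<^sub>0 'b::monoid_add"
  assumes single: "\<And>k c. P (Poly_Mapping.single k c)" and add: "\<And>p q. P p \<Longrightarrow> P q \<Longrightarrow> P (p + q)"
  shows "P p"
proof (induction p rule: update_induct)
  case const
  show ?case using single[of _ 0] by simp
next
  case (update f a b)
  have "Poly_Mapping.update a b f = f + Poly_Mapping.single a b"
    using update(1)
    by (intro poly_mapping_eqI)
      (auto simp: lookup_update lookup_add lookup_single when_def in_keys_iff)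
  then show ?case using add single update by simp
qed

lemma bar_add [simp]: "bar (p + q) = bar p + bar q"
  by (rule poly_mapping_eqI) (simp add: lookup_bar lookup_add)

lemma bar_uminus [simp]: "bar (- p) = - bar p"
  by (rule poly_mapping_eqI) (simp add: lookup_bar)

lemma bar_minus [simp]: "bar (p - q) = bar p - bar q"
  by (rule poly_mapping_eqI) (simp add: lookup_bar lookup_minus)

lemma bar_zero [simp]: "bar 0 = 0"
  by (rule poly_mapping_eqI) (simp add: lookup_bar)

lemma bar_single: "bar (Poly_Mapping.single k c) = Poly_Mapping.single (- k) c"
  by (rule poly_mapping_eqI) (auto simp: lookup_bar lookup_single when_def)

lemma bar_vpow [simp]: "bar (vpow k) = vpow (- k)"
  by (simp add: vpow_def bar_single)

lemma bar_one [simp]: "bar 1 = 1"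
  using bar_vpow[of 0] by (simp add: vpow_def)

lemma bar_bar [simp]: "bar (bar p) = p"
  by (rule poly_mapping_eqI) (simp add: lookup_bar)

lemma bar_mult [simp]: "bar (p * q) = bar p * bar q"
proof (induction p rule: poly_mapping_add_induct)
  case (single k c)
  show ?case
    by (induction q rule: poly_mapping_add_induct) (simp_all add: mult_single bar_single distrib_left)
qed (simp add: distrib_right)

lemma bar_power [simp]: "bar (p ^ n) = bar p ^ n"
  by (induction n) simp_all

lemma bar_sum: "bar (sum f A) = (\<Sum>x\<in>A. bar (f x))"
  by (induction A rule: infinite_finite_induct) simp_all

lemma bar_eq_0_iff [simp]: "bar p = 0 \<longleftrightarrow> p = 0"
  by (metis bar_bar bar_zero)

lemma vpow_mult: "vpow a * vpow b = vpow (a + b)"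
  by (simp add: vpow_def mult_single)

text \<open>The coefficient of H_s in the quadratic relation, not the usual Hecke parameter. Since
  bar negates it, the semilinear substitution of -H_s for H_s preserves that relation.\<close>

definition hecke_q :: laurent where
  "hecke_q = vpow (- 1) - vpow 1"

lemma bar_hecke_q [simp]: "bar hecke_q = - hecke_q"
  by (simp add: hecke_q_def)

lemma hecke_char_quadratic:
  "u \<in> {vpow (- 1), - vpow 1} \<Longrightarrow> u * u = 1 + hecke_q * u"
  by (auto simp: hecke_q_def algebra_simps vpow_mult) (simp_all add: vpow_def)

section \<open>The Hecke algebra as a quotient of the free algebra\<close>

lemma keys_free_algebra:
  "p \<in> carrier (free_algebra S) \<longleftrightarrow> (\<forall>w\<in>Poly_Mapping.keys p. set (letters w) \<subseteq> S)"
  by (simp add: free_algebra_def)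

lemma free_algebra_ops [simp]:
  "mult (free_algebra S) = (*)" "one (free_algebra S) = 1"
  "ring.zero (free_algebra S) = 0" "add (free_algebra S) = (+)"
  by (simp_all add: free_algebra_def)

lemma nc_word_in [simp]: "set ws \<subseteq> S \<Longrightarrow> nc_word ws \<in> carrier (free_algebra S)"
  and nc_const_in [simp]: "nc_const a \<in> carrier (free_algebra S)"
  by (auto simp: keys_free_algebra nc_word_def nc_const_def zero_word_def split: if_splits)

lemma nc_word_append: "nc_word (xs @ ys) = nc_word xs * nc_word ys"
  by (simp add: nc_word_def mult_single plus_word_def)

lemma free_algebra_closed:
  assumes "p \<in> carrier (free_algebra S)" "q \<in> carrier (free_algebra S)"
  shows "p + q \<in> carrier (free_algebra S)" "p * q \<in> carrier (free_algebra S)"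
    "- p \<in> carrier (free_algebra S)" "p - q \<in> carrier (free_algebra S)"
proof -
  show "p + q \<in> carrier (free_algebra S)"
    using assms Poly_Mapping.keys_add[of p q] by (auto simp: keys_free_algebra)
  show "- p \<in> carrier (free_algebra S)"
    using assms by (simp add: keys_free_algebra)
  show "p - q \<in> carrier (free_algebra S)"
    using assms keys_diff[of p q] by (auto simp: keys_free_algebra)
  show "p * q \<in> carrier (free_algebra S)"
    unfolding keys_free_algebra
  proof
    fix w assume "w \<in> Poly_Mapping.keys (p * q)"
    then obtain x y where "w = x + y" "x \<in> Poly_Mapping.keys p" "y \<in> Poly_Mapping.keys q"
      using keys_mult[of p q] by blast
    then show "set (letters w) \<subseteq> S"
      using assms by (auto simp: keys_free_algebra plus_word_def)
  qed
qed

lemma free_algebra_0_1 [simp]: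
  "0 \<in> carrier (free_algebra S)" "1 \<in> carrier (free_algebra S)"
  using nc_const_in[of 1 S] by (simp_all add: keys_free_algebra nc_const_def)

lemma ring_free_algebra: "ring (free_algebra S)"
proof (rule ringI)
  show "abelian_group (free_algebra S)"
  proof (rule abelian_groupI)
    fix x assume "x \<in> carrier (free_algebra S)"
    then show "\<exists>y\<in>carrier (free_algebra S). y \<oplus>\<^bsub>free_algebra S\<^esub> x = \<zero>\<^bsub>free_algebra S\<^esub>"
      by (intro bexI[of _ "- x"]) (simp_all add: free_algebra_closed)
  qed (simp_all add: free_algebra_closed algebra_simps)
  show "Group.monoid (free_algebra S)"
    by (rule monoidI) (simp_all add: free_algebra_closed algebra_simps)
qed (simp_all add: algebra_simps)

lemma hecke_relations_in: "hecke_relations S \<subseteq> carrier (free_algebra S)"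
proof -
  have "nc_word (alternating k s t) \<in> carrier (free_algebra S)" if "s \<in> S" "t \<in> S" for k s t
    using set_alternating[of k s t] that by (intro nc_word_in) auto
  then show ?thesis
    unfolding hecke_relations_def by (auto intro!: free_algebra_closed)
qed

lemma ideal_hecke_ideal: "ideal (hecke_ideal S) (free_algebra S)"
  unfolding hecke_ideal_def using ring_free_algebra hecke_relations_in by (rule ring.genideal_ideal)

lemma ring_hecke: "ring (hecke S)"
  unfolding hecke_def using ideal_hecke_ideal by (rule ideal.quotient_is_ring)

lemma hecke_class_hom: "hecke_class S \<in> ring_hom (free_algebra S) (hecke S)"
proof -
  have "hecke_class S = (+>\<^bsub>free_algebra S\<^esub>) (hecke_ideal S)"
    by (rule ext) (simp add: hecke_class_def)
  then show ?thesis unfolding hecke_def using ideal.rcos_ring_hom[OF ideal_hecke_ideal] by simp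
qed

lemma hecke_carrierE:
  assumes "h \<in> carrier (hecke S)"
  obtains p where "p \<in> carrier (free_algebra S)" "h = hecke_class S p"
  using assms unfolding hecke_def hecke_class_def FactRing_def A_RCOSETS_defs a_r_coset_def[symmetric]
  by auto

lemma hecke_class_in [simp]: "p \<in> carrier (free_algebra S) \<Longrightarrow> hecke_class S p \<in> carrier (hecke S)"
  using ring_hom_closed[OF hecke_class_hom] .

lemma hecke_class_ops:
  assumes "p \<in> carrier (free_algebra S)" "q \<in> carrier (free_algebra S)"
  shows "hecke_class S (p * q) = hecke_class S p \<otimes>\<^bsub>hecke S\<^esub> hecke_class S q"
    and "hecke_class S (p + q) = hecke_class S p \<oplus>\<^bsub>hecke S\<^esub> hecke_class S q"
  using ring_hom_mult[OF hecke_class_hom assms] ring_hom_add[OF hecke_class_hom assms] by simp_all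

lemma hecke_class_one: "hecke_class S 1 = \<one>\<^bsub>hecke S\<^esub>"
  using ring_hom_one[OF hecke_class_hom] by simp

lemma hecke_class_eqI:
  assumes "p \<in> carrier (free_algebra S)" "q \<in> carrier (free_algebra S)" "p - q \<in> hecke_relations S"
  shows "hecke_class S p = hecke_class S q"
proof -
  interpret I: ideal "hecke_ideal S" "free_algebra S" by (rule ideal_hecke_ideal)
  have "p - q \<in> hecke_ideal S"
    unfolding hecke_ideal_def using I.genideal_self[OF hecke_relations_in] assms(3) by blast
  then have "p \<in> hecke_ideal S +>\<^bsub>free_algebra S\<^esub> q"
    unfolding a_r_coset_def' by (auto intro!: bexI[of _ "p - q"])
  then show ?thesis
    unfolding hecke_class_def using I.a_repr_independence[OF _ assms(2) I.a_subgroup] by simp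
qed

definition hecke_word :: "('e \<Rightarrow> 'e) set \<Rightarrow> ('e \<Rightarrow> 'e) list \<Rightarrow> 'e hecke_elem" where
  "hecke_word S ws = hecke_class S (nc_word ws)"

text \<open>The quadratic relation reads H_s (H_s - q) = 1, and constants commute with words, so H_s
  - q is a two-sided inverse.\<close>

lemma hecke_gen_unit:
  assumes "s \<in> S" shows "hecke_word S [s] \<in> Units (hecke S)"
proof -
  interpret H: ring "hecke S" by (rule ring_hecke)
  let ?T = "nc_word [s] :: ('a \<Rightarrow> 'a) ncpoly" and ?c = "nc_const hecke_q :: ('a \<Rightarrow> 'a) ncpoly"
  have in': "?T \<in> carrier (free_algebra S)" using assms by simp
  have comm: "?T * ?c = ?c * ?T"
    by (simp add: nc_word_def nc_const_def mult_single)
  have rel: "?T * ?T - (1 + ?c * ?T) \<in> hecke_relations S"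
    unfolding hecke_relations_def hecke_q_def using assms by blast
  have e1: "hecke_class S (?T * (?T - ?c)) = hecke_class S 1"
    using rel comm in' by (intro hecke_class_eqI) (simp_all add: free_algebra_closed algebra_simps)
  have e2: "hecke_class S ((?T - ?c) * ?T) = hecke_class S 1"
    using rel comm in' by (intro hecke_class_eqI) (simp_all add: free_algebra_closed algebra_simps)
  have "?T - ?c \<in> carrier (free_algebra S)" using in' by (simp add: free_algebra_closed)
  then show ?thesis
    using e1 e2 in' unfolding hecke_word_def Units_def
    by (auto simp: hecke_class_ops hecke_class_one intro!: bexI[of _ "hecke_class S (?T - ?c)"])
qed

lemma hecke_word_append:
  "set xs \<subseteq> S \<Longrightarrow> set ys \<subseteq> S \<Longrightarrow>
     hecke_word S (xs @ ys) = hecke_word S xs \<otimes>\<^bsub>hecke S\<^esub> hecke_word S ys"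
  unfolding hecke_word_def by (simp add: nc_word_append hecke_class_ops)

text \<open>The dualization is specified through \<open>inv\<close>, which is a genuine inverse on
  units only.\<close>

lemma hecke_word_unit:
  assumes "set ws \<subseteq> S" shows "hecke_word S ws \<in> Units (hecke S)"
proof -
  interpret H: ring "hecke S" by (rule ring_hecke)
  from assms show ?thesis
  proof (induction ws)
    case Nil
    have "nc_word [] = (1 :: ('a \<Rightarrow> 'a) ncpoly)"
      by (simp add: nc_word_def zero_word_def[symmetric])
    then show ?case by (simp add: hecke_word_def hecke_class_one)
  next
    case (Cons s ws)
    then show ?case using hecke_word_append[of "[s]" S ws] hecke_gen_unit[of s S] by simp
  qed
qed

section \<open>The right regular representation on functions on the group\<close>

context reflection_cocycle
begin

context includes opaque_comp
begin

definition funs :: "(('a \<Rightarrow> 'a) \<Rightarrow> laurent) set" where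
  "funs = {f. \<forall>w. w \<notin> G \<longrightarrow> f w = 0}"

text \<open>Right multiplication by \<open>H\<^sub>s\<close>, and left multiplication below, in the regular representation,
  acting on coefficient functions; since no finiteness of supports is needed, all functions on the
  group are allowed.\<close>

definition hecke_op :: "('a \<Rightarrow> 'a) \<Rightarrow> (('a \<Rightarrow> 'a) \<Rightarrow> laurent) \<Rightarrow> ('a \<Rightarrow> 'a) \<Rightarrow> laurent" where
  "hecke_op s f = (\<lambda>w. if w \<in> G
     then f (w \<circ> s) + (if w \<circ> s \<circ> winv w \<in> N w then hecke_q * f w else 0) else 0)"

definition left_op :: "('a \<Rightarrow> 'a) \<Rightarrow> (('a \<Rightarrow> 'a) \<Rightarrow> laurent) \<Rightarrow> ('a \<Rightarrow> 'a) \<Rightarrow> laurent" where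
  "left_op s f = (\<lambda>w. if w \<in> G
     then f (s \<circ> w) + (if s \<in> N w then hecke_q * f w else 0) else 0)"

text \<open>\<open>fold\<close> lets the leftmost letter act first, as befits a right action; hence
  the reversed order in \<open>act_mult\<close>.\<close>

definition word_op :: "('a \<Rightarrow> 'a) list \<Rightarrow> (('a \<Rightarrow> 'a) \<Rightarrow> laurent) \<Rightarrow> ('a \<Rightarrow> 'a) \<Rightarrow> laurent" where
  "word_op ws f = fold hecke_op ws f"

definition act :: "('a \<Rightarrow> 'a) ncpoly \<Rightarrow> (('a \<Rightarrow> 'a) \<Rightarrow> laurent) \<Rightarrow> ('a \<Rightarrow> 'a) \<Rightarrow> laurent" where
  "act p f = (\<lambda>w. \<Sum>x\<in>Poly_Mapping.keys p. Poly_Mapping.lookup p x * word_op (letters x) f w)"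

lemma funs_eqI: "f \<in> funs \<Longrightarrow> g \<in> funs \<Longrightarrow> (\<And>w. w \<in> G \<Longrightarrow> f w = g w) \<Longrightarrow> f = g"
proof
  fix w
  assume "f \<in> funs" "g \<in> funs" "\<And>w. w \<in> G \<Longrightarrow> f w = g w"
  then show "f w = g w" unfolding funs_def by (cases "w \<in> G") simp_all
qed

lemma word_op_simps:
  "word_op [] f = f" "word_op [s] f = hecke_op s f"
  "word_op (s # ws) f = word_op ws (hecke_op s f)"
  "word_op (xs @ ys) f = word_op ys (word_op xs f)"
  by (simp_all add: word_op_def comp_apply id_apply)

lemma hecke_op_in: "hecke_op s f \<in> funs" and left_op_in: "left_op s f \<in> funs"
  by (simp_all add: hecke_op_def left_op_def funs_def)

lemma word_op_in: "f \<in> funs \<Longrightarrow> word_op ws f \<in> funs"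
  by (induction ws rule: rev_induct) (simp_all add: word_op_simps hecke_op_in)

lemma hecke_op_linear:
  "hecke_op s (\<lambda>w. c * f w + g w) = (\<lambda>w. c * hecke_op s f w + hecke_op s g w)"
  by (rule ext) (simp add: hecke_op_def algebra_simps)

lemma word_op_linear:
  "word_op ws (\<lambda>w. c * f w + g w) = (\<lambda>w. c * word_op ws f w + word_op ws g w)"
  by (induction ws rule: rev_induct) (simp_all add: word_op_simps hecke_op_linear)

lemma word_op_zero: "word_op ws (\<lambda>w. 0) = (\<lambda>w. 0)"
  using word_op_linear[of ws 0 "\<lambda>w. 0" "\<lambda>w. 0"] word_op_linear[of ws "-1" "\<lambda>w. 0" "\<lambda>w. 0"]
  by (simp add: fun_eq_iff)

lemma word_op_scale: "word_op ws (\<lambda>w. c * f w) = (\<lambda>w. c * word_op ws f w)"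
  using word_op_linear[of ws c f "\<lambda>w. 0"] by (simp add: word_op_zero)

lemma act_superset:
  assumes "finite K" "Poly_Mapping.keys p \<subseteq> K"
  shows "act p f w = (\<Sum>x\<in>K. Poly_Mapping.lookup p x * word_op (letters x) f w)"
  unfolding act_def using assms
  by (intro sum.mono_neutral_left) (auto simp: in_keys_iff)

lemma act_single: "act (Poly_Mapping.single x c) f = (\<lambda>w. c * word_op (letters x) f w)"
  using act_superset[of "{x}" "Poly_Mapping.single x c" f] by (auto simp: fun_eq_iff)

lemma act_nc_word: "act (nc_word ws) f = word_op ws f"
  and act_nc_const: "act (nc_const a) f = (\<lambda>w. a * f w)"
  by (simp_all add: nc_word_def nc_const_def act_single zero_word_def word_op_simps)

lemma act_one: "act 1 f = f"
  using act_nc_const[of 1 f] by (simp add: nc_const_def)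

lemma act_add: "act (p + q) f = (\<lambda>w. act p f w + act q f w)"
proof
  fix w
  let ?K = "Poly_Mapping.keys p \<union> Poly_Mapping.keys q"
  have K: "finite ?K" "Poly_Mapping.keys p \<subseteq> ?K" "Poly_Mapping.keys q \<subseteq> ?K"
      "Poly_Mapping.keys (p + q) \<subseteq> ?K"
    using Poly_Mapping.keys_add[of p q] by auto
  show "act (p + q) f w = act p f w + act q f w"
    unfolding act_superset[OF K(1,2)] act_superset[OF K(1,3)] act_superset[OF K(1,4)]
    by (simp add: lookup_add distrib_right sum.distrib)
qed

lemma act_zero: "act 0 f = (\<lambda>w. 0)"
  by (simp add: act_def)

lemma act_uminus: "act (- p) f = (\<lambda>w. - act p f w)"
  by (rule ext) (simp add: act_def sum_negf)

lemma act_minus: "act (p - q) f = (\<lambda>w. act p f w - act q f w)"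
  using act_add[of p "- q" f] by (simp add: act_uminus)

lemma act_linear: "act p (\<lambda>w. c * f w + g w) = (\<lambda>w. c * act p f w + act p g w)"
  by (rule ext) (simp add: act_def word_op_linear, simp add: sum.distrib sum_distrib_left algebra_simps)

lemma act_on_zero: "act p (\<lambda>w. 0) = (\<lambda>w. 0)"
  by (simp add: act_def word_op_zero)

lemma act_scale: "act p (\<lambda>w. c * f w) = (\<lambda>w. c * act p f w)"
  using act_linear[of p c f "\<lambda>w. 0"] by (simp add: act_on_zero)

lemma act_plus: "act p (\<lambda>w. f w + g w) = (\<lambda>w. act p f w + act p g w)"
  using act_linear[of p 1 f g] by simp

lemma act_mult: "act (p * q) f = act q (act p f)"
proof (induction p rule: poly_mapping_add_induct)
  case (single x c)
  show ?case
  proof (induction q rule: poly_mapping_add_induct)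
    case (single y e)
    show ?case
      by (simp add: mult_single act_single plus_word_def word_op_simps word_op_scale mult_ac)
  next
    case (add q q')
    then show ?case by (simp only: distrib_left act_add)
  qed
next
  case (add p p')
  then show ?case by (simp only: distrib_right act_add act_plus)
qed

lemma act_in:
  assumes "f \<in> funs" shows "act p f \<in> funs"
  using word_op_in[OF assms] by (simp add: funs_def act_def)

text \<open>The condition says that ws is shorter than w, so it holds for exactly one of w and ws.
  In the square of \<open>hecke_op\<close> exactly one of the two evaluation points therefore
  contributes an inner correction term.\<close>

lemma descent_flip:
  assumes "w \<in> G" "s \<in> S"
  shows "w \<circ> s \<circ> s \<circ> winv (w \<circ> s) \<in> N (w \<circ> s) \<longleftrightarrow> w \<circ> s \<circ> winv w \<notin> N w"
  using N_right[OF assms, of "w \<circ> s \<circ> winv w"] assms by (simp add: group_simps)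

lemma hecke_op_quadratic:
  assumes "f \<in> funs" "s \<in> S"
  shows "hecke_op s (hecke_op s f) = (\<lambda>w. f w + hecke_q * hecke_op s f w)"
proof (rule funs_eqI[OF hecke_op_in])
  show "(\<lambda>w. f w + hecke_q * hecke_op s f w) \<in> funs"
    using assms(1) hecke_op_in[of s f] by (simp add: funs_def)
  fix w assume w: "w \<in> G"
  have ws: "w \<circ> s \<circ> s = w" using assms by (simp add: comp_assoc invol)
  have "hecke_op s f (w \<circ> s) =
      f w + (if w \<circ> s \<circ> winv w \<in> N w then 0 else hecke_q * f (w \<circ> s))"
    unfolding hecke_op_def using descent_flip[OF w assms(2)] w assms(2) by (simp add: ws)
  then show "hecke_op s (hecke_op s f) w = f w + hecke_q * hecke_op s f w"
    unfolding hecke_op_def[of s "hecke_op s f"] using w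
    by (simp add: hecke_op_def[of s f] distrib_left)
qed

text \<open>Both sides expand into the same terms unless \<open>w t w\<inverse> = s\<close>; in that case \<open>s w = w t\<close>, and the
  remaining terms cancel.\<close>

lemma left_op_commute:
  assumes "s \<in> S" "t \<in> S"
  shows "left_op s (hecke_op t f) = hecke_op t (left_op s f)"
proof (rule funs_eqI[OF left_op_in hecke_op_in])
  fix w assume w: "w \<in> G"
  define r where "r = w \<circ> t \<circ> winv w"
  have sw: "s \<circ> w \<in> G" and wt: "w \<circ> t \<in> G" using w assms by simp_all
  have d1: "(s \<circ> w) \<circ> t \<circ> winv (s \<circ> w) \<in> N (s \<circ> w) \<longleftrightarrow> (r = s) \<noteq> (r \<in> N w)"
  proof -
    have "(s \<circ> w) \<circ> t \<circ> winv (s \<circ> w) = s \<circ> r \<circ> s"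
      using w assms by (simp add: r_def group_simps)
    moreover have "s \<circ> (s \<circ> r \<circ> s) \<circ> s = r" using assms by (simp add: group_simps)
    moreover have "s \<circ> r \<circ> s = s \<longleftrightarrow> r = s"
    proof
      assume "s \<circ> r \<circ> s = s"
      then have "s \<circ> (s \<circ> r \<circ> s) \<circ> s = s \<circ> s \<circ> s" by simp
      then show "r = s" using assms by (simp add: group_simps)
    qed (use assms in \<open>simp add: group_simps\<close>)
    ultimately show ?thesis using N_step[of s w "s \<circ> r \<circ> s"] assms w by simp
  qed
  have d2: "s \<in> N (w \<circ> t) \<longleftrightarrow> (s \<in> N w) \<noteq> (s = r)"
    using N_right[of w t s] w assms unfolding r_def by simp
  have lhs: "left_op s (hecke_op t f) w =
      f (s \<circ> w \<circ> t) + (if (r = s) \<noteq> (r \<in> N w) then hecke_q * f (s \<circ> w) else 0)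
      + (if s \<in> N w then hecke_q * (f (w \<circ> t) + (if r \<in> N w then hecke_q * f w else 0)) else 0)"
    unfolding left_op_def hecke_op_def d1 r_def[symmetric] using w sw by simp
  have rhs: "hecke_op t (left_op s f) w =
      f (s \<circ> w \<circ> t) + (if (s \<in> N w) \<noteq> (s = r) then hecke_q * f (w \<circ> t) else 0)
      + (if r \<in> N w then hecke_q * (f (s \<circ> w) + (if s \<in> N w then hecke_q * f w else 0)) else 0)"
    unfolding left_op_def hecke_op_def d2 r_def[symmetric] using w wt by (simp add: comp_assoc)
  show "left_op s (hecke_op t f) w = hecke_op t (left_op s f) w"
  proof (cases "r = s")
    case True
    then have "s \<circ> w = w \<circ> t" using w unfolding r_def by (auto simp: group_simps)
    then show ?thesis unfolding lhs rhs using True by simp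
  next
    case False
    then show ?thesis unfolding lhs rhs by (simp add: algebra_simps)
  qed
qed

lemma left_op_word_op:
  assumes "s \<in> S" "set ws \<subseteq> S"
  shows "left_op s (word_op ws f) = word_op ws (left_op s f)"
  using assms(2) by (induction ws rule: rev_induct) (simp_all add: word_op_simps left_op_commute[OF assms(1)])

text \<open>Since left and right multiplication commute and left multiplication moves any group element to
  the identity, two right multiplications agree as soon as they agree at the identity.\<close>

lemma word_op_eqI:
  assumes sub: "set xs \<subseteq> S" "set ys \<subseteq> S"
    and at_id: "\<And>f. f \<in> funs \<Longrightarrow> word_op xs f id = word_op ys f id"
    and f: "f \<in> funs"
  shows "word_op xs f = word_op ys f"
proof (rule funs_eqI[OF word_op_in[OF f] word_op_in[OF f]])
  have *: "\<forall>f\<in>funs. word_op xs f (word_prod ws) = word_op ys f (word_prod ws)"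
    if "set ws \<subseteq> S" "card (N (word_prod ws)) = length ws" for ws
    using that
  proof (induction ws)
    case (Cons s ws)
    have s: "s \<in> S" "word_prod ws \<in> G" using Cons.prems by (auto simp: word_prod_in_gen_group)
    have red: "card (N (word_prod ws)) = length ws" "s \<notin> N (word_prod ws)"
      using reduced_Cons[of s ws] Cons.prems by simp_all
    \<comment> \<open>The word is reduced, so \<open>s\<close> is not in N of the remaining product
      and the correction term of \<open>left_op\<close> vanishes.\<close>
    have step: "g (word_prod (s # ws)) = left_op s g (word_prod ws)" for g
      using s red by (simp add: left_op_def)
    show ?case
    proof
      fix f assume "f \<in> funs"
      have "word_op xs f (word_prod (s # ws)) = word_op xs (left_op s f) (word_prod ws)"
        unfolding step left_op_word_op[OF s(1) sub(1)] ..
      also have "\<dots> = word_op ys (left_op s f) (word_prod ws)"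
        using Cons red left_op_in by simp
      also have "\<dots> = word_op ys f (word_prod (s # ws))"
        unfolding step left_op_word_op[OF s(1) sub(2)] ..
      finally show "word_op xs f (word_prod (s # ws)) = word_op ys f (word_prod (s # ws))" .
    qed
  qed (simp add: at_id)
  fix w assume "w \<in> G"
  then obtain ws where "set ws \<subseteq> S" "word_prod ws = w" "length ws = card (N w)"
    using ex_word_card_N by blast
  then show "word_op xs f w = word_op ys f w" using *[of ws] f by simp
qed

text \<open>The operator applied last is evaluated first, so evaluation walks from \<open>w\<close>
  along the reversed word. The length hypothesis forces each step of this walk to be an ascent,
  where \<open>hecke_op\<close> has no correction term.\<close>

lemma word_op_reduced:
  assumes "w \<in> G" "set ws \<subseteq> S"
    and "card (N (w \<circ> word_prod (rev ws))) = card (N w) + length ws"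
  shows "word_op ws f w = f (w \<circ> word_prod (rev ws))"
proof -
  have "\<forall>w\<in>G. card (N (w \<circ> word_prod (rev ws))) = card (N w) + length ws \<longrightarrow>
      word_op ws f w = f (w \<circ> word_prod (rev ws))"
    using assms(2)
  proof (induction ws rule: rev_induct)
    case (snoc s ws)
    show ?case
    proof (intro ballI impI)
      fix w assume w: "w \<in> G"
        and card: "card (N (w \<circ> word_prod (rev (ws @ [s])))) = card (N w) + length (ws @ [s])"
      have s: "s \<in> S" and ws: "set (rev ws) \<subseteq> S" using snoc.prems by auto
      have e: "w \<circ> word_prod (rev (ws @ [s])) = (w \<circ> s) \<circ> word_prod (rev ws)"
        by (simp add: comp_assoc)
      have le: "card (N ((w \<circ> s) \<circ> word_prod (rev ws))) \<le> card (N (w \<circ> s)) + length ws"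
        using card_N_mult_word[of "w \<circ> s" "rev ws"] w s ws by simp
      have up: "w \<circ> s \<circ> winv w \<notin> N w"
      proof
        assume "w \<circ> s \<circ> winv w \<in> N w"
        then have "card (N (w \<circ> s)) < card (N w)" using card_N_right[OF w s] by simp
        then show False using le card unfolding e by simp
      qed
      then have "card (N (w \<circ> s)) = card (N w) + 1" using card_N_right(1)[OF w s] by simp
      then have "word_op ws f (w \<circ> s) = f ((w \<circ> s) \<circ> word_prod (rev ws))"
        using snoc w s card unfolding e by simp
      then show "word_op (ws @ [s]) f w = f (w \<circ> word_prod (rev (ws @ [s])))"
        unfolding e using w up by (simp add: word_op_simps hecke_op_def)
    qed
  qed (simp add: word_op_simps)
  then show ?thesis using assms(1,3) by simp
qed

text \<open>By \<open>word_op_eqI\<close> only the value at the identity matters. Both alternating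
  words are reduced, so both operators read off \<open>f\<close> at one and the same element, the
  longest one of the dihedral group.\<close>

lemma word_op_braid:
  assumes "s \<in> S" "t \<in> S" "has_order (s \<circ> t) k" "f \<in> funs"
  shows "word_op (alternating k s t) f = word_op (alternating k t s) f"
proof (rule word_op_eqI[OF _ _ _ assms(4)])
  let ?A = "alternating k s t" and ?B = "alternating k t s"
  show sub: "set ?A \<subseteq> S" "set ?B \<subseteq> S"
    using set_alternating[of k s t] set_alternating[of k t s] assms by auto
  have card: "card (N (word_prod ?A)) = k" "card (N (word_prod ?B)) = k"
    using alternating_reduced[of _ _ k k] has_order_commute assms by blast+
  have eq: "word_prod (rev ?A) = word_prod (rev ?B)"
    unfolding rev_alternating using alternating_eq[OF assms(1-3)] by simp
  have "card (N (word_prod (rev ?A))) = k" "card (N (word_prod (rev ?B))) = k"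
    unfolding rev_alternating using card by simp_all
  then show "word_op ?A f id = word_op ?B f id" for f
    using word_op_reduced[of id ?A f] word_op_reduced[of id ?B f] sub eq by simp
qed

section \<open>Descent of the action to the Hecke algebra\<close>

lemma act_relations:
  assumes "p \<in> hecke_relations S" "f \<in> funs"
  shows "act p f = (\<lambda>w. 0)"
  using assms(1) unfolding hecke_relations_def
proof (elim UnE CollectE exE conjE)
  fix s
  assume p: "p = nc_word [s] * nc_word [s] - (1 + nc_const (vpow (- 1) - vpow 1) * nc_word [s])"
    and s: "s \<in> S"
  show "act p f = (\<lambda>w. 0)"
    using hecke_op_quadratic[OF assms(2) s] unfolding p hecke_q_def[symmetric]
    by (simp add: act_minus act_add act_mult act_one act_nc_word act_nc_const word_op_simps
        word_op_scale[of "[s]", unfolded word_op_simps])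
next
  fix s t k
  assume p: "p = nc_word (alternating k s t) - nc_word (alternating k t s)"
    and st: "s \<in> S" "t \<in> S" "has_order (s \<circ> t) k"
  show "act p f = (\<lambda>w. 0)"
    unfolding p using word_op_braid[OF st assms(2)] by (simp add: act_minus act_nc_word)
qed

text \<open>The elements annihilating all of \<open>funs\<close> form a two-sided ideal because
  \<open>funs\<close> is stable under the action. This ideal contains the relations, hence the ideal
  they generate.\<close>

lemma act_ideal:
  assumes "p \<in> hecke_ideal S" "f \<in> funs"
  shows "act p f = (\<lambda>w. 0)"
proof -
  interpret R: ring "free_algebra S" by (rule ring_free_algebra)
  let ?I = "{p \<in> carrier (free_algebra S). \<forall>f\<in>funs. act p f = (\<lambda>w. 0)}"
  have "ideal ?I (free_algebra S)"
  proof (rule idealI[OF R.ring_axioms])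
    show "subgroup ?I (add_monoid (free_algebra S))"
    proof
      fix x assume x: "x \<in> ?I"
      then have "- x \<in> ?I" using free_algebra_closed(3)[of x S x] by (simp add: act_uminus)
      moreover have "inv\<^bsub>add_monoid (free_algebra S)\<^esub> x = - x"
        using x R.minus_equality[of "- x" x] \<open>- x \<in> ?I\<close> unfolding a_inv_def by simp
      ultimately show "inv\<^bsub>add_monoid (free_algebra S)\<^esub> x \<in> ?I" by simp
    qed (auto simp: free_algebra_closed act_add act_zero)
  qed (auto simp: free_algebra_closed act_mult act_in act_on_zero)
  then have "hecke_ideal S \<subseteq> ?I"
    unfolding hecke_ideal_def
    using hecke_relations_in act_relations by (intro R.genideal_minimal) auto
  then show ?thesis using assms by blast
qed

text \<open>On \<open>funs\<close> the chosen representative does not matter, by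
  \<open>act_ideal\<close>; this is the reason for the membership hypotheses on \<open>f\<close>
  below.\<close>

definition hact :: "'a hecke_elem \<Rightarrow> (('a \<Rightarrow> 'a) \<Rightarrow> laurent) \<Rightarrow> ('a \<Rightarrow> 'a) \<Rightarrow> laurent" where
  "hact h f = act (SOME p. p \<in> h) f"

lemma hact_class:
  assumes "p \<in> carrier (free_algebra S)" "f \<in> funs"
  shows "hact (hecke_class S p) f = act p f"
proof -
  interpret I: ideal "hecke_ideal S" "free_algebra S" by (rule ideal_hecke_ideal)
  have "p \<in> hecke_class S p"
    unfolding hecke_class_def using I.a_rcos_self[OF assms(1)] by simp
  then have "(SOME p'. p' \<in> hecke_class S p) \<in> hecke_class S p" by (rule someI)
  then obtain i where i: "i \<in> hecke_ideal S" "(SOME p'. p' \<in> hecke_class S p) = i + p"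
    unfolding hecke_class_def a_r_coset_def' by auto
  then show ?thesis using act_ideal[OF i(1) assms(2)] by (simp add: hact_def act_add)
qed

lemma hact_in:
  assumes "h \<in> carrier (hecke S)" "f \<in> funs"
  shows "hact h f \<in> funs"
  using assms by (metis act_in hact_class hecke_carrierE)

lemma hact_mult:
  assumes "g \<in> carrier (hecke S)" "h \<in> carrier (hecke S)" "f \<in> funs"
  shows "hact (g \<otimes>\<^bsub>hecke S\<^esub> h) f = hact h (hact g f)"
proof -
  obtain p q where "p \<in> carrier (free_algebra S)" "g = hecke_class S p"
      "q \<in> carrier (free_algebra S)" "h = hecke_class S q"
    using assms by (metis hecke_carrierE)
  then show ?thesis
    using assms by (simp add: hecke_class_ops(1)[symmetric] hact_class free_algebra_closed act_mult act_in)
qed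

lemma hact_add:
  assumes "g \<in> carrier (hecke S)" "h \<in> carrier (hecke S)" "f \<in> funs"
  shows "hact (g \<oplus>\<^bsub>hecke S\<^esub> h) f = (\<lambda>w. hact g f w + hact h f w)"
proof -
  obtain p q where "p \<in> carrier (free_algebra S)" "g = hecke_class S p"
      "q \<in> carrier (free_algebra S)" "h = hecke_class S q"
    using assms by (metis hecke_carrierE)
  then show ?thesis
    using assms by (simp add: hecke_class_ops(2)[symmetric] hact_class free_algebra_closed act_add)
qed

lemma hact_one: "f \<in> funs \<Longrightarrow> hact \<one>\<^bsub>hecke S\<^esub> f = f"
  by (simp add: hecke_class_one[symmetric] hact_class act_one)

lemma hact_scale:
  assumes "h \<in> carrier (hecke S)" "f \<in> funs"
  shows "hact h (\<lambda>w. c * f w) = (\<lambda>w. c * hact h f w)"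
proof -
  obtain p where p: "p \<in> carrier (free_algebra S)" "h = hecke_class S p"
    using assms by (metis hecke_carrierE)
  have "(\<lambda>w. c * f w) \<in> funs" using assms(2) by (simp add: funs_def)
  then show ?thesis using p assms by (simp add: hact_class act_scale)
qed

lemma hact_word: "set ws \<subseteq> S \<Longrightarrow> f \<in> funs \<Longrightarrow> hact (hecke_word S ws) f = word_op ws f"
  unfolding hecke_word_def by (simp add: hact_class act_nc_word)

lemma hact_const: "f \<in> funs \<Longrightarrow> hact (hecke_const S a) f = (\<lambda>w. a * f w)"
  unfolding hecke_const_def by (simp add: hact_class act_nc_const)

end

end

section \<open>Induced modules\<close>

lemma frag_extend_sum_of:
  "finite A \<Longrightarrow> frag_extend f (\<Sum>y\<in>A. frag_of (g y)) = (\<Sum>y\<in>A. f (g y))"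
  by (induction A rule: finite_induct) (simp_all add: frag_extend_add)

section \<open>The tensor product by generators and relations\<close>

context
  fixes S S0 :: "('e \<Rightarrow> 'e) set" and u :: laurent
  assumes S0_sub: "S0 \<subseteq> S"
begin

lemma hecke_const_in: "hecke_const S a \<in> carrier (hecke S)"
  by (simp add: hecke_const_def)

lemma hecke_sub_in: "g \<in> hecke_sub S S0 \<Longrightarrow> g \<in> carrier (hecke S)"
proof -
  interpret H: ring "hecke S" by (rule ring_hecke)
  have "range (hecke_const S) \<union> hecke_gen S ` S0 \<subseteq> carrier (hecke S)"
    using S0_sub by (auto simp: hecke_const_in hecke_gen_def)
  then show "g \<in> hecke_sub S S0 \<Longrightarrow> g \<in> carrier (hecke S)"
    unfolding hecke_sub_def by (rule H.generate_ring_in_carrier)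
qed

lemma carrier_tensor_free:
  "c \<in> carrier (tensor_free S) \<longleftrightarrow> Poly_Mapping.keys c \<subseteq> UNIV \<times> carrier (hecke S)"
  by (simp add: tensor_free_def)

lemma tensor_free_ops [simp]:
  "x \<otimes>\<^bsub>tensor_free S\<^esub> y = x + y" "\<one>\<^bsub>tensor_free S\<^esub> = 0"
  by (simp_all add: tensor_free_def)

lemma comm_group_tensor_free: "comm_group (tensor_free S)"
  by (simp add: tensor_free_def abelian_free_Abelian_group)

lemma frag_of_in_tensor_free: "h \<in> carrier (hecke S) \<Longrightarrow> frag_of (a, h) \<in> carrier (tensor_free S)"
  by (simp add: carrier_tensor_free)

lemma tensor_free_diff:
  "c \<in> carrier (tensor_free S) \<Longrightarrow> e \<in> carrier (tensor_free S) \<Longrightarrow> c - e \<in> carrier (tensor_free S)"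
  using keys_diff[of c e] by (auto simp: carrier_tensor_free)

lemma tensor_relations_in: "tensor_relations S S0 u \<subseteq> carrier (tensor_free S)"
proof -
  interpret H: ring "hecke S" by (rule ring_hecke)
  show ?thesis
    unfolding tensor_relations_def
    by (auto intro!: tensor_free_diff frag_of_in_tensor_free intro: hecke_sub_in)
qed

lemma subgroup_tensor_kernel: "subgroup (tensor_kernel S S0 u) (tensor_free S)"
  unfolding tensor_kernel_def
  using comm_group_tensor_free tensor_relations_in
  by (intro group.generate_is_subgroup) (simp_all add: comm_group_def)

lemma normal_tensor_kernel: "tensor_kernel S S0 u \<lhd> tensor_free S"
  using comm_group.subgroup_imp_normal[OF comm_group_tensor_free subgroup_tensor_kernel] .

text \<open>Converts induction over \<open>generate\<close> into additive notation. The group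
  inverse is the minus of the free abelian group only on the carrier, which is where the relations
  have to lie.\<close>

lemma tensor_kernel_induct [consumes 1, case_names zero rel uminus plus]:
  assumes "c \<in> tensor_kernel S S0 u" "P 0" "\<And>c. c \<in> tensor_relations S S0 u \<Longrightarrow> P c"
    "\<And>c. P c \<Longrightarrow> P (- c)" "\<And>c e. P c \<Longrightarrow> P e \<Longrightarrow> P (c + e)"
  shows "P c"
  using assms(1) unfolding tensor_kernel_def
proof (induction rule: generate.induct)
  case (inv h)
  then have "inv\<^bsub>tensor_free S\<^esub> h = - h"
    using tensor_relations_in carrier_tensor_free[of h] unfolding tensor_free_def by auto
  then show ?case using assms inv by simp
qed (use assms in auto)

lemma tensor_class_iff: "x \<in> tensor_class S S0 u c \<longleftrightarrow> (\<exists>k\<in>tensor_kernel S S0 u. x = k + c)"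
  by (auto simp: tensor_class_def r_coset_def)

lemma zero_in_tensor_kernel: "0 \<in> tensor_kernel S S0 u"
  using subgroup.one_closed[OF subgroup_tensor_kernel] by simp

lemma tensor_class_self: "c \<in> tensor_class S S0 u c"
  using zero_in_tensor_kernel by (force simp: tensor_class_iff)

lemma tensor_class_shift:
  assumes "k \<in> tensor_kernel S S0 u" shows "tensor_class S S0 u (k + c) = tensor_class S S0 u c"
proof -
  have K: "k' + k \<in> tensor_kernel S S0 u" "k' - k \<in> tensor_kernel S S0 u"
    if "k' \<in> tensor_kernel S S0 u" for k'
  proof -
    show "k' + k \<in> tensor_kernel S S0 u"
      using subgroup.m_closed[OF subgroup_tensor_kernel that assms] by simp
    have "inv\<^bsub>tensor_free S\<^esub> k = - k"
      using subgroup.mem_carrier[OF subgroup_tensor_kernel assms] carrier_tensor_free[of k]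
      unfolding tensor_free_def by simp
    then show "k' - k \<in> tensor_kernel S S0 u"
      using subgroup.m_closed[OF subgroup_tensor_kernel that
          subgroup.m_inv_closed[OF subgroup_tensor_kernel assms]] by simp
  qed
  show ?thesis
  proof (rule Set.set_eqI)
    fix x
    show "x \<in> tensor_class S S0 u (k + c) \<longleftrightarrow> x \<in> tensor_class S S0 u c"
      unfolding tensor_class_iff
    proof
      assume "\<exists>k'\<in>tensor_kernel S S0 u. x = k' + (k + c)"
      then obtain k' where "k' \<in> tensor_kernel S S0 u" "x = k' + (k + c)" by blast
      then show "\<exists>k'\<in>tensor_kernel S S0 u. x = k' + c"
        using K by (intro bexI[of _ "k' + k"]) (simp_all add: add.assoc)
    next
      assume "\<exists>k'\<in>tensor_kernel S S0 u. x = k' + c"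
      then obtain k' where "k' \<in> tensor_kernel S S0 u" "x = k' + c" by blast
      then show "\<exists>k'\<in>tensor_kernel S S0 u. x = k' + (k + c)"
        using K by (intro bexI[of _ "k' - k"]) simp_all
    qed
  qed
qed

text \<open>Scaling the first factor sends each relation to a relation of the same kind. Hence the
  union in \<open>tensor_map\<close> that defines the scalar action collapses to a single
  class.\<close>

lemma tensor_scale_kernel:
  assumes "c \<in> tensor_kernel S S0 u"
  shows "frag_extend (\<lambda>p. frag_of (case p of (b, h) \<Rightarrow> (a * b, h))) c \<in> tensor_kernel S S0 u"
    (is "?E c \<in> ?K")
  using assms
proof (induction c rule: tensor_kernel_induct)
  case (rel c)
  have "?E c \<in> tensor_relations S S0 u"
    using rel[unfolded tensor_relations_def]
  proof (elim UnE CollectE exE conjE)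
    fix b e h assume "c = frag_of (b + e, h) - frag_of (b, h) - frag_of (e, h)" "h \<in> carrier (hecke S)"
    moreover from this have "?E c = frag_of (a * b + a * e, h) - frag_of (a * b, h) - frag_of (a * e, h)"
      by (simp add: frag_extend_diff distrib_left)
    ultimately show ?thesis unfolding tensor_relations_def by blast
  next
    fix b g h assume "c = frag_of (b, g \<oplus>\<^bsub>hecke S\<^esub> h) - frag_of (b, g) - frag_of (b, h)"
      "g \<in> carrier (hecke S)" "h \<in> carrier (hecke S)"
    moreover from this
    have "?E c = frag_of (a * b, g \<oplus>\<^bsub>hecke S\<^esub> h) - frag_of (a * b, g) - frag_of (a * b, h)"
      by (simp add: frag_extend_diff)
    ultimately show ?thesis unfolding tensor_relations_def by blast
  next
    fix b g h assume "c = frag_of (b * character S S0 u g, h) - frag_of (b, g \<otimes>\<^bsub>hecke S\<^esub> h)"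
      "g \<in> hecke_sub S S0" "h \<in> carrier (hecke S)"
    moreover from this
    have "?E c = frag_of (a * b * character S S0 u g, h) - frag_of (a * b, g \<otimes>\<^bsub>hecke S\<^esub> h)"
      by (simp add: frag_extend_diff mult.assoc)
    ultimately show ?thesis unfolding tensor_relations_def by blast
  qed
  then show ?case unfolding tensor_kernel_def by (rule generate.incl)
next
  case (uminus c)
  have "?E (- c) = - ?E c" by (simp add: frag_extend_minus)
  moreover have "inv\<^bsub>tensor_free S\<^esub> (?E c) = - ?E c"
    using subgroup.mem_carrier[OF subgroup_tensor_kernel uminus] carrier_tensor_free
    unfolding tensor_free_def by simp
  ultimately show ?case using subgroup.m_inv_closed[OF subgroup_tensor_kernel uminus] by simp
next
  case (plus c e)
  then show ?case using subgroup.m_closed[OF subgroup_tensor_kernel plus]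
    by (simp add: frag_extend_add)
qed (simp add: zero_in_tensor_kernel)

lemma smult_tensor_class:
  "a \<odot>\<^bsub>induced_module S S0 u\<^esub> tensor_class S S0 u (frag_of (b, h)) = tensor_class S S0 u (frag_of (a * b, h))"
proof -
  let ?E = "frag_extend (\<lambda>p. frag_of (case p of (b, h) \<Rightarrow> (a * b, h)))"
  have "tensor_class S S0 u (?E c) = tensor_class S S0 u (frag_of (a * b, h))"
    if "c \<in> tensor_class S S0 u (frag_of (b, h))" for c
  proof -
    obtain k where "k \<in> tensor_kernel S S0 u" "c = k + frag_of (b, h)"
      using \<open>c \<in> _\<close> tensor_class_iff by blast
    then show ?thesis using tensor_class_shift[OF tensor_scale_kernel] by (simp add: frag_extend_add)
  qed
  then show ?thesis
    using tensor_class_self[of "frag_of (b, h)"]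
    by (auto simp: induced_module_def Let_def tensor_map_def)
qed

lemma induced_module_ops:
  "carrier (induced_module S S0 u) = carrier (tensor_free S Mod tensor_kernel S S0 u)"
  "add (induced_module S S0 u) = mult (tensor_free S Mod tensor_kernel S S0 u)"
  "ring.zero (induced_module S S0 u) = \<one>\<^bsub>tensor_free S Mod tensor_kernel S S0 u\<^esub>"
  by (simp_all add: induced_module_def Let_def)

lemma abelian_monoid_induced_module: "abelian_monoid (induced_module S S0 u)"
proof -
  interpret Q: comm_group "tensor_free S Mod tensor_kernel S S0 u"
    using comm_group.abelian_FactGroup[OF comm_group_tensor_free subgroup_tensor_kernel] .
  show ?thesis
    by (rule abelian_monoidI; unfold induced_module_ops)
      (rule Q.m_closed Q.one_closed Q.m_assoc Q.l_one Q.m_comm; assumption)+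
qed

lemma tensor_class_in: "c \<in> carrier (tensor_free S) \<Longrightarrow> tensor_class S S0 u c \<in> carrier (induced_module S S0 u)"
  by (auto simp: induced_module_ops FactGroup_def RCOSETS_def tensor_class_def)

lemma tensor_class_add:
  assumes "c \<in> carrier (tensor_free S)" "e \<in> carrier (tensor_free S)"
  shows "tensor_class S S0 u c \<oplus>\<^bsub>induced_module S S0 u\<^esub> tensor_class S S0 u e = tensor_class S S0 u (c + e)"
  using normal.rcos_sum[OF normal_tensor_kernel assms]
  by (simp add: induced_module_ops FactGroup_def tensor_class_def)

lemma tensor_class_zero: "\<zero>\<^bsub>induced_module S S0 u\<^esub> = tensor_class S S0 u 0"
proof -
  interpret T: comm_group "tensor_free S" by (rule comm_group_tensor_free)
  have "tensor_kernel S S0 u #>\<^bsub>tensor_free S\<^esub> \<one>\<^bsub>tensor_free S\<^esub> = tensor_kernel S S0 u"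
    using subgroup.subset[OF subgroup_tensor_kernel] by (rule T.coset_mult_one)
  then show ?thesis by (simp add: induced_module_ops FactGroup_def tensor_class_def)
qed

text \<open>The membership conjunct is carried along because \<open>tensor_class_add\<close> asks
  for it in the induction step.\<close>

lemma finsum_tensor_class:
  assumes "finite A" "\<And>y. y \<in> A \<Longrightarrow> h y \<in> carrier (hecke S)"
  shows "(\<Oplus>\<^bsub>induced_module S S0 u\<^esub>y\<in>A. a y \<odot>\<^bsub>induced_module S S0 u\<^esub> tensor_class S S0 u (frag_of (1, h y)))
     = tensor_class S S0 u (\<Sum>y\<in>A. frag_of (a y, h y)) \<and> (\<Sum>y\<in>A. frag_of (a y, h y)) \<in> carrier (tensor_free S)"
  using assms
proof (induction A rule: finite_induct)
  case empty
  interpret M: abelian_monoid "induced_module S S0 u" by (rule abelian_monoid_induced_module)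
  show ?case by (simp add: tensor_class_zero carrier_tensor_free)
next
  case (insert x A)
  interpret M: abelian_monoid "induced_module S S0 u" by (rule abelian_monoid_induced_module)
  have in': "tensor_class S S0 u (frag_of (a y, h y)) \<in> carrier (induced_module S S0 u)"
    "frag_of (a y, h y) \<in> carrier (tensor_free S)" if "y \<in> insert x A" for y
    using insert.prems[OF that] by (simp_all add: tensor_class_in frag_of_in_tensor_free)
  have "(\<Sum>y\<in>A. frag_of (a y, h y)) \<in> carrier (tensor_free S)" using insert by simp
  then have "(\<Sum>y\<in>insert x A. frag_of (a y, h y)) \<in> carrier (tensor_free S)"
    using insert.hyps in'(2)[of x] group.is_monoid[of "tensor_free S"] comm_group_tensor_free
      monoid.m_closed[of "tensor_free S"] by (simp add: comm_group_def)
  then show ?case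
    using insert in' by (simp add: smult_tensor_class M.finsum_insert tensor_class_add Pi_iff)
qed

end

text \<open>\<open>Wp_minimal\<close> says geometrically that y is the shortest element of its coset
  under left multiplication by the parabolic subgroup: no reflection of that subgroup separates the
  base chamber from its image under y.\<close>

locale parabolic_cocycle = reflection_cocycle S N
  for S :: "('a \<Rightarrow> 'a) set" and N :: "('a \<Rightarrow> 'a) \<Rightarrow> ('a \<Rightarrow> 'a) set" +
  fixes S0 Wp :: "('a \<Rightarrow> 'a) set"
  assumes S0_sub: "S0 \<subseteq> S"
    and finite_S: "finite S"
    and Wp_sub: "Wp \<subseteq> gen_group S"
    and Wp_minimal: "y \<in> Wp \<Longrightarrow> N y \<inter> gen_group S0 = {}"
begin

context includes opaque_comp
begin

abbreviation G0 where "G0 \<equiv> gen_group S0"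

section \<open>Eigenvectors and characters of the parabolic subalgebra\<close>

lemma G0_sub: "w \<in> G0 \<Longrightarrow> w \<in> G"
  using gen_group_mono[OF S0_sub] by blast

lemma inv_G0: "w \<in> G0 \<Longrightarrow> winv w \<in> G0"
  using subgroup_inverse[OF S0_sub] by blast

text \<open>Every reflection crossed by a word in \<open>S0\<close> is a letter conjugated by a
  prefix of the word, hence lies in the parabolic subgroup.\<close>

lemma N_G0:
  assumes "w \<in> G0" "t \<in> N w" shows "t \<in> G0"
proof -
  have *: "\<forall>t. t \<in> N (word_prod ws) \<longrightarrow> t \<in> G0" if "set ws \<subseteq> S0" for ws
    using that
  proof (induction ws)
    case (Cons s ws)
    have s: "s \<in> S" "s \<in> G0" "word_prod ws \<in> G"
      using Cons.prems S0_sub by (auto intro: gen_in_gen_group word_prod_in_gen_group)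
    show ?case
    proof (intro allI impI)
      fix t assume "t \<in> N (word_prod (s # ws))"
      then consider "t = s" | "s \<circ> t \<circ> s \<in> N (word_prod ws)" using N_step[of s "word_prod ws" t] s by auto
      then show "t \<in> G0"
      proof cases
        case 2
        then have "s \<circ> t \<circ> s \<in> G0" using Cons by auto
        then have "s \<circ> (s \<circ> t \<circ> s) \<circ> s \<in> G0"
          by (rule gen_group_comp[OF gen_group_comp[OF s(2)] s(2)])
        then show ?thesis using s by (simp add: group_simps)
      qed (use s in simp)
    qed
  qed simp
  obtain ws where "set ws \<subseteq> S0" "w = word_prod ws" using assms(1) by (elim gen_groupE)
  then show ?thesis using * assms by blast
qed

text \<open>For a finite parabolic subgroup and u = v^-1 this is, up to a power of v, the
  coefficient function of the symmetrizer, and for u = -v that of the antisymmetrizer.\<close>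

definition eigen :: "laurent \<Rightarrow> ('a \<Rightarrow> 'a) \<Rightarrow> laurent" where
  "eigen u w = (if w \<in> G0 then u ^ card (N w) else 0)"

lemma eigen_in: "eigen u \<in> funs"
  using G0_sub by (auto simp: funs_def eigen_def)

lemma eigen_id: "eigen u id = 1"
  by (simp add: eigen_def)

text \<open>At an ascent the operator just reads the value at ws, one power of u higher. At a
  descent from length k + 1 it gives u^k + q u^(k+1) = u^k (1 + q u), and the quadratic equation
  turns this into u^(k+2).\<close>

lemma hecke_op_eigen:
  assumes "u * u = 1 + hecke_q * u" "s \<in> S0"
  shows "hecke_op s (eigen u) = (\<lambda>w. u * eigen u w)"
proof (rule funs_eqI[OF hecke_op_in])
  show "(\<lambda>w. u * eigen u w) \<in> funs" using eigen_in by (simp add: funs_def)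
  fix w assume w: "w \<in> G"
  have s: "s \<in> S" "s \<in> G0" using assms S0_sub by (auto intro: gen_in_gen_group)
  show "hecke_op s (eigen u) w = u * eigen u w"
  proof (cases "w \<in> G0")
    case True
    have ws: "w \<circ> s \<in> G0" using True s by simp
    show ?thesis
    proof (cases "w \<circ> s \<circ> winv w \<in> N w")
      case desc: True
      then obtain k where k: "card (N w) = Suc k" using card_N_right(2)[OF w s(1)] gr0_implies_Suc by blast
      then have "card (N (w \<circ> s)) = k" using card_N_right(1)[OF w s(1)] desc by simp
      then have "hecke_op s (eigen u) w = (1 + hecke_q * u) * u ^ k"
        using w ws True desc k by (simp add: hecke_op_def eigen_def algebra_simps)
      then show ?thesis unfolding assms(1)[symmetric] using True k by (simp add: eigen_def mult.assoc)
    next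
      case False
      then show ?thesis
        using card_N_right(1)[OF w s(1)] w ws True by (simp add: hecke_op_def eigen_def)
    qed
  next
    case False
    have "w \<circ> s \<notin> G0"
    proof
      assume "w \<circ> s \<in> G0"
      then have "w \<circ> s \<circ> s \<in> G0" by (rule gen_group_comp[OF _ s(2)])
      then show False using False s by (simp add: group_simps)
    qed
    then show ?thesis using False w by (simp add: hecke_op_def eigen_def)
  qed
qed

lemma hecke_const_zero: "hecke_const S 0 = \<zero>\<^bsub>hecke S\<^esub>"
proof -
  interpret H: ring "hecke S" by (rule ring_hecke)
  have "hecke_const S 0 \<oplus>\<^bsub>hecke S\<^esub> hecke_const S 0 = hecke_const S 0"
    unfolding hecke_const_def by (simp add: hecke_class_ops[symmetric] nc_const_def)
  then show ?thesis using hecke_const_in[OF S0_sub] H.add.l_cancel_one by simp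
qed

lemma hact_uminus:
  assumes "h \<in> carrier (hecke S)" "f \<in> funs"
  shows "hact (\<ominus>\<^bsub>hecke S\<^esub> h) f = (\<lambda>w. - hact h f w)"
proof
  fix w
  interpret H: ring "hecke S" by (rule ring_hecke)
  have "hact (h \<oplus>\<^bsub>hecke S\<^esub> \<ominus>\<^bsub>hecke S\<^esub> h) f w = 0"
    using assms hact_const[of f 0] by (simp add: hecke_const_zero H.r_neg)
  then show "hact (\<ominus>\<^bsub>hecke S\<^esub> h) f w = - hact h f w"
    using assms by (simp add: hact_add eq_neg_iff_add_eq_0 add.commute)
qed

lemma hecke_gen_word: "hecke_gen S s = hecke_word S [s]"
  by (simp add: hecke_gen_def hecke_word_def)

lemma hact_gen_eigen:
  assumes "u * u = 1 + hecke_q * u" "s \<in> S0"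
  shows "hact (hecke_gen S s) (eigen u) = (\<lambda>w. u * eigen u w)"
  using hact_word[of "[s]" "eigen u"] hecke_op_eigen[OF assms] S0_sub assms(2)
  by (auto simp: hecke_gen_word eigen_in word_op_simps)

lemma hact_sub_eigen:
  assumes u: "u * u = 1 + hecke_q * u" and "g \<in> hecke_sub S S0"
  shows "\<exists>c. hact g (eigen u) = (\<lambda>w. c * eigen u w)"
  using assms(2) unfolding hecke_sub_def
proof (induction rule: generate_ring.induct)
  case one
  show ?case using hact_one[OF eigen_in] by (intro exI[of _ 1]) simp
next
  case (incl h)
  then show ?case using hact_const[OF eigen_in] hact_gen_eigen[OF u] by blast
next
  case (a_inv h)
  then obtain c where "hact h (eigen u) = (\<lambda>w. c * eigen u w)" by blast
  moreover have "h \<in> carrier (hecke S)" using a_inv hecke_sub_in[OF S0_sub] unfolding hecke_sub_def by blast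
  ultimately show ?case using hact_uminus eigen_in by (intro exI[of _ "- c"]) simp
next
  case (eng_add g h)
  then obtain b c where "hact g (eigen u) = (\<lambda>w. b * eigen u w)" "hact h (eigen u) = (\<lambda>w. c * eigen u w)" by blast
  moreover have "g \<in> carrier (hecke S)" "h \<in> carrier (hecke S)"
    using eng_add hecke_sub_in[OF S0_sub] unfolding hecke_sub_def by blast+
  ultimately show ?case using hact_add eigen_in by (intro exI[of _ "b + c"]) (simp add: distrib_right)
next
  case (eng_mult g h)
  then obtain b c where "hact g (eigen u) = (\<lambda>w. b * eigen u w)" "hact h (eigen u) = (\<lambda>w. c * eigen u w)" by blast
  moreover have "g \<in> carrier (hecke S)" "h \<in> carrier (hecke S)"
    using eng_mult hecke_sub_in[OF S0_sub] unfolding hecke_sub_def by blast+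
  ultimately show ?case
    using hact_mult hact_scale eigen_in by (intro exI[of _ "b * c"]) (simp add: mult.assoc)
qed

text \<open>The eigenvalues of the parabolic subalgebra on \<open>eigen u\<close>, read off at the
  identity where that function is 1, form a character, so the choice operator in
  \<open>character\<close> has a witness.\<close>

lemma is_character_character:
  assumes u: "u * u = 1 + hecke_q * u"
  shows "is_character S S0 u (character S S0 u)"
proof -
  let ?\<phi> = "\<lambda>g. hact g (eigen u) id"
  have ev: "hact g (eigen u) = (\<lambda>w. ?\<phi> g * eigen u w)" if "g \<in> hecke_sub S S0" for g
    using hact_sub_eigen[OF u that] eigen_id by fastforce
  have "is_character S S0 u ?\<phi>"
    unfolding is_character_def
  proof (intro conjI ballI allI)
    fix g h assume gh: "g \<in> hecke_sub S S0" "h \<in> hecke_sub S S0"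
    then have in': "g \<in> carrier (hecke S)" "h \<in> carrier (hecke S)" using hecke_sub_in[OF S0_sub] by blast+
    show "?\<phi> (g \<oplus>\<^bsub>hecke S\<^esub> h) = ?\<phi> g + ?\<phi> h" using hact_add[OF in' eigen_in] by simp
    have "hact (g \<otimes>\<^bsub>hecke S\<^esub> h) (eigen u) = hact h (\<lambda>w. ?\<phi> g * eigen u w)"
      using hact_mult[OF in' eigen_in] ev[OF gh(1)] by simp
    then show "?\<phi> (g \<otimes>\<^bsub>hecke S\<^esub> h) = ?\<phi> g * ?\<phi> h"
      using hact_scale[OF in'(2) eigen_in] by simp
  qed (use hact_const[OF eigen_in] hact_gen_eigen[OF u] eigen_id in simp_all)
  then show ?thesis unfolding character_def by (rule someI[of "is_character S S0 u"])
qed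

text \<open>The chosen \<open>character\<close> is known only through its defining equations.
  Induction over the generated subring shows that they force it to be the eigenvalue.\<close>

lemma character_eigen:
  assumes u: "u * u = 1 + hecke_q * u" and "g \<in> hecke_sub S S0"
  shows "hact g (eigen u) = (\<lambda>w. character S S0 u g * eigen u w)"
proof -
  interpret H: ring "hecke S" by (rule ring_hecke)
  let ?\<phi> = "character S S0 u"
  have \<phi>: "\<And>g h. g \<in> hecke_sub S S0 \<Longrightarrow> h \<in> hecke_sub S S0 \<Longrightarrow>
        ?\<phi> (g \<oplus>\<^bsub>hecke S\<^esub> h) = ?\<phi> g + ?\<phi> h \<and> ?\<phi> (g \<otimes>\<^bsub>hecke S\<^esub> h) = ?\<phi> g * ?\<phi> h"
      "\<And>a. ?\<phi> (hecke_const S a) = a" "\<And>s. s \<in> S0 \<Longrightarrow> ?\<phi> (hecke_gen S s) = u"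
    using is_character_character[OF u] unfolding is_character_def by blast+
  have one: "\<one>\<^bsub>hecke S\<^esub> = hecke_const S 1"
    by (simp add: hecke_class_one[symmetric] hecke_const_def nc_const_def)
  have sub: "h \<in> carrier (hecke S)"
    if "h \<in> generate_ring (hecke S) (range (hecke_const S) \<union> hecke_gen S ` S0)" for h
    using that hecke_sub_in[OF S0_sub] unfolding hecke_sub_def by blast
  show ?thesis
    using assms(2) unfolding hecke_sub_def
  proof (induction rule: generate_ring.induct)
    case one
    show ?case using hact_one[OF eigen_in] \<phi>(2) \<open>\<one>\<^bsub>hecke S\<^esub> = hecke_const S 1\<close> by simp
  next
    case (incl h)
    then show ?case using hact_const[OF eigen_in] hact_gen_eigen[OF u] \<phi>(2,3) by auto
  next
    case (a_inv h)
    have "?\<phi> (h \<oplus>\<^bsub>hecke S\<^esub> (\<ominus>\<^bsub>hecke S\<^esub> h)) = ?\<phi> h + ?\<phi> (\<ominus>\<^bsub>hecke S\<^esub> h)"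
      using \<phi>(1)[unfolded hecke_sub_def, OF a_inv.hyps generate_ring.a_inv[OF a_inv.hyps]] by simp
    then have "?\<phi> (\<ominus>\<^bsub>hecke S\<^esub> h) = - ?\<phi> h"
      using sub[OF a_inv.hyps] \<phi>(2)[of 0] by (simp add: hecke_const_zero H.r_neg eq_neg_iff_add_eq_0 add.commute)
    then show ?case using a_inv.IH hact_uminus[OF sub[OF a_inv.hyps] eigen_in] by simp
  next
    case (eng_add g h)
    then show ?case using \<phi>(1)[unfolded hecke_sub_def, of g h] hact_add[OF sub sub eigen_in, of g h]
      by (simp add: distrib_right)
  next
    case (eng_mult g h)
    then show ?case
      using \<phi>(1)[unfolded hecke_sub_def, of g h] hact_mult[OF sub sub eigen_in, of g h]
        hact_scale[OF sub eigen_in, of h]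
      by (simp add: mult.assoc)
  qed
qed

definition tensor_eval :: "laurent \<Rightarrow> ('a \<Rightarrow> 'a) \<Rightarrow> 'a tensor_rep \<Rightarrow> laurent" where
  "tensor_eval u z = frag_extend (\<lambda>(a, h). a * hact h (eigen u) z)"

text \<open>The balancing relation is the eigenvector equation for \<open>eigen u\<close>; the other
  two are additivity in each factor.\<close>

lemma tensor_eval_kernel:
  assumes u: "u * u = 1 + hecke_q * u" and "c \<in> tensor_kernel S S0 u"
  shows "tensor_eval u z c = 0"
  using assms(2)
proof (induction c rule: tensor_kernel_induct[OF S0_sub, consumes 1, case_names zero rel uminus plus])
  case (rel c)
  interpret H: ring "hecke S" by (rule ring_hecke)
  from rel show ?case
    unfolding tensor_relations_def
  proof (elim UnE CollectE exE conjE)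
    fix a g h assume "c = frag_of (a * character S S0 u g, h) - frag_of (a, g \<otimes>\<^bsub>hecke S\<^esub> h)"
      and g: "g \<in> hecke_sub S S0" and h: "h \<in> carrier (hecke S)"
    then show ?thesis
      using hact_mult[OF hecke_sub_in[OF S0_sub g] h eigen_in] character_eigen[OF u g]
        hact_scale[OF h eigen_in]
      by (simp add: tensor_eval_def frag_extend_diff mult.assoc)
  qed (auto simp: tensor_eval_def frag_extend_diff hact_add eigen_in distrib_left distrib_right)
qed (simp_all add: tensor_eval_def frag_extend_minus frag_extend_add)

section \<open>Standard basis elements and evaluations\<close>

lemma hecke_basis_word:
  assumes "y \<in> G"
  obtains ws where "set ws \<subseteq> S" "word_prod ws = y" "length ws = card (N y)" "hecke_basis S y = hecke_word S ws"
  using reduced_word_some[OF assms] unfolding hecke_basis_def hecke_word_def reduced_word_iff by blast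

lemma hecke_basis_in: "y \<in> G \<Longrightarrow> hecke_basis S y \<in> carrier (hecke S)"
  by (metis hecke_basis_word hecke_class_in hecke_word_def nc_word_in)

lemma finite_kl_support:
  assumes "is_kl_family S S0 Wp u d m" "x \<in> Wp"
  shows "finite {y \<in> Wp. m y x \<noteq> 0}"
proof (rule finite_subset[OF _ finite_length_le[OF finite_S, of "cox_length S x"]])
  show "{y \<in> Wp. m y x \<noteq> 0} \<subseteq> {w \<in> G. cox_length S w \<le> cox_length S x}"
  proof
    fix y assume "y \<in> {y \<in> Wp. m y x \<noteq> 0}"
    then have "bruhat_le S y x" using assms unfolding is_kl_family_def by blast
    then show "y \<in> {w \<in> G. cox_length S w \<le> cox_length S x}"
      using bruhat_le_length[of y x] subsetD[OF Wp_sub assms(2)] by auto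
  qed
qed

text \<open>Self-duality is an equation between classes. Testing it on the representative
  \<open>?c\<close> leaves an error in the kernel of the tensor relations, which
  \<open>tensor_eval\<close> sends to 0.\<close>

lemma kl_dual_identity:
  assumes kl: "is_kl_family S S0 Wp u d m" and x: "x \<in> Wp" and u: "u * u = 1 + hecke_q * u"
  shows "(\<Sum>y | y \<in> Wp \<and> m y x \<noteq> 0. bar (m y x) * hact (d (hecke_basis S y)) (eigen u) z)
    = (\<Sum>y | y \<in> Wp \<and> m y x \<noteq> 0. m y x * hact (hecke_basis S y) (eigen u) z)"
proof -
  let ?A = "{y. y \<in> Wp \<and> m y x \<noteq> 0}"
  let ?c = "\<Sum>y\<in>?A. frag_of (m y x, hecke_basis S y)"
  let ?E = "frag_extend (\<lambda>p. frag_of (case p of (a, h) \<Rightarrow> (bar a, d h)))"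
  have fin: "finite ?A" using finite_kl_support[OF kl x] by simp
  have "kl_element S S0 Wp u m x = tensor_class S S0 u ?c"
    unfolding kl_element_def induced_basis_def
    using finsum_tensor_class[OF S0_sub fin, of "hecke_basis S" u "\<lambda>y. m y x"] hecke_basis_in Wp_sub by auto
  then have "self_dual S S0 u d (tensor_class S S0 u ?c)"
    using kl x unfolding is_kl_family_def by metis
  then have "(\<Union>c\<in>tensor_class S S0 u ?c. tensor_class S S0 u (?E c)) = tensor_class S S0 u ?c"
    unfolding self_dual_def tensor_map_def .
  \<comment> \<open>The union runs over all representatives; the term for \<open>?c\<close>
    contributes the class of its image, and so the image itself.\<close>
  then have "?E ?c \<in> tensor_class S S0 u ?c"
    using tensor_class_self[OF S0_sub] by blast
  then obtain k where k: "k \<in> tensor_kernel S S0 u" "?E ?c = k + ?c"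
    using tensor_class_iff[OF S0_sub] by blast
  then have "tensor_eval u z (?E ?c) = tensor_eval u z ?c"
    using tensor_eval_kernel[OF u k(1)] by (simp add: tensor_eval_def frag_extend_add)
  then show ?thesis
    using fin by (simp add: tensor_eval_def frag_extend_sum_of)
qed

text \<open>For minimal y, acting with H_y merely translates \<open>eigen u\<close> to the coset of
  y. A correction term at w survives only if w = a y' with a in the parabolic subgroup, y' the
  product so far, and w s w^-1 in N(w). With r = y' s y'^-1 this element is a r a^-1; r is not in
  N(y'), so the cocycle identity puts a r a^-1 into N(a), inside the parabolic subgroup. Then r lies
  there too, although r is crossed by the minimal word: a contradiction.\<close>

lemma word_op_eigen:
  assumes "set ws \<subseteq> S" "card (N (word_prod ws)) = length ws" "N (word_prod ws) \<inter> G0 = {}" "w \<in> G"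
  shows "word_op ws (eigen u) w = eigen u (w \<circ> winv (word_prod ws))"
proof -
  have "\<forall>w\<in>G. word_op ws (eigen u) w = eigen u (w \<circ> winv (word_prod ws))"
    using assms(1-3)
  proof (induction ws rule: rev_induct)
    case Nil
    then show ?case using inv_word_prod[of "[]"] by (simp add: word_op_simps)
  next
    case (snoc s ws)
    let ?y = "word_prod ws"
    let ?r = "?y \<circ> s \<circ> winv ?y"
    have s: "s \<in> S" "?y \<in> G" using snoc.prems by (auto simp: word_prod_in_gen_group)
    have red: "card (N ?y) = length ws" "?r \<notin> N ?y"
      using reduced_snoc[of ws s] snoc.prems by simp_all
    have N: "t \<in> N (word_prod (ws @ [s])) \<longleftrightarrow> (t \<in> N ?y) \<noteq> (t = ?r)" for t
      using N_right[OF s(2,1)] by simp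
    have r: "?r \<notin> G0" using N[of ?r] red snoc.prems by blast
    have "N ?y \<inter> G0 = {}" using N red snoc.prems by blast
    then have IH: "\<forall>w\<in>G. word_op ws (eigen u) w = eigen u (w \<circ> winv ?y)" using snoc red by simp
    show ?case
    proof
      fix w assume w: "w \<in> G"
      have e: "w \<circ> s \<circ> winv ?y = w \<circ> winv (word_prod (ws @ [s]))"
        using s w by (simp add: group_simps)
      have "w \<circ> s \<circ> winv w \<notin> N w" if a: "w \<circ> winv ?y \<in> G0"
      proof
        let ?a = "w \<circ> winv ?y"
        assume "w \<circ> s \<circ> winv w \<in> N w"
        moreover have "w = ?a \<circ> ?y" using s by (simp add: group_simps)
        moreover have "w \<circ> s \<circ> winv w = ?a \<circ> ?r \<circ> winv ?a" using s w by (simp add: group_simps)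
        ultimately have "?a \<circ> ?r \<circ> winv ?a \<in> N (?a \<circ> ?y)" by metis
        moreover have "winv ?a \<circ> (?a \<circ> ?r \<circ> winv ?a) \<circ> ?a = ?r" using s w by (simp add: group_simps)
        ultimately have "?a \<circ> ?r \<circ> winv ?a \<in> N ?a"
          using N_mult[of ?a ?y] red G0_sub[OF a] s by auto
        then have "?a \<circ> ?r \<circ> winv ?a \<in> G0" using N_G0[OF a] by blast
        then have "winv ?a \<circ> (?a \<circ> ?r \<circ> winv ?a) \<circ> ?a \<in> G0"
          by (rule gen_group_comp[OF gen_group_comp[OF inv_G0[OF a]] a])
        then show False using r s w by (simp add: group_simps)
      qed
      then have zero: "(if w \<circ> s \<circ> winv w \<in> N w then hecke_q * eigen u (w \<circ> winv ?y) else 0) = 0"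
        by (auto simp: eigen_def)
      have "word_op (ws @ [s]) (eigen u) w = eigen u (w \<circ> s \<circ> winv ?y)
          + (if w \<circ> s \<circ> winv w \<in> N w then hecke_q * eigen u (w \<circ> winv ?y) else 0)"
        using w s IH by (simp add: word_op_simps hecke_op_def)
      then have "word_op (ws @ [s]) (eigen u) w = eigen u (w \<circ> s \<circ> winv ?y)"
        unfolding zero by simp
      then show "word_op (ws @ [s]) (eigen u) w = eigen u (w \<circ> winv (word_prod (ws @ [s])))"
        unfolding e .
    qed
  qed
  then show ?thesis using assms(4) by blast
qed

text \<open>The translated eigenvector lives on the coset of y, so it remains to see that two
  minimal elements y and z = ay of one coset agree. A reflection in N(a) lies in the parabolic
  subgroup, so minimality of z forces it to cancel against a conjugate in N(y), which minimality of
  y excludes. Hence N(a) is empty.\<close>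

lemma hact_basis_eigen:
  assumes y: "y \<in> Wp" and z: "z \<in> Wp"
  shows "hact (hecke_basis S y) (eigen u) z = (if z = y then 1 else 0)"
proof -
  have yz: "y \<in> G" "z \<in> G" using assms Wp_sub by auto
  obtain ws where ws: "set ws \<subseteq> S" "word_prod ws = y" "length ws = card (N y)"
      "hecke_basis S y = hecke_word S ws"
    using hecke_basis_word[OF yz(1)] .
  have e: "hact (hecke_basis S y) (eigen u) z = eigen u (z \<circ> winv y)"
    using word_op_eigen[of ws z u] ws yz Wp_minimal[OF y] by (simp add: hact_word eigen_in)
  show ?thesis
  proof (cases "z \<circ> winv y \<in> G0")
    case True
    let ?a = "z \<circ> winv y"
    have z_eq: "z = ?a \<circ> y" using yz by (simp add: group_simps)
    have "N ?a = {}"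
    proof (rule ccontr)
      assume "N ?a \<noteq> {}"
      then obtain t where t: "t \<in> N ?a" by blast
      then have t0: "t \<in> G0" using N_G0 True by blast
      then have "t \<notin> N (?a \<circ> y)" using Wp_minimal[OF z] z_eq by auto
      then have "winv ?a \<circ> t \<circ> ?a \<in> N y" using N_mult[of ?a y t] t G0_sub[OF True] yz by blast
      moreover have "winv ?a \<circ> t \<circ> ?a \<in> G0"
        by (rule gen_group_comp[OF gen_group_comp[OF inv_G0[OF True] t0] True])
      ultimately show False using Wp_minimal[OF y] by blast
    qed
    then have "?a = id" using card_N_eq_0 G0_sub[OF True] by blast
    then show ?thesis using e z_eq by (simp add: eigen_id)
  next
    case False
    then have "z \<noteq> y" using yz by auto
    then show ?thesis using e False by (simp add: eigen_def)
  qed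
qed

text \<open>The semilinear involution \<open>v \<mapsto> v\<inverse>\<close>, \<open>H\<^sub>s \<mapsto> -H\<^sub>s\<close> of the Hecke algebra exchanges the characters
  \<open>v\<inverse>\<close> and \<open>-v\<close> and commutes with the dualization.\<close>

definition theta :: "(('a \<Rightarrow> 'a) \<Rightarrow> laurent) \<Rightarrow> ('a \<Rightarrow> 'a) \<Rightarrow> laurent" where
  "theta f w = (- 1) ^ card (N w) * bar (f w)"

lemma theta_in: "f \<in> funs \<Longrightarrow> theta f \<in> funs"
  by (simp add: funs_def theta_def)

text \<open>Passing from w to ws flips the parity of the length, and bar negates
  \<open>hecke_q\<close>; both terms of \<open>hecke_op\<close> thus pick up the same sign.\<close>

lemma theta_hecke_op:
  assumes "s \<in> S" shows "theta (hecke_op s f) = (\<lambda>w. - hecke_op s (theta f) w)"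
proof
  fix w
  show "theta (hecke_op s f) w = - hecke_op s (theta f) w"
  proof (cases "w \<in> G")
    case True
    have sign: "(- 1) ^ card (N (w \<circ> s)) = - ((- 1) ^ card (N w) :: laurent)"
    proof (cases "w \<circ> s \<circ> winv w \<in> N w")
      case desc: True
      then obtain k where "card (N w) = Suc k" using card_N_right(2)[OF True assms] gr0_implies_Suc by blast
      then show ?thesis using card_N_right(1)[OF True assms] desc by simp
    qed (use card_N_right(1)[OF True assms] in simp)
    show ?thesis using True
      by (simp add: theta_def hecke_op_def sign algebra_simps)
  qed (simp add: theta_def hecke_op_def)
qed

lemma theta_word_op:
  assumes "set ws \<subseteq> S"
  shows "theta (word_op ws f) = (\<lambda>w. (- 1) ^ length ws * word_op ws (theta f) w)"
  using assms
proof (induction ws rule: rev_induct)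
  case (snoc s ws)
  then have "theta (word_op (ws @ [s]) f) = (\<lambda>w. - hecke_op s (\<lambda>w. (- 1) ^ length ws * word_op ws (theta f) w) w)"
    by (simp add: word_op_simps theta_hecke_op)
  then show ?case
    using word_op_scale[of "[s]" "(- 1) ^ length ws" "word_op ws (theta f)"] by (simp add: word_op_simps)
qed (simp add: word_op_simps)

lemma theta_eigen: "theta (eigen u) = eigen (- bar u)"
  by (rule ext) (simp add: theta_def eigen_def power_mult_distrib[symmetric])

text \<open>With h the word for y^-1, the dual of H_y is h^-1, so g = f.h^-1 satisfies g.h = f for
  the eigenvector f. Applying \<open>theta\<close> puts the sign of the word length into this
  equation, and acting with h^-1 solves it for the twist of g. The sign is that of y because y and
  y^-1 have equal length.\<close>

lemma theta_hact_dual_basis: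
  assumes d: "is_dualization S d" and y: "y \<in> G"
  shows "theta (hact (d (hecke_basis S y)) (eigen u))
    = (\<lambda>w. (- 1) ^ card (N y) * hact (d (hecke_basis S y)) (eigen (- bar u)) w)"
proof -
  interpret H: ring "hecke S" by (rule ring_hecke)
  have iy: "winv y \<in> G" using y by simp
  obtain ws where ws: "set ws \<subseteq> S" "word_prod ws = winv y" "length ws = card (N (winv y))"
      "hecke_basis S (winv y) = hecke_word S ws"
    using hecke_basis_word[OF iy] .
  let ?h = "hecke_word S ws" and ?i = "inv\<^bsub>hecke S\<^esub> (hecke_word S ws)" and ?e = "(- 1) ^ length ws :: laurent"
  have U: "?h \<in> Units (hecke S)" using hecke_word_unit ws by blast
  then have in': "?h \<in> carrier (hecke S)" "?i \<in> carrier (hecke S)"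
    using H.Units_closed H.Units_inv_closed by blast+
  have "\<exists>ws. set ws \<subseteq> S \<and> word_prod ws = y" using gen_groupE[OF y] by blast
  then have dy: "d (hecke_basis S y) = ?i"
    using d unfolding ws(4)[symmetric] is_dualization_def by blast
  define g where "g = hact ?i (eigen u)"
  have g: "g \<in> funs" unfolding g_def using hact_in[OF in'(2) eigen_in] .
  have "word_op ws g = hact ?h g" using hact_word[OF ws(1) g] by simp
  also have "\<dots> = hact (?i \<otimes>\<^bsub>hecke S\<^esub> ?h) (eigen u)"
    unfolding g_def using hact_mult[OF in'(2,1) eigen_in] by simp
  also have "\<dots> = eigen u" using U by (simp add: H.Units_l_inv hact_one eigen_in)
  finally have "eigen (- bar u) = (\<lambda>w. ?e * word_op ws (theta g) w)"
    using theta_word_op[OF ws(1), of g] theta_eigen by simp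
  then have "hact ?i (eigen (- bar u)) = hact ?i (\<lambda>w. ?e * hact ?h (theta g) w)"
    using hact_word[OF ws(1) theta_in[OF g]] by simp
  also have "\<dots> = (\<lambda>w. ?e * hact (?h \<otimes>\<^bsub>hecke S\<^esub> ?i) (theta g) w)"
    using hact_scale[OF in'(2) hact_in[OF in'(1) theta_in[OF g]]] hact_mult[OF in' theta_in[OF g]] by simp
  also have "\<dots> = (\<lambda>w. ?e * theta g w)" using U by (simp add: H.Units_r_inv hact_one theta_in g)
  finally have "(\<lambda>w. ?e * hact ?i (eigen (- bar u)) w) = theta g"
    by (simp add: mult.assoc[symmetric] power_mult_distrib[symmetric])
  then show ?thesis unfolding dy g_def using ws(3) card_N_inv[OF y] by metis
qed

theorem t_poly_self_dual:
  assumes d: "is_dualization S d"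
    and m: "is_kl_family S S0 Wp (vpow (- 1)) d m"
    and n: "is_kl_family S S0 Wp (- vpow 1) d n"
    and minv: "is_inverse_family S Wp m minv"
    and A: "A \<in> Wp" and B: "B \<in> Wp"
  shows "bar (t_poly Wp n minv B A) = t_poly Wp n minv B A"
proof -
  \<comment> \<open>A length ball replaces the infinite index set: it is finite, and whenever it
    contains x it contains every y with a nonzero entry at (y, x), for either family.
    \<open>B\<close> may lie outside it.\<close>
  define Q where "Q = {y \<in> Wp. cox_length S y \<le> cox_length S A}"
  define \<epsilon> :: "('a \<Rightarrow> 'a) \<Rightarrow> laurent" where "\<epsilon> y = (- 1) ^ cox_length S y" for y
  \<comment> \<open>The matrix of the dualization of N: column y holds the coefficients of the dual
    of N_y, read off by evaluation.\<close>
  define s where "s z y = hact (d (hecke_basis S y)) (eigen (- vpow 1)) z" for z y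
  have Q: "finite Q" "Q \<subseteq> Wp" "A \<in> Q"
    using finite_subset[OF _ finite_length_le[OF finite_S, of "cox_length S A"], of Q] Wp_sub A
    by (auto simp: Q_def)
  have G: "y \<in> G" if "y \<in> Q" for y using that Q Wp_sub by blast
  have len: "\<epsilon> y = (- 1) ^ card (N y)" if "y \<in> Wp" for y
    using that Wp_sub cox_length_eq[of y] by (auto simp: \<epsilon>_def)
  have \<epsilon>: "\<epsilon> y * \<epsilon> y = 1" "bar (\<epsilon> y) = \<epsilon> y" for y
    by (simp_all add: \<epsilon>_def power_mult_distrib[symmetric])
  have lower: "y \<in> Q \<and> (y = x \<or> cox_length S y < cox_length S x)"
    if "is_kl_family S S0 Wp u d p" "p y x \<noteq> 0" "y \<in> Wp" "x \<in> Q" for u p y x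
  proof -
    have x: "x \<in> Wp" "cox_length S x \<le> cox_length S A" using that(4) by (simp_all add: Q_def)
    have "\<forall>x\<in>Wp. \<forall>y\<in>Wp. \<not> bruhat_le S y x \<longrightarrow> p y x = 0"
      using that(1) unfolding is_kl_family_def by (elim conjE)
    then have "bruhat_le S y x" using that(2,3) x(1) by blast
    then have "y = x \<or> cox_length S y < cox_length S x"
      using bruhat_le_length[OF _ G[OF that(4)]] by blast
    then show ?thesis using that(3) x by (auto simp: Q_def)
  qed
  have dual: "(\<Sum>y\<in>Q. bar (p y x) * hact (d (hecke_basis S y)) (eigen u) z) = p z x"
    if p: "is_kl_family S S0 Wp u d p" and u: "u \<in> {vpow (- 1), - vpow 1}" and x: "x \<in> Q" and z: "z \<in> Q"
    for u p x z
  proof -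
    have xW: "x \<in> Wp" "z \<in> Wp" using x z Q by auto
    have "(\<Sum>y\<in>Q. bar (p y x) * hact (d (hecke_basis S y)) (eigen u) z)
        = (\<Sum>y | y \<in> Wp \<and> p y x \<noteq> 0. bar (p y x) * hact (d (hecke_basis S y)) (eigen u) z)"
      using lower[OF p _ _ x] Q by (intro sum.mono_neutral_right) auto
    also have "\<dots> = (\<Sum>y | y \<in> Wp \<and> p y x \<noteq> 0. p y x * hact (hecke_basis S y) (eigen u) z)"
      by (rule kl_dual_identity[OF p xW(1) hecke_char_quadratic[OF u]])
    also have "\<dots> = (\<Sum>y\<in>Q. p y x * hact (hecke_basis S y) (eigen u) z)"
      using lower[OF p _ _ x] Q by (intro sum.mono_neutral_left) auto
    also have "\<dots> = (\<Sum>y\<in>Q. if z = y then p y x else 0)"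
      using Q xW by (intro sum.cong) (auto simp: hact_basis_eigen)
    also have "\<dots> = p z x" using Q z by simp
    finally show ?thesis .
  qed
  have n_dual: "(\<Sum>y\<in>Q. bar (n y A) * s z y) = n z A" if "z \<in> Q" for z
    unfolding s_def using dual[OF n _ Q(3) that] by simp
  \<comment> \<open>Applying \<open>theta\<close> moves the equation for \<open>m\<close> from v^-1
    to -v. It now says that the combination of the N_z with coefficients
    \<open>\<epsilon> z * bar (m z x)\<close> is self-dual in N.\<close>
  have m_dual: "(\<Sum>y\<in>Q. \<epsilon> y * m y x * s z y) = \<epsilon> z * bar (m z x)" if x: "x \<in> Q" and z: "z \<in> Q" for x z
  proof -
    have zW: "z \<in> Wp" using z Q by blast
    have "\<epsilon> z * bar (m z x)
        = \<epsilon> z * bar (\<Sum>y\<in>Q. bar (m y x) * hact (d (hecke_basis S y)) (eigen (vpow (- 1))) z)"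
      using dual[OF m _ x z] by simp
    also have "\<dots> = (\<Sum>y\<in>Q. m y x * theta (hact (d (hecke_basis S y)) (eigen (vpow (- 1)))) z)"
      unfolding theta_def len[OF zW, symmetric] by (simp add: bar_sum sum_distrib_left mult_ac)
    also have "\<dots> = (\<Sum>y\<in>Q. \<epsilon> y * m y x * s z y)"
      using G Q len by (intro sum.cong) (auto simp: theta_hact_dual_basis[OF d] s_def mult_ac)
    finally show ?thesis by simp
  qed
  have inverse: "(\<Sum>C\<in>Q. \<epsilon> C * minv C B * m C x) = (if B = x then \<epsilon> B else 0)" if x: "x \<in> Q" for x
  proof -
    have "(\<Sum>C\<in>Q. \<epsilon> C * minv C B * m C x) = \<epsilon> B * (\<Sum>C\<in>Q. (- 1) ^ (cox_length S C + cox_length S B) * minv C B * m C x)"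
      unfolding sum_distrib_left by (intro sum.cong) (simp_all add: \<epsilon>_def power_add power_mult_distrib[symmetric] algebra_simps)
    also have "(\<Sum>C\<in>Q. (- 1) ^ (cox_length S C + cox_length S B) * minv C B * m C x)
        = (\<Sum>C | C \<in> Wp \<and> minv C B * m C x \<noteq> 0. (- 1) ^ (cox_length S C + cox_length S B) * minv C B * m C x)"
      using lower[OF m _ _ x] Q by (intro sum.mono_neutral_right) auto
    also have "\<dots> = (if B = x then 1 else 0)"
      using minv B x Q unfolding is_inverse_family_def by blast
    finally show ?thesis by simp
  qed
  \<comment> \<open>The functional N_C -> \<open>bar (minv C B)\<close> evaluated at the dual of
    N_y. By \<open>inverse\<close>, this functional is \<open>\<epsilon> B\<close> times the
    coordinate at the self-dual element of index \<open>B\<close>.\<close>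
  define p where "p y = (\<Sum>C\<in>Q. bar (minv C B) * s C y)" for y
  have p_sum: "(\<Sum>y\<in>Q. \<epsilon> y * m y x * p y) = (\<Sum>y\<in>Q. \<epsilon> y * m y x * minv y B)" if x: "x \<in> Q" for x
  proof -
    have "(\<Sum>y\<in>Q. \<epsilon> y * m y x * p y) = (\<Sum>C\<in>Q. bar (minv C B) * (\<Sum>y\<in>Q. \<epsilon> y * m y x * s C y))"
      unfolding p_def sum_distrib_left by (subst sum.swap) (simp add: mult_ac)
    also have "\<dots> = bar (\<Sum>C\<in>Q. \<epsilon> C * minv C B * m C x)"
      unfolding bar_sum using m_dual[OF x] by (intro sum.cong) (simp_all add: \<epsilon> mult_ac)
    also have "\<dots> = (\<Sum>y\<in>Q. \<epsilon> y * minv y B * m y x)" unfolding inverse[OF x] by (simp add: \<epsilon>)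
    finally show ?thesis by (simp add: mult_ac)
  qed
  \<comment> \<open>By \<open>p_sum\<close>, p and the column \<open>B\<close> of
    \<open>minv\<close> have equal images under the matrix with entries
    \<open>\<epsilon> y * m y x\<close>. It is triangular for the length with diagonal entries
    \<open>\<epsilon> x\<close>, so they agree.\<close>
  have p_eq: "x \<in> Q \<longrightarrow> p x = minv x B" for x
  proof (induction "cox_length S x" arbitrary: x rule: less_induct)
    case less
    show ?case
    proof
      assume x: "x \<in> Q"
      have "\<epsilon> y * m y x * p y = \<epsilon> y * m y x * minv y B" if "y \<in> Q - {x}" for y
        using lower[OF m _ _ x, of y] less[of y] that Q by (cases "m y x = 0") auto
      then have "(\<Sum>y\<in>Q - {x}. \<epsilon> y * m y x * p y) = (\<Sum>y\<in>Q - {x}. \<epsilon> y * m y x * minv y B)"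
        by (intro sum.cong) auto
      then have "\<epsilon> x * m x x * p x = \<epsilon> x * m x x * minv x B"
        using p_sum[OF x] unfolding sum.remove[OF Q(1) x] by simp
      moreover have "\<forall>x\<in>Wp. m x x = 1" using m unfolding is_kl_family_def by (elim conjE)
      then have "m x x = 1" using x Q by blast
      ultimately have "\<epsilon> x * (\<epsilon> x * p x) = \<epsilon> x * (\<epsilon> x * minv x B)" by simp
      then show "p x = minv x B" by (simp add: mult.assoc[symmetric] \<epsilon>)
    qed
  qed
  have "t_poly Wp n minv B A = (\<Sum>C\<in>Q. n C A * bar (minv C B))"
    unfolding t_poly_def using lower[OF n _ _ Q(3)] Q by (intro sum.mono_neutral_left) auto
  \<comment> \<open>Self-duality of the element of index \<open>A\<close> inserts the matrix
    \<open>s\<close>; contracted with the functional, it becomes \<open>p\<close>.\<close>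
  also have "\<dots> = (\<Sum>C\<in>Q. (\<Sum>y\<in>Q. bar (n y A) * s C y) * bar (minv C B))"
    using n_dual by simp
  also have "\<dots> = (\<Sum>y\<in>Q. bar (n y A) * p y)"
    unfolding p_def sum_distrib_left sum_distrib_right by (subst sum.swap) (simp add: mult_ac)
  also have "\<dots> = (\<Sum>y\<in>Q. bar (n y A) * minv y B)" using p_eq by simp
  also have "\<dots> = bar (\<Sum>C\<in>Q. n C A * bar (minv C B))" by (simp add: bar_sum)
  also have "(\<Sum>C\<in>Q. n C A * bar (minv C B)) = t_poly Wp n minv B A"
    unfolding t_poly_def using lower[OF n _ _ Q(3)] Q by (intro sum.mono_neutral_right) auto
  finally show ?thesis by (rule sym)
qed

end

end

section \<open>The alcove geometry\<close>

lemma pairing_add: "pairing (x + y) \<alpha> = pairing x \<alpha> + pairing y \<alpha>"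
  and pairing_diff: "pairing (x - y) \<alpha> = pairing x \<alpha> - pairing y \<alpha>"
  and pairing_scaleR: "pairing (c *\<^sub>R x) \<alpha> = c * pairing x \<alpha>"
  and pairing_minus_left: "pairing (- x) \<alpha> = - pairing x \<alpha>"
  and pairing_minus_right: "pairing x (- \<alpha>) = - pairing x \<alpha>"
  by (simp_all add: pairing_def inner_add_left inner_diff_left distrib_left right_diff_distrib
      add_divide_distrib diff_divide_distrib)

lemma pairing_self: "\<alpha> \<noteq> 0 \<Longrightarrow> pairing \<alpha> \<alpha> = 2"
  by (simp add: pairing_def)

lemma pairing_sum: "pairing (\<Sum>x\<in>A. f x) \<alpha> = (\<Sum>x\<in>A. pairing (f x) \<alpha>)"
  by (induction A rule: infinite_finite_induct) (simp_all add: pairing_add, simp_all add: pairing_def)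

lemmas pairing_linear = pairing_add pairing_diff pairing_scaleR pairing_minus_left

lemma refl_root_inner:
  assumes "\<alpha> \<noteq> 0" shows "refl_root \<alpha> x \<bullet> refl_root \<alpha> y = x \<bullet> y"
  using assms by (simp add: refl_root_def pairing_def inner_diff_left inner_diff_right inner_commute field_simps)

lemma refl_root_refl_root: "\<alpha> \<noteq> 0 \<Longrightarrow> refl_root \<alpha> (refl_root \<alpha> x) = x"
  by (simp add: refl_root_def pairing_linear pairing_self algebra_simps)

lemma pairing_refl_root:
  assumes "\<alpha> \<noteq> 0" shows "pairing (refl_root \<alpha> x) (refl_root \<alpha> y) = pairing x y"
  using refl_root_inner[OF assms] by (simp add: pairing_def)

lemma refl_root_linear:
  "refl_root \<alpha> (x + y) = refl_root \<alpha> x + refl_root \<alpha> y"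
  "refl_root \<alpha> (x - y) = refl_root \<alpha> x - refl_root \<alpha> y"
  "refl_root \<alpha> (c *\<^sub>R x) = c *\<^sub>R refl_root \<alpha> x"
  by (simp_all add: refl_root_def pairing_linear algebra_simps)

lemma affine_reflection_refl_root: "affine_reflection l \<alpha> k x = refl_root \<alpha> x + (real l * of_int k) *\<^sub>R \<alpha>"
  by (simp add: affine_reflection_def refl_root_def algebra_simps)

lemma affine_reflection_minus: "affine_reflection l (- \<alpha>) (- k) = affine_reflection l \<alpha> k"
  by (rule ext) (simp add: affine_reflection_def pairing_minus_right algebra_simps)

lemma affine_reflection_fixed_iff:
  "\<alpha> \<noteq> 0 \<Longrightarrow> affine_reflection l \<alpha> k x = x \<longleftrightarrow> pairing x \<alpha> = real l * of_int k"
  by (simp add: affine_reflection_def)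

lemma affine_reflection_involution: "\<alpha> \<noteq> 0 \<Longrightarrow> affine_reflection l \<alpha> k (affine_reflection l \<alpha> k x) = x"
  by (simp add: affine_reflection_def pairing_linear pairing_self algebra_simps)

lemma affine_reflection_segment:
  "affine_reflection l \<alpha> k ((1 - c) *\<^sub>R x + c *\<^sub>R y) =
     (1 - c) *\<^sub>R affine_reflection l \<alpha> k x + c *\<^sub>R affine_reflection l \<alpha> k y"
  unfolding affine_reflection_refl_root refl_root_linear by (simp add: algebra_simps)

lemma weyl_group_comp:
  assumes "v \<in> weyl_group R" "w \<in> weyl_group R" shows "v \<circ> w \<in> weyl_group R"
  using assms(1)
proof (rule weyl_group.induct)
  fix \<alpha> v assume "\<alpha> \<in> R" "v \<circ> w \<in> weyl_group R"
  then show "refl_root \<alpha> \<circ> v \<circ> w \<in> weyl_group R"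
    unfolding comp_assoc by (rule weyl_group.intros)
qed (use assms(2) in simp)

lemma weyl_group_zero:
  assumes "w \<in> weyl_group R" shows "w 0 = 0"
  using assms by (rule weyl_group.induct) (simp_all add: refl_root_def pairing_def)

text \<open>Coordinates are shifted by the half sum of the positive roots: the group acts without
  the dot, and the reflecting hyperplanes are the sets where the pairing with a root is a multiple
  of \<open>l\<close>.\<close>

locale affine_alcove =
  fixes R Rp :: "'e::euclidean_space set" and l :: nat and c0 :: 'e
  assumes root_system: "root_system R"
    and positive_system: "positive_system R Rp"
    and l_pos: "0 < l"
    and c0_in: "\<alpha> \<in> Rp \<Longrightarrow> 0 < pairing c0 \<alpha> \<and> pairing c0 \<alpha> < real l"
begin

abbreviation aref where "aref \<equiv> affine_reflection l"
abbreviation S where "S \<equiv> simple_reflections Rp l"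

definition alcove :: "'e set" where
  "alcove = {x. \<forall>\<alpha>\<in>Rp. 0 < pairing x \<alpha> \<and> pairing x \<alpha> < real l}"

definition reflections :: "('e \<Rightarrow> 'e) set" where
  "reflections = {aref \<alpha> k |\<alpha> k. \<alpha> \<in> R}"

definition regular :: "'e \<Rightarrow> bool" where
  "regular p \<longleftrightarrow> (\<forall>t\<in>reflections. t p \<noteq> p)"

text \<open>A hyperplane is represented by its reflection, which avoids choosing a root up to sign.
  The definition means strict separation only for endpoints off the hyperplane, as in
  \<open>separating_iff\<close>.\<close>

definition separating :: "'e \<Rightarrow> 'e \<Rightarrow> ('e \<Rightarrow> 'e) set" where
  "separating p q = {t \<in> reflections. \<exists>z\<in>closed_segment p q. t z = z}"

section \<open>Affine reflections and separating hyperplanes\<close>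

lemma finite_R: "finite R" and R_nonzero: "\<alpha> \<in> R \<Longrightarrow> \<alpha> \<noteq> 0"
  and R_multiple: "\<alpha> \<in> R \<Longrightarrow> c *\<^sub>R \<alpha> \<in> R \<Longrightarrow> c = 1 \<or> c = -1"
  and R_refl: "\<alpha> \<in> R \<Longrightarrow> \<beta> \<in> R \<Longrightarrow> refl_root \<alpha> \<beta> \<in> R"
  and R_int: "\<alpha> \<in> R \<Longrightarrow> \<beta> \<in> R \<Longrightarrow> pairing \<beta> \<alpha> \<in> \<int>"
  using root_system unfolding root_system_def by blast+

lemma R_uminus: "\<alpha> \<in> R \<Longrightarrow> - \<alpha> \<in> R"
  using R_refl[of \<alpha> \<alpha>] pairing_self[OF R_nonzero] by (simp add: refl_root_def scaleR_2)

lemma Rp_sub: "\<alpha> \<in> Rp \<Longrightarrow> \<alpha> \<in> R" and Rp_cases: "\<alpha> \<in> R \<Longrightarrow> \<alpha> \<in> Rp \<or> - \<alpha> \<in> Rp"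
proof -
  obtain \<gamma> where \<gamma>: "\<forall>\<alpha>\<in>R. \<alpha> \<bullet> \<gamma> \<noteq> 0" "Rp = {\<alpha>\<in>R. 0 < \<alpha> \<bullet> \<gamma>}"
    using positive_system unfolding positive_system_def by blast
  then show "\<alpha> \<in> Rp \<Longrightarrow> \<alpha> \<in> R" by blast
  show "\<alpha> \<in> R \<Longrightarrow> \<alpha> \<in> Rp \<or> - \<alpha> \<in> Rp"
    using \<gamma> R_uminus by (auto simp: not_less order.strict_iff_order)
qed

lemma finite_Rp: "finite Rp"
  using Rp_sub finite_subset[OF _ finite_R, of Rp] by blast

lemma reflectionsE:
  assumes "t \<in> reflections"
  obtains \<alpha> k where "\<alpha> \<in> Rp" "t = aref \<alpha> k"
proof -
  obtain \<alpha> k where \<alpha>: "t = aref \<alpha> k" "\<alpha> \<in> R" using assms unfolding reflections_def by blast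
  show ?thesis
  proof (cases "\<alpha> \<in> Rp")
    case True
    then show ?thesis using that \<alpha> by blast
  next
    case False
    then show ?thesis
      using that[of "- \<alpha>" "- k"] Rp_cases[OF \<alpha>(2)] \<alpha>(1) by (simp add: affine_reflection_minus)
  qed
qed

lemma aref_in: "\<alpha> \<in> R \<Longrightarrow> aref \<alpha> k \<in> reflections"
  unfolding reflections_def by blast

lemma reflections_invol:
  assumes "t \<in> reflections" shows "t (t x) = x"
proof -
  obtain \<alpha> k where "t = aref \<alpha> k" "\<alpha> \<in> R" using assms unfolding reflections_def by blast
  then show ?thesis using affine_reflection_involution[OF R_nonzero] by simp
qed

lemma reflections_invol_comp: "t \<in> reflections \<Longrightarrow> t \<circ> t = id"
  by (rule ext) (simp add: reflections_invol)

text \<open>Conjugation moves the hyperplane of t by s. The new level j - k i is an integer because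
  i, the pairing of two roots, is one.\<close>

lemma reflections_conj:
  assumes "s \<in> reflections" "t \<in> reflections"
  shows "s \<circ> t \<circ> s \<in> reflections"
proof -
  obtain \<alpha> k \<beta> j where s: "s = aref \<alpha> k" "\<alpha> \<in> R" and t: "t = aref \<beta> j" "\<beta> \<in> R"
    using assms unfolding reflections_def by blast
  obtain i where i: "pairing \<alpha> \<beta> = of_int i" using R_int s t Ints_cases by metis
  have \<alpha>: "\<alpha> \<noteq> 0" using s R_nonzero by blast
  have p: "pairing (refl_root \<alpha> x) \<beta> = pairing x (refl_root \<alpha> \<beta>)" for x
    using pairing_refl_root[OF \<alpha>, of x "refl_root \<alpha> \<beta>"] refl_root_refl_root[OF \<alpha>] by simp
  have "refl_root \<alpha> \<alpha> = - \<alpha>" using pairing_self[OF \<alpha>] by (simp add: refl_root_def scaleR_2)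
  have "s \<circ> t \<circ> s = aref (refl_root \<alpha> \<beta>) (j - k * i)"
  proof
    fix x
    let ?y = "aref \<alpha> k x"
    have "(s \<circ> t \<circ> s) x = refl_root \<alpha> (?y - (pairing ?y \<beta> - real l * of_int j) *\<^sub>R \<beta>) + (real l * of_int k) *\<^sub>R \<alpha>"
      by (simp add: s t affine_reflection_refl_root[of l \<alpha> k "aref \<beta> j ?y"]) (simp add: affine_reflection_def)
    also have "\<dots> = aref \<alpha> k ?y - (pairing ?y \<beta> - real l * of_int j) *\<^sub>R refl_root \<alpha> \<beta>"
      unfolding refl_root_linear by (simp add: affine_reflection_refl_root[of l \<alpha> k ?y])
    also have "aref \<alpha> k ?y = x" using affine_reflection_involution[OF \<alpha>] .
    also have "pairing ?y \<beta> = pairing x (refl_root \<alpha> \<beta>) + real l * of_int k * of_int i"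
      by (simp add: affine_reflection_refl_root pairing_linear p i)
    finally show "(s \<circ> t \<circ> s) x = aref (refl_root \<alpha> \<beta>) (j - k * i) x"
      by (simp add: affine_reflection_def algebra_simps)
  qed
  then show ?thesis using aref_in R_refl s t by simp
qed

lemma regular_reflect:
  assumes "s \<in> reflections" "regular p" shows "regular (s p)"
  unfolding regular_def
proof
  fix t assume t: "t \<in> reflections"
  show "t (s p) \<noteq> s p"
  proof
    assume "t (s p) = s p"
    then have "(s \<circ> t \<circ> s) p = p" using reflections_invol[OF assms(1)] by simp
    then show False using assms(2) reflections_conj[OF assms(1) t] unfolding regular_def by blast
  qed
qed

text \<open>The function \<open>?f\<close> is affine along the segment and nonzero at its ends, so
  it vanishes in between exactly if the end values have opposite signs. The witness
  \<open>?c\<close> is the zero of the linear interpolation.\<close>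

lemma separating_iff:
  assumes "\<alpha> \<in> R" "aref \<alpha> k p \<noteq> p" "aref \<alpha> k q \<noteq> q"
  shows "aref \<alpha> k \<in> separating p q \<longleftrightarrow>
    (pairing p \<alpha> - real l * of_int k) * (pairing q \<alpha> - real l * of_int k) < 0"
proof -
  let ?f = "\<lambda>x. pairing x \<alpha> - real l * of_int k"
  have nz: "?f p \<noteq> 0" "?f q \<noteq> 0"
    using assms affine_reflection_fixed_iff[OF R_nonzero[OF assms(1)]] by auto
  have f: "?f ((1 - c) *\<^sub>R p + c *\<^sub>R q) = (1 - c) * ?f p + c * ?f q" for c
    by (simp add: pairing_linear algebra_simps)
  have "aref \<alpha> k \<in> separating p q \<longleftrightarrow> (\<exists>c. 0 \<le> c \<and> c \<le> 1 \<and> (1 - c) * ?f p + c * ?f q = 0)"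
    using aref_in[OF assms(1)] affine_reflection_fixed_iff[OF R_nonzero[OF assms(1)]] f[symmetric]
    unfolding separating_def closed_segment_def by auto
  also have "\<dots> \<longleftrightarrow> ?f p * ?f q < 0"
  proof
    assume "\<exists>c. 0 \<le> c \<and> c \<le> 1 \<and> (1 - c) * ?f p + c * ?f q = 0"
    then obtain c where c: "0 \<le> c" "c \<le> 1" "(1 - c) * ?f p + c * ?f q = 0" by blast
    then have "c \<noteq> 0" using nz by auto
    then have "0 < c" using c by simp
    have "c * (?f p * ?f q) = - ((1 - c) * (?f p)\<^sup>2)"
      using arg_cong[OF c(3), of "\<lambda>x. ?f p * x"] by (simp add: algebra_simps power2_eq_square)
    also have "\<dots> \<le> 0" using c by simp
    finally have "?f p * ?f q \<le> 0" using \<open>0 < c\<close> by (simp add: mult_le_0_iff)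
    then show "?f p * ?f q < 0" using nz by (simp add: order.strict_iff_order)
  next
    assume neg: "?f p * ?f q < 0"
    let ?c = "?f p / (?f p - ?f q)"
    have "?f p - ?f q \<noteq> 0" using neg by (auto simp: mult_less_0_iff)
    moreover have "0 \<le> ?c" "?c \<le> 1"
      using neg by (auto simp: mult_less_0_iff divide_simps)
    moreover have "(1 - ?c) * ?f p + ?c * ?f q = ?f p - ?c * (?f p - ?f q)" by (simp only: algebra_simps)
    ultimately show "\<exists>c. 0 \<le> c \<and> c \<le> 1 \<and> (1 - c) * ?f p + c * ?f q = 0"
      by (intro exI[of _ ?c]) simp
  qed
  finally show ?thesis .
qed

text \<open>Each of the three points lies strictly on one side, so crossings add mod 2.\<close>

lemma separating_trans:
  assumes "t \<in> reflections" "t p \<noteq> p" "t q \<noteq> q" "t r \<noteq> r"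
  shows "t \<in> separating p r \<longleftrightarrow> (t \<in> separating p q) \<noteq> (t \<in> separating q r)"
proof -
  obtain \<alpha> k where t: "t = aref \<alpha> k" "\<alpha> \<in> R" using assms unfolding reflections_def by blast
  have "pairing x \<alpha> - real l * of_int k \<noteq> 0" if "t x \<noteq> x" for x
    using that affine_reflection_fixed_iff[OF R_nonzero[OF t(2)]] t by auto
  from this[OF assms(2)] this[OF assms(3)] this[OF assms(4)] show ?thesis
    using assms separating_iff[OF t(2)] unfolding t by (auto simp: mult_less_0_iff)
qed

lemma separating_commute: "separating p q = separating q p"
  by (simp add: separating_def closed_segment_commute)

lemma separating_reflect:
  assumes s: "s \<in> reflections" and t: "t \<in> reflections"
  shows "t \<in> separating (s p) (s q) \<longleftrightarrow> s \<circ> t \<circ> s \<in> separating p q"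
proof -
  have aff: "s ((1 - c) *\<^sub>R x + c *\<^sub>R y) = (1 - c) *\<^sub>R s x + c *\<^sub>R s y" for c x y
    using s affine_reflection_segment unfolding reflections_def by auto
  have seg: "s z \<in> closed_segment (s x) (s y)" if "z \<in> closed_segment x y" for x y z
    using that aff unfolding closed_segment_def by auto
  have "(\<exists>z\<in>closed_segment (s p) (s q). t z = z) \<longleftrightarrow> (\<exists>z\<in>closed_segment p q. (s \<circ> t \<circ> s) z = z)"
  proof
    assume "\<exists>z\<in>closed_segment (s p) (s q). t z = z"
    then obtain z where "z \<in> closed_segment (s p) (s q)" "t z = z" by blast
    then show "\<exists>z\<in>closed_segment p q. (s \<circ> t \<circ> s) z = z"
      using seg[of z "s p" "s q"] reflections_invol[OF s] by (intro bexI[of _ "s z"]) auto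
  next
    assume "\<exists>z\<in>closed_segment p q. (s \<circ> t \<circ> s) z = z"
    then obtain z where z: "z \<in> closed_segment p q" "s (t (s z)) = z" by auto
    then have "t (s z) = s z" using reflections_invol[OF s] by metis
    then show "\<exists>z\<in>closed_segment (s p) (s q). t z = z" using seg z by blast
  qed
  then show ?thesis using reflections_conj[OF s t] t by (simp add: separating_def)
qed

lemma separating_self: "regular p \<Longrightarrow> separating p p = {}"
  by (auto simp: separating_def regular_def)

lemma separating_subset: "separating p q \<subseteq> reflections"
  by (auto simp: separating_def)

text \<open>A level met by the segment is bounded by the pairings at its ends, and there are
  finitely many roots.\<close>

lemma finite_separating: "finite (separating p q)"
proof -
  let ?b = "\<lambda>\<alpha>. \<bar>pairing p \<alpha>\<bar> + \<bar>pairing q \<alpha>\<bar>"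
  let ?K = "SIGMA \<alpha>:R. {- \<lceil>?b \<alpha>\<rceil>..\<lceil>?b \<alpha>\<rceil>}"
  have "separating p q \<subseteq> (\<lambda>(\<alpha>, k). aref \<alpha> k) ` ?K"
  proof
    fix t assume "t \<in> separating p q"
    then obtain \<alpha> k z where t: "t = aref \<alpha> k" "\<alpha> \<in> R" "z \<in> closed_segment p q" "t z = z"
      unfolding separating_def reflections_def by blast
    then obtain c where c: "0 \<le> c" "c \<le> 1" "z = (1 - c) *\<^sub>R p + c *\<^sub>R q"
      unfolding closed_segment_def by blast
    have "real l * of_int k = (1 - c) * pairing p \<alpha> + c * pairing q \<alpha>"
      using t affine_reflection_fixed_iff[OF R_nonzero[OF t(2)]] c by (simp add: pairing_linear)
    then have "\<bar>real l * of_int k\<bar> \<le> (1 - c) * \<bar>pairing p \<alpha>\<bar> + c * \<bar>pairing q \<alpha>\<bar>"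
      using c abs_triangle_ineq[of "(1 - c) * pairing p \<alpha>" "c * pairing q \<alpha>"] by (simp add: abs_mult)
    also have "\<dots> \<le> ?b \<alpha>" using c by (intro add_mono mult_left_le_one_le) auto
    finally have "real l * \<bar>of_int k\<bar> \<le> ?b \<alpha>" by (simp add: abs_mult)
    moreover have "1 * \<bar>of_int k\<bar> \<le> real l * \<bar>of_int k :: real\<bar>"
      using l_pos by (intro mult_right_mono) auto
    ultimately have "\<bar>of_int k\<bar> \<le> ?b \<alpha>" by linarith
    then have "k \<in> {- \<lceil>?b \<alpha>\<rceil>..\<lceil>?b \<alpha>\<rceil>}" by (simp, linarith)
    then show "t \<in> (\<lambda>(\<alpha>, k). aref \<alpha> k) ` ?K" using t by blast
  qed
  moreover have "finite ?K" using finite_R by simp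
  ultimately show ?thesis using finite_surj by blast
qed

text \<open>Every level is at most 0 or at least \<open>l\<close>, so no hyperplane enters the open
  strips that define the alcove. The point \<open>q\<close> may lie on other walls, which matters
  for points chosen on a facet.\<close>

lemma closed_alcove_not_separated:
  assumes q: "\<And>\<alpha>. \<alpha> \<in> Rp \<Longrightarrow> 0 \<le> pairing q \<alpha> \<and> pairing q \<alpha> \<le> real l"
    and t: "t \<in> reflections" "t q \<noteq> q"
  shows "t c0 \<noteq> c0" "t \<notin> separating c0 q"
proof -
  obtain \<alpha> k where \<alpha>: "\<alpha> \<in> Rp" "t = aref \<alpha> k" using t reflectionsE by blast
  have R: "\<alpha> \<in> R" using \<alpha> Rp_sub by blast
  have "k \<le> 0 \<or> 1 \<le> k" by linarith
  then have "real_of_int k \<le> 0 \<or> 1 \<le> real_of_int k" by simp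
  then have k: "real l * of_int k \<le> 0 \<or> real l \<le> real l * of_int k"
    using l_pos by (auto simp: mult_le_0_iff)
  have "pairing c0 \<alpha> \<noteq> real l * of_int k" using k c0_in[OF \<alpha>(1)] by linarith
  then show c0: "t c0 \<noteq> c0" using affine_reflection_fixed_iff[OF R_nonzero[OF R]] \<alpha> by simp
  have "\<not> (a - c) * (b - c) < 0" if "0 < a \<and> a < L" "0 \<le> b \<and> b \<le> L" "c \<le> 0 \<or> L \<le> c" for a b c L :: real
    using that by (auto simp: mult_less_0_iff)
  from this[OF c0_in[OF \<alpha>(1)] q[OF \<alpha>(1)] k]
  have "\<not> (pairing c0 \<alpha> - real l * of_int k) * (pairing q \<alpha> - real l * of_int k) < 0" .
  then show "t \<notin> separating c0 q" using separating_iff[OF R] c0 t(2) unfolding \<alpha>(2) by blast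
qed

lemma alcove_regular:
  assumes "p \<in> alcove" shows "regular p"
  unfolding regular_def
proof
  fix t assume "t \<in> reflections"
  then obtain \<alpha> k where \<alpha>: "\<alpha> \<in> Rp" "t = aref \<alpha> k" using reflectionsE by blast
  have "k \<le> 0 \<or> 1 \<le> k" by linarith
  then have "real_of_int k \<le> 0 \<or> 1 \<le> real_of_int k" by simp
  then have "real l * of_int k \<le> 0 \<or> real l \<le> real l * of_int k"
    using l_pos by (auto simp: mult_le_0_iff)
  then have "pairing p \<alpha> \<noteq> real l * of_int k" using assms \<alpha> unfolding alcove_def by force
  then show "t p \<noteq> p" using affine_reflection_fixed_iff[OF R_nonzero[OF Rp_sub[OF \<alpha>(1)]]] \<alpha> by simp
qed

lemma c0_alcove: "c0 \<in> alcove"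
  using c0_in by (simp add: alcove_def)

lemmas c0_regular = alcove_regular[OF c0_alcove]

lemma alcove_not_separated:
  assumes "p \<in> alcove" shows "separating c0 p = {}"
proof -
  have "t \<notin> separating c0 p" if "t \<in> reflections" for t
    using closed_alcove_not_separated(2)[of p t] assms alcove_regular[OF assms] that
    unfolding alcove_def regular_def by force
  then show ?thesis using separating_subset by blast
qed

section \<open>Walls as facets of the closed alcove\<close>

abbreviation \<rho> where "\<rho> \<equiv> half_sum Rp"

definition closed_dot_alcove :: "'e set" where
  "closed_dot_alcove = {x. \<forall>\<alpha>\<in>Rp. 0 \<le> pairing (x + \<rho>) \<alpha> \<and> pairing (x + \<rho>) \<alpha> \<le> real l}"

lemma pairing_le_halfspace:
  assumes "\<alpha> \<noteq> 0"
  shows "pairing (x + \<rho>) \<alpha> \<le> b \<longleftrightarrow> \<alpha> \<bullet> x \<le> b * (\<alpha> \<bullet> \<alpha>) / 2 - \<alpha> \<bullet> \<rho>"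
    and "pairing (x + \<rho>) \<alpha> = b \<longleftrightarrow> \<alpha> \<bullet> x = b * (\<alpha> \<bullet> \<alpha>) / 2 - \<alpha> \<bullet> \<rho>"
    and "b \<le> pairing (x + \<rho>) \<alpha> \<longleftrightarrow> (- \<alpha>) \<bullet> x \<le> \<alpha> \<bullet> \<rho> - b * (\<alpha> \<bullet> \<alpha>) / 2"
proof -
  have pos: "0 < \<alpha> \<bullet> \<alpha>" using assms by simp
  have e: "pairing (x + \<rho>) \<alpha> = 2 * (\<alpha> \<bullet> x + \<alpha> \<bullet> \<rho>) / (\<alpha> \<bullet> \<alpha>)"
    by (simp add: pairing_def inner_commute[of \<alpha> x] inner_commute[of \<alpha> \<rho>] inner_add_left)
  have r: "2 * (y + z) \<le> d \<longleftrightarrow> y \<le> d / 2 - z" "2 * (y + z) = d \<longleftrightarrow> y = d / 2 - z"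
    "d \<le> 2 * (y + z) \<longleftrightarrow> - y \<le> z - d / 2" for y z d :: real
    by (auto simp: field_simps)
  show "pairing (x + \<rho>) \<alpha> \<le> b \<longleftrightarrow> \<alpha> \<bullet> x \<le> b * (\<alpha> \<bullet> \<alpha>) / 2 - \<alpha> \<bullet> \<rho>"
    unfolding e pos_divide_le_eq[OF pos] by (rule r)
  show "pairing (x + \<rho>) \<alpha> = b \<longleftrightarrow> \<alpha> \<bullet> x = b * (\<alpha> \<bullet> \<alpha>) / 2 - \<alpha> \<bullet> \<rho>"
    unfolding e nonzero_divide_eq_eq[OF less_imp_neq[OF pos, symmetric]] by (rule r)
  show "b \<le> pairing (x + \<rho>) \<alpha> \<longleftrightarrow> (- \<alpha>) \<bullet> x \<le> \<alpha> \<bullet> \<rho> - b * (\<alpha> \<bullet> \<alpha>) / 2"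
    unfolding e pos_le_divide_eq[OF pos] inner_minus_left by (rule r)
qed

lemma closed_halfspaces:
  "\<alpha> \<noteq> 0 \<Longrightarrow> closed {x. b \<le> pairing (x + \<rho>) \<alpha>}" "\<alpha> \<noteq> 0 \<Longrightarrow> closed {x. pairing (x + \<rho>) \<alpha> \<le> b}"
  unfolding pairing_le_halfspace by (rule closed_halfspace_le)+

text \<open>Moving a point of the closed polyhedron slightly towards the base point makes all
  inequalities strict.\<close>

lemma closure_open_bottom_alcove: "closure (open_bottom_alcove Rp l) = closed_dot_alcove"
proof
  have "closed_dot_alcove = (\<Inter>\<alpha>\<in>Rp. {x. 0 \<le> pairing (x + \<rho>) \<alpha>} \<inter> {x. pairing (x + \<rho>) \<alpha> \<le> real l})"
    by (auto simp: closed_dot_alcove_def)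
  moreover have "closed \<dots>"
    using R_nonzero Rp_sub closed_halfspaces by (intro closed_INT ballI closed_Int) blast+
  ultimately have "closed closed_dot_alcove" by simp
  then show "closure (open_bottom_alcove Rp l) \<subseteq> closed_dot_alcove"
    by (intro closure_minimal) (auto simp: open_bottom_alcove_def closed_dot_alcove_def less_imp_le)
  show "closed_dot_alcove \<subseteq> closure (open_bottom_alcove Rp l)"
  proof
    fix x assume x: "x \<in> closed_dot_alcove"
    let ?c = "c0 - \<rho>"
    have c: "?c \<in> open_bottom_alcove Rp l" using c0_in by (simp add: open_bottom_alcove_def)
    show "x \<in> closure (open_bottom_alcove Rp l)"
    proof (cases "?c = x")
      case True
      then show ?thesis using c closure_subset by blast
    next
      case False
      have "open_segment ?c x \<subseteq> open_bottom_alcove Rp l"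
      proof
        fix z assume "z \<in> open_segment ?c x"
        then obtain u where u: "0 < u" "u < 1" "z = (1 - u) *\<^sub>R ?c + u *\<^sub>R x"
          by (auto simp: in_segment)
        have "0 < pairing (z + \<rho>) \<alpha> \<and> pairing (z + \<rho>) \<alpha> < real l" if \<alpha>: "\<alpha> \<in> Rp" for \<alpha>
        proof -
          have e: "pairing (z + \<rho>) \<alpha> = (1 - u) * pairing c0 \<alpha> + u * pairing (x + \<rho>) \<alpha>"
            by (simp add: u pairing_linear algebra_simps)
          have "0 < (1 - u) * pairing c0 \<alpha>" "(1 - u) * pairing c0 \<alpha> < (1 - u) * real l"
            using u c0_in[OF \<alpha>] by simp_all
          moreover have "0 \<le> u * pairing (x + \<rho>) \<alpha>" "u * pairing (x + \<rho>) \<alpha> \<le> u * real l"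
            using u x \<alpha> by (auto simp: closed_dot_alcove_def)
          ultimately show ?thesis unfolding e by (auto simp: algebra_simps)
        qed
        then show "z \<in> open_bottom_alcove Rp l" by (simp add: open_bottom_alcove_def)
      qed
      then have "closed_segment ?c x \<subseteq> closure (open_bottom_alcove Rp l)"
        using closure_mono closure_open_segment[of ?c x] False by metis
      then show ?thesis by auto
    qed
  qed
qed

lemma is_wall_iff:
  "is_wall Rp l \<alpha> k \<longleftrightarrow> affine hull (closed_dot_alcove \<inter> hyperplane Rp l \<alpha> k) = hyperplane Rp l \<alpha> k"
  by (simp add: is_wall_def closure_open_bottom_alcove)

lemma hyperplane_nonempty:
  assumes "\<alpha> \<noteq> 0" shows "(real l * of_int k / 2) *\<^sub>R \<alpha> - \<rho> \<in> hyperplane Rp l \<alpha> k"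
  using pairing_self[OF assms] by (simp add: hyperplane_def pairing_linear)

text \<open>The hyperplane of a wall is nonempty and is the hull of its part in the closed alcove,
  so it meets the alcove; this leaves only the levels 0 and 1.\<close>

lemma finite_S: "finite S"
proof -
  have "S \<subseteq> (\<lambda>(\<alpha>, k). aref \<alpha> k) ` (Rp \<times> {0, 1})"
  proof
    fix s assume "s \<in> S"
    then obtain \<alpha> k where \<alpha>: "\<alpha> \<in> Rp" "is_wall Rp l \<alpha> k" "s = aref \<alpha> k"
      unfolding simple_reflections_def by blast
    have "closed_dot_alcove \<inter> hyperplane Rp l \<alpha> k \<noteq> {}"
    proof
      assume "closed_dot_alcove \<inter> hyperplane Rp l \<alpha> k = {}"
      then have "hyperplane Rp l \<alpha> k = {}" using \<alpha>(2) unfolding is_wall_iff by simp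
      then show False using hyperplane_nonempty[OF R_nonzero[OF Rp_sub[OF \<alpha>(1)]]] by blast
    qed
    then obtain x where "0 \<le> pairing (x + \<rho>) \<alpha>" "pairing (x + \<rho>) \<alpha> \<le> real l"
        "pairing (x + \<rho>) \<alpha> = real l * of_int k"
      using \<alpha>(1) unfolding closed_dot_alcove_def hyperplane_def by blast
    then have "0 \<le> real_of_int k" "real_of_int k \<le> 1"
      using l_pos by (auto simp: zero_le_mult_iff mult_le_cancel_left1)
    then have "k = 0 \<or> k = 1" by linarith
    then show "s \<in> (\<lambda>(\<alpha>, k). aref \<alpha> k) ` (Rp \<times> {0, 1})" using \<alpha> by force
  qed
  then show ?thesis using finite_Rp by (meson finite.emptyI finite.insertI finite_SigmaI finite_surj)
qed

lemma S_sub: "s \<in> S \<Longrightarrow> s \<in> reflections"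
  unfolding simple_reflections_def reflections_def using Rp_sub by blast

text \<open>\<open>?x\<close> is the foot of the first hyperplane and \<open>?y\<close> the part of
  \<beta> orthogonal to \<alpha>. Both \<open>?x\<close> and \<open>?x + ?y\<close> lie on the first
  hyperplane, hence on the second, so \<open>?y\<close> is orthogonal to \<beta> as well and
  vanishes. The roots are then proportional, thus equal up to sign.\<close>

lemma aref_eqI:
  assumes "\<alpha> \<in> R" "\<beta> \<in> R"
    and sub: "\<And>x. pairing x \<alpha> = real l * of_int k \<Longrightarrow> pairing x \<beta> = real l * of_int j"
  shows "aref \<alpha> k = aref \<beta> j"
proof -
  have nz: "\<alpha> \<noteq> 0" "\<beta> \<noteq> 0" using assms R_nonzero by auto
  let ?x = "(real l * of_int k / 2) *\<^sub>R \<alpha>"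
  let ?y = "\<beta> - ((\<beta> \<bullet> \<alpha>) / (\<alpha> \<bullet> \<alpha>)) *\<^sub>R \<alpha>"
  have perp: "?y \<bullet> \<alpha> = 0" using nz by (simp add: inner_diff_left)
  then have "pairing ?x \<beta> = real l * of_int j" "pairing (?x + ?y) \<beta> = real l * of_int j"
    using pairing_self[OF nz(1)] by (intro sub; simp add: pairing_linear; simp add: pairing_def inner_diff_left)+
  then have "pairing ?y \<beta> = 0" by (simp add: pairing_add)
  then have "?y \<bullet> \<beta> = 0" using nz by (simp add: pairing_def)
  then have "?y \<bullet> ?y = 0" using perp by (simp add: inner_diff_right[of ?y \<beta>])
  then have "\<beta> = ((\<beta> \<bullet> \<alpha>) / (\<alpha> \<bullet> \<alpha>)) *\<^sub>R \<alpha>" by simp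
  then consider "\<beta> = \<alpha>" | "\<beta> = - \<alpha>"
    using R_multiple[OF assms(1)] assms(2) by (metis scaleR_minus1_left scaleR_one)
  then show ?thesis
  proof cases
    case 1
    then have "real l * of_int k = real l * of_int j"
      using \<open>pairing ?x \<beta> = _\<close> pairing_self[OF nz(1)] by (simp add: pairing_scaleR)
    then show ?thesis using l_pos 1 by simp
  next
    case 2
    then have "real l * of_int k = real l * of_int (- j)"
      using \<open>pairing ?x \<beta> = _\<close> pairing_self[OF nz(1)] by (simp add: pairing_scaleR pairing_minus_right)
    then have "k = - j" using l_pos by (simp only: mult_cancel_left of_int_eq_iff) simp
    then show ?thesis using 2 affine_reflection_minus[of l \<alpha> k] by simp
  qed
qed

text \<open>Since the wall is the hull of its part in the closed alcove, that part is not contained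
  in any other hyperplane. For t different from s it therefore has a point q fixed by s but not by
  t, and t separates q neither from \<open>c0\<close> nor, after reflecting by s, from
  \<open>s c0\<close>.\<close>

lemma separating_simple:
  assumes "s \<in> S" shows "separating c0 (s c0) = {s}"
proof (intro equalityI subsetI)
  obtain \<alpha> k where \<alpha>: "\<alpha> \<in> Rp" "is_wall Rp l \<alpha> k" "s = aref \<alpha> k"
    using assms unfolding simple_reflections_def by blast
  have \<alpha>R: "\<alpha> \<in> R" "\<alpha> \<noteq> 0" using \<alpha> Rp_sub R_nonzero by auto
  have s: "s \<in> reflections" using S_sub assms by blast
  fix t
  {
    assume "t \<in> {s}"
    have ne: "s c0 \<noteq> c0" "s (s c0) \<noteq> s c0"
      using c0_regular regular_reflect[OF s c0_regular] s unfolding regular_def by blast+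
    have "pairing (s c0) \<alpha> - real l * of_int k = - (pairing c0 \<alpha> - real l * of_int k)"
      using pairing_self[OF \<alpha>R(2)] by (simp add: \<alpha>(3) affine_reflection_def pairing_linear algebra_simps)
    moreover have "0 < (pairing c0 \<alpha> - real l * of_int k)\<^sup>2"
      using ne(1) affine_reflection_fixed_iff[OF \<alpha>R(2), of l k c0] unfolding \<alpha>(3) by simp
    ultimately have "(pairing c0 \<alpha> - real l * of_int k) * (pairing (s c0) \<alpha> - real l * of_int k) < 0"
      by (simp only: mult_minus_right power2_eq_square neg_less_0_iff_less)
    then show "t \<in> separating c0 (s c0)"
      using \<open>t \<in> {s}\<close> ne separating_iff[OF \<alpha>R(1), of k c0 "s c0"]
      unfolding \<alpha>(3) by blast
  }
  {
    assume tsep: "t \<in> separating c0 (s c0)"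
    then have t: "t \<in> reflections" using separating_subset by blast
    then obtain \<beta> j where \<beta>: "\<beta> \<in> Rp" "t = aref \<beta> j" using reflectionsE by blast
    have \<beta>R: "\<beta> \<in> R" "\<beta> \<noteq> 0" using \<beta> Rp_sub R_nonzero by auto
    show "t \<in> {s}"
    proof (rule ccontr)
      assume "t \<notin> {s}"
      have "\<not> closed_dot_alcove \<inter> hyperplane Rp l \<alpha> k \<subseteq> hyperplane Rp l \<beta> j"
      proof
        assume "closed_dot_alcove \<inter> hyperplane Rp l \<alpha> k \<subseteq> hyperplane Rp l \<beta> j"
        moreover have "affine (hyperplane Rp l \<beta> j)"
          unfolding hyperplane_def pairing_le_halfspace(2)[OF \<beta>R(2)] by (rule affine_hyperplane)
        ultimately have "affine hull (closed_dot_alcove \<inter> hyperplane Rp l \<alpha> k) \<subseteq> hyperplane Rp l \<beta> j"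
          by (rule hull_minimal)
        then have sub: "hyperplane Rp l \<alpha> k \<subseteq> hyperplane Rp l \<beta> j" using \<alpha>(2) unfolding is_wall_iff by simp
        have "pairing x \<beta> = real l * of_int j" if "pairing x \<alpha> = real l * of_int k" for x
        proof -
          have "x - \<rho> \<in> hyperplane Rp l \<alpha> k" using that by (simp add: hyperplane_def)
          then have "x - \<rho> \<in> hyperplane Rp l \<beta> j" using sub by blast
          then show ?thesis by (simp add: hyperplane_def)
        qed
        then have "aref \<alpha> k = aref \<beta> j" by (rule aref_eqI[OF \<alpha>R(1) \<beta>R(1)])
        then show False using \<alpha>(3) \<beta>(2) \<open>t \<notin> {s}\<close> by simp
      qed
      then obtain x where x: "x \<in> closed_dot_alcove" "x \<in> hyperplane Rp l \<alpha> k" "x \<notin> hyperplane Rp l \<beta> j" by blast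
      define q where "q = x + \<rho>"
      have q: "0 \<le> pairing q \<delta> \<and> pairing q \<delta> \<le> real l" if "\<delta> \<in> Rp" for \<delta>
        using x(1) that by (simp add: q_def closed_dot_alcove_def)
      have sq: "s q = q" and tq: "t q \<noteq> q"
        using x affine_reflection_fixed_iff[OF \<alpha>R(2)] affine_reflection_fixed_iff[OF \<beta>R(2)] \<alpha> \<beta>
        by (simp_all add: q_def hyperplane_def)
      have 1: "t \<notin> separating c0 q" by (rule closed_alcove_not_separated(2)[OF q t tq])
      have stsq: "(s \<circ> t \<circ> s) q \<noteq> q"
        using sq tq reflections_invol[OF s] by (metis comp_apply)
      have "s \<circ> t \<circ> s \<notin> separating c0 q"
        by (rule closed_alcove_not_separated(2)[OF q reflections_conj[OF s t] stsq])
      then have 2: "t \<notin> separating q (s c0)"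
        using separating_reflect[OF s t, of q c0] sq separating_commute by metis
      have "t c0 \<noteq> c0" "t (s c0) \<noteq> s c0"
        using c0_regular regular_reflect[OF s c0_regular] t unfolding regular_def by blast+
      then show False using separating_trans[OF t, of c0 q "s c0"] tq 1 2 tsep by blast
    qed
  }
qed

text \<open>The walls are the facets of the closed alcove: a minimal set of half-spaces cutting out the
  polyhedron has exactly the facets as its bounding hyperplanes.\<close>

lemma wall_separating:
  assumes "regular p" "p \<notin> alcove"
  shows "\<exists>s\<in>S. s \<in> separating c0 p"
proof -
  let ?P = closed_dot_alcove
  define H where "H = (\<lambda>\<alpha>. {x. 0 \<le> pairing (x + \<rho>) \<alpha>}) ` Rp \<union> (\<lambda>\<alpha>. {x. pairing (x + \<rho>) \<alpha> \<le> real l}) ` Rp"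
  have "finite H" and H: "?P = \<Inter>H" using finite_Rp by (auto simp: H_def closed_dot_alcove_def)
  have "\<exists>F. (F \<subseteq> H \<and> ?P = \<Inter>F) \<and> (\<forall>F'. F' \<subseteq> H \<and> ?P = \<Inter>F' \<longrightarrow> card F \<le> card F')"
    by (rule ex_has_least_nat[of _ H]) (simp add: H)
  then obtain F where F: "F \<subseteq> H" "?P = \<Inter>F" "\<And>F'. F' \<subseteq> H \<Longrightarrow> ?P = \<Inter>F' \<Longrightarrow> card F \<le> card F'"
    by (elim exE conjE) simp
  have finF: "finite F" using F(1) \<open>finite H\<close> finite_subset by blast
  have "open (open_bottom_alcove Rp l)"
  proof -
    have "open_bottom_alcove Rp l
        = (\<Inter>\<alpha>\<in>Rp. - {x. pairing (x + \<rho>) \<alpha> \<le> 0} \<inter> - {x. real l \<le> pairing (x + \<rho>) \<alpha>})"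
      by (auto simp: open_bottom_alcove_def not_le)
    moreover have "open \<dots>"
      using finite_Rp R_nonzero Rp_sub
      by (intro open_INT ballI open_Int open_Compl)
        (auto intro: closed_halfspaces)
    ultimately show ?thesis by simp
  qed
  moreover have "open_bottom_alcove Rp l \<subseteq> ?P"
    using closure_subset closure_open_bottom_alcove by blast
  moreover have "c0 - \<rho> \<in> open_bottom_alcove Rp l" using c0_in by (simp add: open_bottom_alcove_def)
  ultimately have "interior ?P \<noteq> {}" using interior_maximal by blast
  \<comment> \<open>As the polyhedron spans the whole space, its facets have codimension one and
    span their bounding hyperplanes.\<close>
  then have hull: "affine hull ?P = UNIV" by (rule affine_hull_nonempty_interior)
  \<comment> \<open>The level k is 0 for a lower bound and 1 for an upper bound; the last clause
    records on which side the points outside h lie.\<close>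
  have "\<exists>a b \<alpha> k. a \<noteq> 0 \<and> h = {x. a \<bullet> x \<le> b} \<and> {x. a \<bullet> x = b} = hyperplane Rp l \<alpha> k \<and> \<alpha> \<in> Rp \<and>
      (\<forall>x. x \<notin> h \<longrightarrow> (k = 0 \<and> pairing (x + \<rho>) \<alpha> < 0 \<or> k = 1 \<and> real l < pairing (x + \<rho>) \<alpha>))"
    if "h \<in> F" for h
  proof -
    have "h \<in> H" using that F(1) by blast
    then obtain \<alpha> where \<alpha>: "\<alpha> \<in> Rp" and
      "h = {x. 0 \<le> pairing (x + \<rho>) \<alpha>} \<or> h = {x. pairing (x + \<rho>) \<alpha> \<le> real l}"
      unfolding H_def by blast
    moreover have nz: "\<alpha> \<noteq> 0" using \<alpha> Rp_sub R_nonzero by blast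
    ultimately consider (lower) "h = {x. 0 \<le> pairing (x + \<rho>) \<alpha>}" | (upper) "h = {x. pairing (x + \<rho>) \<alpha> \<le> real l}"
      by blast
    then show ?thesis
    proof cases
      case lower
      have "{x. (- \<alpha>) \<bullet> x = \<alpha> \<bullet> \<rho>} = hyperplane Rp l \<alpha> 0"
        unfolding hyperplane_def pairing_le_halfspace(2)[OF nz] by auto
      moreover have "h = {x. (- \<alpha>) \<bullet> x \<le> \<alpha> \<bullet> \<rho>}"
        unfolding lower pairing_le_halfspace(3)[OF nz] by simp
      ultimately show ?thesis
        using \<alpha> nz lower by (intro exI[of _ "- \<alpha>"] exI[of _ "\<alpha> \<bullet> \<rho>"] exI[of _ \<alpha>] exI[of _ 0]) auto
    next
      case upper
      let ?b = "real l * (\<alpha> \<bullet> \<alpha>) / 2 - \<alpha> \<bullet> \<rho>"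
      have "{x. \<alpha> \<bullet> x = ?b} = hyperplane Rp l \<alpha> 1"
        unfolding hyperplane_def pairing_le_halfspace(2)[OF nz] by auto
      moreover have "h = {x. \<alpha> \<bullet> x \<le> ?b}"
        unfolding upper pairing_le_halfspace(1)[OF nz] ..
      ultimately show ?thesis
        using \<alpha> nz upper by (intro exI[of _ \<alpha>] exI[of _ ?b] exI[of _ \<alpha>] exI[of _ 1]) auto
    qed
  qed
  then obtain a b \<alpha> k where ab: "\<And>h. h \<in> F \<Longrightarrow> a h \<noteq> 0 \<and> h = {x. a h \<bullet> x \<le> b h} \<and>
      {x. a h \<bullet> x = b h} = hyperplane Rp l (\<alpha> h) (k h) \<and> \<alpha> h \<in> Rp \<and>
      (\<forall>x. x \<notin> h \<longrightarrow> (k h = 0 \<and> pairing (x + \<rho>) (\<alpha> h) < 0 \<or> k h = 1 \<and> real l < pairing (x + \<rho>) (\<alpha> h)))"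
    by metis
  \<comment> \<open>A regular point lies on no hyperplane, so outside the open alcove it is outside
    the closed one too.\<close>
  have "p - \<rho> \<notin> ?P"
  proof
    assume P: "p - \<rho> \<in> ?P"
    have "0 < pairing p \<delta> \<and> pairing p \<delta> < real l" if \<delta>: "\<delta> \<in> Rp" for \<delta>
    proof -
      have "aref \<delta> 0 p \<noteq> p" "aref \<delta> 1 p \<noteq> p"
        using assms(1) aref_in Rp_sub[OF \<delta>] unfolding regular_def by blast+
      then show ?thesis
        using P \<delta> affine_reflection_fixed_iff[OF R_nonzero[OF Rp_sub[OF \<delta>]]]
        by (auto simp: closed_dot_alcove_def order.strict_iff_order)
    qed
    then show False using assms(2) by (simp add: alcove_def)
  qed
  then obtain h where h: "h \<in> F" "p - \<rho> \<notin> h" using F(2) by blast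
  let ?\<alpha> = "\<alpha> h" and ?k = "k h"
  have sep: "?k = 0 \<and> pairing p ?\<alpha> < 0 \<or> ?k = 1 \<and> real l < pairing p ?\<alpha>"
    using ab[OF h(1)] h(2) by fastforce
  have \<alpha>: "?\<alpha> \<in> Rp" "?\<alpha> \<in> R" using ab[OF h(1)] Rp_sub by auto
  have minimal: "?P \<subset> affine hull ?P \<inter> \<Inter>F'" if "F' \<subset> F" for F'
  proof -
    have "?P \<subseteq> \<Inter>F'" using that F(2) by blast
    moreover have "?P \<noteq> \<Inter>F'"
      using F(3)[of F'] F(1) that psubset_card_mono[OF finF that] by fastforce
    ultimately show ?thesis using hull by auto
  qed
  have "?P \<inter> {x. a h \<bullet> x = b h} facet_of ?P"
  proof (subst facet_of_polyhedron_explicit[of F ?P a b])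
    show "?P = affine hull ?P \<inter> \<Inter>F" using hull F(2) by simp
    show "a h \<noteq> 0 \<and> h = {x. a h \<bullet> x \<le> b h}" if "h \<in> F" for h using ab[OF that] by blast
    show "\<exists>h'. h' \<in> F \<and> ?P \<inter> {x. a h \<bullet> x = b h} = ?P \<inter> {x. a h' \<bullet> x = b h'}" using h by blast
  qed (use finF minimal in auto)
  then have facet: "?P \<inter> {x. a h \<bullet> x = b h} \<noteq> {}"
      "aff_dim (?P \<inter> {x. a h \<bullet> x = b h}) = aff_dim ?P - 1"
    unfolding facet_of_def by blast+
  have dim: "aff_dim ?P = int DIM('e)" using hull aff_dim_affine_hull[of ?P] by simp
  have nz: "a h \<noteq> 0" using ab[OF h(1)] by blast
  have "affine hull (?P \<inter> {x. a h \<bullet> x = b h}) = {x. a h \<bullet> x = b h}"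
  proof (rule affine_dim_equal)
    show "affine hull (?P \<inter> {x. a h \<bullet> x = b h}) \<subseteq> {x. a h \<bullet> x = b h}"
      by (rule hull_minimal) (auto simp: affine_hyperplane)
    show "aff_dim (affine hull (?P \<inter> {x. a h \<bullet> x = b h})) = aff_dim {x. a h \<bullet> x = b h}"
      unfolding aff_dim_affine_hull facet(2) dim aff_dim_hyperplane[OF nz]
      using DIM_positive[where 'a = 'e] by (simp only: of_nat_diff Suc_leI One_nat_def of_nat_1)
  qed (use facet(1) in \<open>auto simp: affine_hyperplane\<close>)
  then have "is_wall Rp l ?\<alpha> ?k" using ab[OF h(1)] unfolding is_wall_iff by simp
  then have "aref ?\<alpha> ?k \<in> S" using \<alpha> unfolding simple_reflections_def by blast
  moreover have ne: "aref ?\<alpha> ?k c0 \<noteq> c0" "aref ?\<alpha> ?k p \<noteq> p"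
    using c0_regular assms(1) aref_in[OF \<alpha>(2)] unfolding regular_def by blast+
  have "aref ?\<alpha> ?k \<in> separating c0 p"
    unfolding separating_iff[OF \<alpha>(2) ne] using sep c0_in[OF \<alpha>(1)] by (auto simp: mult_less_0_iff)
  ultimately show ?thesis by blast
qed

section \<open>Generation of the affine Weyl group by the wall reflections\<close>

lemma generic_point_on_hyperplane:
  assumes \<alpha>: "\<alpha> \<in> R"
  shows "\<exists>q. aref \<alpha> k q = q \<and> (\<forall>t\<in>reflections. t q = q \<longrightarrow> t = aref \<alpha> k)"
proof -
  \<comment> \<open>Orthogonal projection to the hyperplane. Points projecting into another
    hyperplane form a null set, and countably many null sets do not cover the space.\<close>
  define proj where "proj x = x - ((pairing x \<alpha> - real l * of_int k) / 2) *\<^sub>R \<alpha>" for x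
  define bad where "bad = (\<lambda>(\<beta>, j). {x. pairing (proj x) \<beta> = real l * of_int j})"
  have nz: "\<alpha> \<noteq> 0" using \<alpha> R_nonzero by blast
  have on: "pairing (proj x) \<alpha> = real l * of_int k" for x
    using pairing_self[OF nz] by (simp add: proj_def pairing_linear field_simps)
  have negl: "negligible (bad (\<beta>, j))" if \<beta>: "\<beta> \<in> R" "aref \<beta> j \<noteq> aref \<alpha> k" for \<beta> j
  proof -
    have "\<beta> \<noteq> 0" using \<beta> R_nonzero by blast
    \<comment> \<open>Normal vector of the pulled-back hyperplane: up to scaling, the component of
      \<beta> orthogonal to \<alpha>.\<close>
    define a where "a = (2 / (\<beta> \<bullet> \<beta>)) *\<^sub>R \<beta> - (pairing \<alpha> \<beta> / (\<alpha> \<bullet> \<alpha>)) *\<^sub>R \<alpha>"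
    define c where "c = real l * of_int j - real l * of_int k * pairing \<alpha> \<beta> / 2"
    have eqv: "pairing (proj x) \<beta> = real l * of_int j \<longleftrightarrow> a \<bullet> x = c" for x
    proof -
      have "pairing (proj x) \<beta> = pairing x \<beta> - (pairing x \<alpha> - real l * of_int k) / 2 * pairing \<alpha> \<beta>"
        by (simp add: proj_def pairing_linear)
      moreover have "a \<bullet> x = pairing x \<beta> - pairing x \<alpha> / 2 * pairing \<alpha> \<beta>"
        by (simp add: a_def pairing_def inner_diff_left inner_commute[of x \<beta>] inner_commute[of x \<alpha>] mult_ac)
      ultimately have "pairing (proj x) \<beta> - real l * of_int j = a \<bullet> x - c"
        by (simp add: c_def algebra_simps diff_divide_distrib)
      then show ?thesis by auto
    qed
    have bad_eq: "bad (\<beta>, j) = {x. a \<bullet> x = c}" by (simp add: bad_def eqv)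
    show ?thesis
    proof (cases "a = 0")
      case False
      then show ?thesis unfolding bad_eq by (intro negligible_hyperplane) blast
    next
      case True
      \<comment> \<open>For parallel hyperplanes the pullback is everything or nothing, and
        everything would make the two reflections equal.\<close>
      have "bad (\<beta>, j) = {}"
      proof (rule ccontr)
        assume "bad (\<beta>, j) \<noteq> {}"
        then have "c = 0" unfolding bad_eq True by auto
        then have all: "pairing (proj x) \<beta> = real l * of_int j" for x
          unfolding eqv True by simp
        have "aref \<alpha> k = aref \<beta> j"
        proof (rule aref_eqI[OF \<alpha> \<beta>(1)])
          fix x assume "pairing x \<alpha> = real l * of_int k"
          then show "pairing x \<beta> = real l * of_int j" using all[of x] by (simp add: proj_def)
        qed
        then show False using \<beta>(2) by simp
      qed
      then show ?thesis by simp
    qed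
  qed
  define I where "I = {(\<beta>, j :: int). \<beta> \<in> R \<and> aref \<beta> j \<noteq> aref \<alpha> k}"
  have "I \<subseteq> R \<times> UNIV" by (auto simp: I_def)
  then have "countable I" using countable_finite[OF finite_R] by (meson countable_SIGMA countable_subset countableI_type)
  then have "negligible (\<Union>(bad ` I))"
    by (intro negligible_countable_Union) (auto simp: I_def negl)
  then have "\<Union>(bad ` I) \<noteq> UNIV" using non_negligible_UNIV by metis
  then obtain x where x: "x \<notin> \<Union>(bad ` I)" by blast
  have "t = aref \<alpha> k" if t: "t \<in> reflections" "t (proj x) = proj x" for t
  proof (rule ccontr)
    assume ne: "t \<noteq> aref \<alpha> k"
    obtain \<beta> j where \<beta>: "\<beta> \<in> R" "t = aref \<beta> j" using t(1) unfolding reflections_def by blast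
    then have "x \<in> bad (\<beta>, j)"
      using t(2) affine_reflection_fixed_iff[OF R_nonzero] by (simp add: bad_def)
    then show False using x \<beta> ne by (auto simp: I_def)
  qed
  then show ?thesis using on affine_reflection_fixed_iff[OF nz] by blast
qed

text \<open>One \<delta> for all levels at once: it lets a single small step avoid the infinitely
  many hyperplanes parallel to a given one.\<close>

lemma multiples_discrete:
  fixes x :: real
  shows "\<exists>\<delta>>0. \<forall>j. x \<noteq> real l * of_int j \<longrightarrow> \<delta> \<le> \<bar>x - real l * of_int j\<bar>"
proof -
  define n where "n = \<lfloor>x / real l\<rfloor>"
  have "of_int n \<le> x / real l" "x / real l < of_int n + 1"
    unfolding n_def by linarith+
  then have n: "real l * of_int n \<le> x" "x < real l * (of_int n + 1)"
    using l_pos by (simp_all add: pos_le_divide_eq pos_divide_less_eq mult.commute)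
  define \<delta> where "\<delta> = (if x = real l * of_int n then real l
    else min (x - real l * of_int n) (real l * (of_int n + 1) - x))"
  have "\<delta> > 0" using n l_pos by (auto simp: \<delta>_def)
  moreover have "\<delta> \<le> \<bar>x - real l * of_int j\<bar>" if "x \<noteq> real l * of_int j" for j
  proof (cases "j \<le> n")
    case True
    have 1: "real l * of_int j \<le> real l * of_int n" using True by (intro mult_left_mono) auto
    have "real l * of_int j \<le> real l * (of_int n - 1)" if "j \<noteq> n"
      using True that by (intro mult_left_mono) auto
    then show ?thesis using n 1 that by (cases "j = n") (auto simp: \<delta>_def algebra_simps)
  next
    case False
    have 1: "real l * (of_int n + 1) \<le> real l * of_int j" using False by (intro mult_left_mono) auto
    then show ?thesis using n by (auto simp: \<delta>_def algebra_simps)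
  qed
  ultimately show ?thesis by blast
qed

text \<open>Leave a generic point q of the hyperplane along \<alpha> in both directions, by so small
  an \<epsilon> that every hyperplane avoiding q stays out of reach. The two ends are mirror images
  under t.\<close>

lemma ex_adjacent_point:
  assumes "t \<in> reflections"
  shows "\<exists>p. regular p \<and> separating p (t p) = {t}"
proof -
  obtain \<alpha> k where \<alpha>: "\<alpha> \<in> R" "t = aref \<alpha> k" using assms unfolding reflections_def by blast
  have nz: "\<alpha> \<noteq> 0" using \<alpha> R_nonzero by blast
  obtain q where q: "t q = q" "\<And>t'. t' \<in> reflections \<Longrightarrow> t' q = q \<Longrightarrow> t' = t"
    using generic_point_on_hyperplane[OF \<alpha>(1)] \<alpha>(2) by blast
  have "eventually (\<lambda>\<epsilon>. \<forall>j. pairing q \<beta> \<noteq> real l * of_int j \<longrightarrow>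
      \<epsilon> * \<bar>pairing \<alpha> \<beta>\<bar> < \<bar>pairing q \<beta> - real l * of_int j\<bar>) (at_right 0)" for \<beta>
  proof -
    obtain \<delta> where \<delta>: "\<delta> > 0" "\<And>j. pairing q \<beta> \<noteq> real l * of_int j \<Longrightarrow> \<delta> \<le> \<bar>pairing q \<beta> - real l * of_int j\<bar>"
      using multiples_discrete[of "pairing q \<beta>"] by blast
    have "((\<lambda>\<epsilon>. \<epsilon> * \<bar>pairing \<alpha> \<beta>\<bar>) \<longlongrightarrow> 0 * \<bar>pairing \<alpha> \<beta>\<bar>) (at_right 0)"
      by (intro tendsto_intros)
    then have "eventually (\<lambda>\<epsilon>. \<epsilon> * \<bar>pairing \<alpha> \<beta>\<bar> < \<delta>) (at_right 0)"
      using \<delta>(1) by (intro order_tendstoD) simp_all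
    then show ?thesis using \<delta>(2) by (elim eventually_mono) force
  qed
  then have "eventually (\<lambda>\<epsilon>. \<forall>\<beta>\<in>R. \<forall>j. pairing q \<beta> \<noteq> real l * of_int j \<longrightarrow>
      \<epsilon> * \<bar>pairing \<alpha> \<beta>\<bar> < \<bar>pairing q \<beta> - real l * of_int j\<bar>) (at_right 0)"
    using finite_R by (intro eventually_ball_finite) auto
  then have "eventually (\<lambda>\<epsilon>. 0 < \<epsilon> \<and> (\<forall>\<beta>\<in>R. \<forall>j. pairing q \<beta> \<noteq> real l * of_int j \<longrightarrow>
      \<epsilon> * \<bar>pairing \<alpha> \<beta>\<bar> < \<bar>pairing q \<beta> - real l * of_int j\<bar>)) (at_right 0)"
    by (intro eventually_conj eventually_at_right_less)
  then obtain \<epsilon> :: real where \<epsilon>: "0 < \<epsilon>" "\<And>\<beta> j. \<beta> \<in> R \<Longrightarrow> pairing q \<beta> \<noteq> real l * of_int j \<Longrightarrow>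
      \<epsilon> * \<bar>pairing \<alpha> \<beta>\<bar> < \<bar>pairing q \<beta> - real l * of_int j\<bar>"
    using eventually_happens[of _ "at_right (0::real)"] trivial_limit_at_right_real by blast
  have near: "t' = t" if t': "t' \<in> reflections" "t' (q + u *\<^sub>R \<alpha>) = q + u *\<^sub>R \<alpha>" and u: "\<bar>u\<bar> \<le> \<epsilon>" for t' u
  proof -
    obtain \<beta> j where \<beta>: "\<beta> \<in> R" "t' = aref \<beta> j" using t'(1) unfolding reflections_def by blast
    have "pairing q \<beta> + u * pairing \<alpha> \<beta> = real l * of_int j"
      using t'(2) affine_reflection_fixed_iff[OF R_nonzero[OF \<beta>(1)]] \<beta>(2) by (simp add: pairing_linear)
    then have "\<bar>pairing q \<beta> - real l * of_int j\<bar> = \<bar>u\<bar> * \<bar>pairing \<alpha> \<beta>\<bar>"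
      by (simp add: abs_mult[symmetric])
    also have "\<dots> \<le> \<epsilon> * \<bar>pairing \<alpha> \<beta>\<bar>" using u by (intro mult_right_mono) auto
    finally have "pairing q \<beta> = real l * of_int j" using \<epsilon>(2)[OF \<beta>(1)] by force
    then have "t' q = q" using affine_reflection_fixed_iff[OF R_nonzero[OF \<beta>(1)]] \<beta>(2) by simp
    then show ?thesis using q(2) t'(1) by blast
  qed
  define p where "p = q + \<epsilon> *\<^sub>R \<alpha>"
  have qk: "pairing q \<alpha> = real l * of_int k" using q(1) affine_reflection_fixed_iff[OF nz] \<alpha>(2) by simp
  have tp: "t p = q + (- \<epsilon>) *\<^sub>R \<alpha>"
  proof -
    have "pairing p \<alpha> - real l * of_int k = 2 * \<epsilon>"
      using pairing_self[OF nz] by (simp add: p_def pairing_linear qk)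
    then have "t p = p - (2 * \<epsilon>) *\<^sub>R \<alpha>"
      unfolding \<alpha>(2) affine_reflection_def by (simp only:)
    also have "(2 * \<epsilon>) *\<^sub>R \<alpha> = \<epsilon> *\<^sub>R \<alpha> + \<epsilon> *\<^sub>R \<alpha>" by (simp only: mult_2 scaleR_add_left)
    also have "p - (\<epsilon> *\<^sub>R \<alpha> + \<epsilon> *\<^sub>R \<alpha>) = q + (- \<epsilon>) *\<^sub>R \<alpha>" by (simp add: p_def)
    finally show ?thesis .
  qed
  have "regular p"
    unfolding regular_def
  proof
    fix t' assume t': "t' \<in> reflections"
    show "t' p \<noteq> p"
    proof
      assume "t' p = p"
      then have "t' = t" using near[OF t', of \<epsilon>] \<epsilon>(1) by (simp add: p_def)
      then have "q + (- \<epsilon>) *\<^sub>R \<alpha> = q + \<epsilon> *\<^sub>R \<alpha>" using \<open>t' p = p\<close> tp by (simp add: p_def)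
      then have "(- \<epsilon>) *\<^sub>R \<alpha> = \<epsilon> *\<^sub>R \<alpha>" by (rule add_left_imp_eq)
      then show False using nz \<epsilon>(1) by (simp only: scaleR_cancel_right) simp
    qed
  qed
  moreover have "separating p (t p) = {t}"
  proof (intro equalityI subsetI)
    fix t' assume "t' \<in> separating p (t p)"
    then obtain z c where t': "t' \<in> reflections" "t' z = z" and c: "0 \<le> c" "c \<le> 1" "z = (1 - c) *\<^sub>R p + c *\<^sub>R t p"
      unfolding separating_def closed_segment_def by blast
    have e: "\<epsilon> * (1 - 2 * c) = \<epsilon> - \<epsilon> * c - \<epsilon> * c" by (simp add: algebra_simps)
    have "z = q + (\<epsilon> * (1 - 2 * c)) *\<^sub>R \<alpha>"
      unfolding c(3) tp e scaleR_diff_left by (simp add: p_def algebra_simps)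
    moreover have "\<epsilon> * \<bar>1 - 2 * c\<bar> \<le> \<epsilon> * 1" using c \<epsilon>(1) by (intro mult_left_mono) auto
    ultimately show "t' \<in> {t}" using near[of t' "\<epsilon> * (1 - 2 * c)"] t' \<epsilon>(1) by (simp add: abs_mult)
  next
    fix t' assume "t' \<in> {t}"
    have "q = (1 - 1 / 2) *\<^sub>R p + (1 / 2) *\<^sub>R t p" unfolding tp by (simp add: p_def algebra_simps flip: scaleR_add_left)
    then have "q \<in> closed_segment p (t p)" unfolding closed_segment_def by (intro CollectI exI[of _ "1 / 2"]) simp
    then show "t' \<in> separating p (t p)" using \<open>t' \<in> {t}\<close> assms q(1) by (auto simp: separating_def)
  qed
  ultimately show ?thesis by blast
qed

text \<open>Go through \<open>s c0\<close>: the first leg crosses only s, and the second is the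
  image under s of the segment from \<open>c0\<close> to p.\<close>

lemma separating_simple_step:
  assumes "s \<in> S" "t \<in> reflections" "regular p"
  shows "t \<in> separating c0 (s p) \<longleftrightarrow> (t = s) \<noteq> (s \<circ> t \<circ> s \<in> separating c0 p)"
proof -
  have s: "s \<in> reflections" using S_sub assms by blast
  have "t c0 \<noteq> c0" "t (s c0) \<noteq> s c0" "t (s p) \<noteq> s p"
    using c0_regular regular_reflect[OF s] assms unfolding regular_def by blast+
  then show ?thesis
    using separating_trans[OF assms(2), of c0 "s c0" "s p"] separating_simple[OF assms(1)]
      separating_reflect[OF s assms(2)] by simp
qed

text \<open>A reflection whose hyperplane is the only one between \<open>p\<close> and its mirror image is carried,
  while \<open>p\<close> is moved towards the base alcove by simple reflections, to a reflection in a wall.\<close>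

lemma adjacent_reflection_in_group:
  assumes "regular p" "t \<in> reflections" "separating p (t p) = {t}"
  shows "t \<in> gen_group S"
proof -
  have "\<forall>p t. card (separating c0 p) = n \<longrightarrow> regular p \<longrightarrow> t \<in> reflections \<longrightarrow> separating p (t p) = {t}
      \<longrightarrow> t \<in> gen_group S" for n
  proof (induction n rule: less_induct)
    case (less n)
    show ?case
    proof (intro allI impI)
      fix p t assume card: "card (separating c0 p) = n" and p: "regular p" and t: "t \<in> reflections"
        and sep: "separating p (t p) = {t}"
      show "t \<in> gen_group S"
      proof (cases "p \<in> alcove")
        case True
        have tp: "regular (t p)" using regular_reflect[OF t p] .
        \<comment> \<open>Nothing separates \<open>c0\<close> from p, so only t separates
          \<open>c0\<close> from its image \<open>t p\<close>, and the wall provided by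
          \<open>wall_separating\<close> must be that of t.\<close>
        have ne: "separating c0 (t p) = {t}"
        proof -
          have "t' \<in> separating c0 (t p) \<longleftrightarrow> t' \<in> separating p (t p)" if t': "t' \<in> reflections" for t'
            using separating_trans[OF t', of c0 p "t p"] alcove_not_separated[OF True] t' c0_regular p tp
            unfolding regular_def by blast
          then show ?thesis using sep separating_subset by blast
        qed
        have "t p \<notin> alcove" using ne alcove_not_separated by blast
        then have "t \<in> S" using wall_separating[OF tp] unfolding ne by simp
        then show ?thesis by (rule gen_in_gen_group)
      next
        case False
        obtain s where s: "s \<in> S" "s \<in> separating c0 p" using wall_separating[OF p False] by blast
        have sr: "s \<in> reflections" using S_sub s by blast
        have sp: "regular (s p)" using regular_reflect[OF sr p] .
        have ss: "s \<circ> (s \<circ> x) = x" for x :: "'e \<Rightarrow> 'e" by (metis comp_assoc id_comp reflections_invol_comp[OF sr])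
        have ss': "(x \<circ> s) \<circ> s = x" for x :: "'e \<Rightarrow> 'e" by (metis comp_assoc comp_id reflections_invol_comp[OF sr])
        define t' where "t' = s \<circ> t \<circ> s"
        have t': "t' \<in> reflections" unfolding t'_def using reflections_conj[OF sr t] .
        \<comment> \<open>As s separates \<open>c0\<close> from p, reflecting p removes s and
          conjugates the remaining hyperplanes; the induction measure drops.\<close>
        have "separating c0 (s p) \<subseteq> (\<lambda>r. s \<circ> r \<circ> s) ` (separating c0 p - {s})"
        proof
          fix r assume r: "r \<in> separating c0 (s p)"
          then have rr: "r \<in> reflections" using separating_subset by blast
          have e: "r = s \<circ> (s \<circ> r \<circ> s) \<circ> s" by (simp add: comp_assoc ss reflections_invol_comp[OF sr])
          have "r \<noteq> s"
            using separating_simple_step[OF s(1) sr p] s(2) r by (auto simp: comp_assoc ss reflections_invol_comp[OF sr])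
          then have "s \<circ> r \<circ> s \<in> separating c0 p" using separating_simple_step[OF s(1) rr p] r by blast
          moreover have "s \<circ> r \<circ> s \<noteq> s"
          proof
            assume "s \<circ> r \<circ> s = s"
            then have "r = s \<circ> s \<circ> s" using e by metis
            then show False using \<open>r \<noteq> s\<close> by (simp add: comp_assoc ss reflections_invol_comp[OF sr])
          qed
          ultimately show "r \<in> (\<lambda>r. s \<circ> r \<circ> s) ` (separating c0 p - {s})" using e by blast
        qed
        then have "card (separating c0 (s p)) \<le> card (separating c0 p - {s})"
          using finite_separating surj_card_le by (metis finite_Diff)
        also have "\<dots> < n" using s(2) finite_separating card by (metis card_Diff1_less)
        finally have lt: "card (separating c0 (s p)) < n" .
        have "t' (s p) = s (t p)" using reflections_invol[OF sr] by (simp add: t'_def)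
        moreover have "separating (s p) (s (t p)) = {t'}"
        proof (intro equalityI subsetI)
          fix r assume r: "r \<in> separating (s p) (s (t p))"
          then have "r \<in> reflections" using separating_subset by blast
          then have "s \<circ> r \<circ> s = t" using r separating_reflect[OF sr] sep by blast
          then show "r \<in> {t'}" unfolding t'_def by (auto simp: comp_assoc ss reflections_invol_comp[OF sr])
        next
          fix r assume "r \<in> {t'}"
          then have "s \<circ> r \<circ> s = t" unfolding t'_def by (auto simp: comp_assoc ss reflections_invol_comp[OF sr])
          then show "r \<in> separating (s p) (s (t p))"
            using \<open>r \<in> {t'}\<close> t' separating_reflect[OF sr, of r p "t p"] sep by simp
        qed
        ultimately have "t' \<in> gen_group S" using less[OF lt] sp t' by simp
        then have "s \<circ> t' \<circ> s \<in> gen_group S"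
          using gen_group_comp[OF gen_group_comp] gen_in_gen_group[OF s(1)] by blast
        moreover have "s \<circ> t' \<circ> s = t" by (simp add: t'_def comp_assoc ss reflections_invol_comp[OF sr])
        ultimately show ?thesis by simp
      qed
    qed
  qed
  then show ?thesis using assms by blast
qed

lemma reflections_in_group: "t \<in> reflections \<Longrightarrow> t \<in> gen_group S"
  using ex_adjacent_point adjacent_reflection_in_group by blast

lemma translation_in_group:
  assumes "\<gamma> \<in> root_lattice R"
  shows "(\<lambda>x. x + real l *\<^sub>R \<gamma>) \<in> gen_group S"
proof -
  define L where "L = {v. (\<lambda>x. x + v) \<in> gen_group S}"
  have zero: "0 \<in> L" using id_in_gen_group[of S] by (simp add: L_def id_def)
  have add: "v + w \<in> L" if "v \<in> L" "w \<in> L" for v w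
    using gen_group_comp[of "\<lambda>x. x + w" S "\<lambda>x. x + v"] that by (simp add: L_def comp_def add.assoc)
  have root: "real l *\<^sub>R \<alpha> \<in> L" if \<alpha>: "\<alpha> \<in> R" for \<alpha>
  proof -
    \<comment> \<open>Reflections in parallel hyperplanes at levels 0 and 1 compose to a
      translation.\<close>
    have "aref \<alpha> 1 \<circ> aref \<alpha> 0 = (\<lambda>x. x + real l *\<^sub>R \<alpha>)"
      using pairing_self[OF R_nonzero[OF \<alpha>]]
      by (auto simp: affine_reflection_def pairing_linear algebra_simps)
    moreover have "aref \<alpha> 1 \<circ> aref \<alpha> 0 \<in> gen_group S"
      using \<alpha> aref_in reflections_in_group by (intro gen_group_comp) blast+
    ultimately show ?thesis by (simp add: L_def)
  qed
  have nat_mult: "real n *\<^sub>R (real l *\<^sub>R \<alpha>) \<in> L" if "\<alpha> \<in> R" for \<alpha> n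
  proof (induction n)
    case (Suc n)
    have "real (Suc n) *\<^sub>R (real l *\<^sub>R \<alpha>) = real n *\<^sub>R (real l *\<^sub>R \<alpha>) + real l *\<^sub>R \<alpha>"
      by (simp add: algebra_simps)
    then show ?case using add[OF Suc root[OF that]] by simp
  qed (simp add: zero)
  have int_mult: "of_int c *\<^sub>R (real l *\<^sub>R \<alpha>) \<in> L" if "\<alpha> \<in> R" for \<alpha> and c :: int
  proof (cases "0 \<le> c")
    case True
    then show ?thesis using nat_mult[OF that, of "nat c"] by simp
  next
    case False
    then show ?thesis using nat_mult[OF R_uminus[OF that], of "nat (- c)"] by simp
  qed
  obtain c :: "'e \<Rightarrow> int" where \<gamma>: "\<gamma> = (\<Sum>\<alpha>\<in>R. of_int (c \<alpha>) *\<^sub>R \<alpha>)"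
    using assms unfolding root_lattice_def by blast
  have "(\<Sum>\<alpha>\<in>A. of_int (c \<alpha>) *\<^sub>R (real l *\<^sub>R \<alpha>)) \<in> L" if "finite A" "A \<subseteq> R" for A
    using that
  proof (induction A rule: finite_induct)
    case (insert \<alpha> A)
    then show ?case using add int_mult by simp
  qed (simp add: zero)
  then have "(\<Sum>\<alpha>\<in>R. of_int (c \<alpha>) *\<^sub>R (real l *\<^sub>R \<alpha>)) \<in> L" using finite_R by blast
  moreover have "(\<Sum>\<alpha>\<in>R. of_int (c \<alpha>) *\<^sub>R (real l *\<^sub>R \<alpha>)) = real l *\<^sub>R \<gamma>"
    unfolding \<gamma> scaleR_sum_right by (simp add: mult.commute)
  ultimately show ?thesis by (simp add: L_def)
qed

lemma affine_weyl_group_sub: "affine_weyl_group R l \<subseteq> gen_group S"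
proof
  fix x assume "x \<in> affine_weyl_group R l"
  then obtain w \<gamma> where w: "w \<in> weyl_group R" and \<gamma>: "\<gamma> \<in> root_lattice R" and x: "x = (\<lambda>y. w y + real l *\<^sub>R \<gamma>)"
    unfolding affine_weyl_group_def by blast
  have refl: "refl_root \<alpha> \<in> gen_group S" if "\<alpha> \<in> R" for \<alpha>
  proof -
    have "aref \<alpha> 0 = refl_root \<alpha>" by (rule ext) (simp add: affine_reflection_refl_root)
    then show ?thesis using reflections_in_group[OF aref_in[OF that, of 0]] by simp
  qed
  have "w \<in> gen_group S"
    by (rule weyl_group.induct[OF w, of "\<lambda>w. w \<in> gen_group S"]) (simp_all add: gen_group_comp refl)
  moreover have "x = (\<lambda>y. y + real l *\<^sub>R \<gamma>) \<circ> w" by (auto simp: x)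
  ultimately show "x \<in> gen_group S" using translation_in_group[OF \<gamma>] gen_group_comp by blast
qed

section \<open>The separation cocycle and the dominant elements\<close>

lemma group_regular:
  assumes "w \<in> gen_group S" "regular p" shows "regular (w p)"
  using assms(1)
  by (rule gen_group_induct[of w S "\<lambda>w. regular (w p)"]) (use assms(2) regular_reflect S_sub in auto)

lemma group_not_separating:
  assumes "w \<in> gen_group S" "separating p q = {}"
  shows "separating (w p) (w q) = {}"
proof (rule gen_group_induct[of w S "\<lambda>w. separating (w p) (w q) = {}"])
  fix s w assume s: "s \<in> S" and IH: "separating (w p) (w q) = {}"
  have "t \<notin> separating (s (w p)) (s (w q))" if "t \<in> reflections" for t
    using separating_reflect[OF S_sub[OF s] that] IH by blast
  then show "separating ((s \<circ> w) p) ((s \<circ> w) q) = {}" using separating_subset by fastforce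
qed (use assms in simp_all)

lemma reflection_cocycle: "reflection_cocycle S (\<lambda>w. separating c0 (w c0))"
proof
  show "separating c0 (id c0) = {}" using separating_self[OF c0_regular] by simp
  show "s \<circ> s = id" if "s \<in> S" for s using reflections_invol_comp S_sub that by blast
  fix s w t assume s: "s \<in> S" and w: "w \<in> gen_group S"
  have sr: "s \<in> reflections" using S_sub s by blast
  show "t \<in> separating c0 ((s \<circ> w) c0) \<longleftrightarrow> (t = s) \<noteq> (s \<circ> t \<circ> s \<in> separating c0 (w c0))"
  proof (cases "t \<in> reflections")
    case True
    then show ?thesis using separating_simple_step[OF s True group_regular[OF w c0_regular]] by simp
  next
    case False
    \<comment> \<open>The cocycle rule ranges over all maps t. If t is no reflection, then it is not
      s, and neither it nor its conjugate can be separating.\<close>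
    have "s \<circ> (s \<circ> t \<circ> s) \<circ> s = (s \<circ> s) \<circ> t \<circ> (s \<circ> s)" by (simp add: comp_assoc)
    then have "s \<circ> (s \<circ> t \<circ> s) \<circ> s = t" using reflections_invol_comp[OF sr] by simp
    then have "s \<circ> t \<circ> s \<notin> reflections" using reflections_conj[OF sr, of "s \<circ> t \<circ> s"] False by metis
    then show ?thesis using False sr separating_subset by blast
  qed
qed

text \<open>Positive roots \<open>\<beta>\<close> that \<open>refl_root \<alpha>\<close> keeps positive cancel in pairs; the others pair
  positively with \<open>\<alpha>\<close>.\<close>

lemma pairing_half_sum_nonneg:
  assumes \<alpha>: "\<alpha> \<in> Rp" shows "0 \<le> pairing \<rho> \<alpha>"
proof -
  obtain \<gamma> where \<gamma>: "\<forall>\<alpha>\<in>R. \<alpha> \<bullet> \<gamma> \<noteq> 0" "Rp = {\<alpha>\<in>R. 0 < \<alpha> \<bullet> \<gamma>}"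
    using positive_system unfolding positive_system_def by blast
  have \<alpha>R: "\<alpha> \<in> R" "\<alpha> \<noteq> 0" using \<alpha> Rp_sub R_nonzero by auto
  define P where "P = {\<beta> \<in> Rp. refl_root \<alpha> \<beta> \<in> Rp}"
  have "(\<Sum>\<beta>\<in>P. pairing \<beta> \<alpha>) = (\<Sum>\<beta>\<in>P. pairing (refl_root \<alpha> \<beta>) \<alpha>)"
    by (rule sum.reindex_bij_witness[of _ "refl_root \<alpha>" "refl_root \<alpha>"])
      (auto simp: P_def refl_root_refl_root[OF \<alpha>R(2)])
  also have "\<dots> = - (\<Sum>\<beta>\<in>P. pairing \<beta> \<alpha>)"
    using pairing_self[OF \<alpha>R(2)] by (simp add: refl_root_def pairing_linear sum_negf)
  finally have P: "(\<Sum>\<beta>\<in>P. pairing \<beta> \<alpha>) = 0" by simp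
  have "0 \<le> pairing \<beta> \<alpha>" if \<beta>: "\<beta> \<in> Rp - P" for \<beta>
  proof (rule ccontr)
    assume "\<not> 0 \<le> pairing \<beta> \<alpha>"
    then have "pairing \<beta> \<alpha> * (\<alpha> \<bullet> \<gamma>) \<le> 0" using \<gamma>(2) \<alpha> by (intro mult_nonpos_nonneg) auto
    moreover have "0 < \<beta> \<bullet> \<gamma>" using \<beta> \<gamma>(2) by blast
    ultimately have "0 < refl_root \<alpha> \<beta> \<bullet> \<gamma>" by (simp add: refl_root_def inner_diff_left)
    then show False using \<beta> \<gamma>(2) R_refl[OF \<alpha>R(1)] by (auto simp: P_def)
  qed
  then have "0 \<le> (\<Sum>\<beta>\<in>Rp - P. pairing \<beta> \<alpha>)" by (intro sum_nonneg) blast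
  moreover have "(\<Sum>\<beta>\<in>Rp. pairing \<beta> \<alpha>) = (\<Sum>\<beta>\<in>Rp - P. pairing \<beta> \<alpha>) + (\<Sum>\<beta>\<in>P. pairing \<beta> \<alpha>)"
    using finite_Rp by (intro sum.subset_diff) (auto simp: P_def)
  ultimately show ?thesis using P by (simp add: half_sum_def pairing_scaleR pairing_sum)
qed

text \<open>An element of the finite group fixes 0, so its hyperplane has level 0. In place of
  \<open>c0\<close>, take the point \<open>c1\<close> of the same alcove whose image under y is a
  dominant weight plus the half sum: its pairing with \<alpha> is nonnegative, so it cannot lie on
  the far side of that hyperplane.\<close>

lemma dominant_not_separated:
  assumes y: "y \<in> dominant_elements R Rp l"
  shows "separating c0 (y c0) \<inter> weyl_group R = {}"
proof (rule ccontr)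
  assume "separating c0 (y c0) \<inter> weyl_group R \<noteq> {}"
  then obtain t where t: "t \<in> separating c0 (y c0)" "t \<in> weyl_group R" by blast
  then have tr: "t \<in> reflections" using separating_subset by blast
  then obtain \<alpha> k where \<alpha>: "\<alpha> \<in> Rp" "t = aref \<alpha> k" using reflectionsE by blast
  have \<alpha>R: "\<alpha> \<in> R" "\<alpha> \<noteq> 0" using \<alpha> Rp_sub R_nonzero by auto
  have "aref \<alpha> k 0 = 0" using weyl_group_zero[OF t(2)] \<alpha>(2) by simp
  then have k: "k = 0" using \<alpha>R l_pos by (simp add: affine_reflection_def pairing_def)
  have yG: "y \<in> gen_group S" using y affine_weyl_group_sub unfolding dominant_elements_def by blast
  obtain x where x: "x \<in> bottom_alcove Rp l" "dot_action Rp y x \<in> dominant_weights Rp"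
    using y unfolding dominant_elements_def by blast
  define c1 where "c1 = x + \<rho>"
  have c1: "c1 \<in> alcove" using x(1) by (simp add: c1_def bottom_alcove_def open_bottom_alcove_def alcove_def)
  have "separating (y c0) (y c1) = {}"
    by (rule group_not_separating[OF yG alcove_not_separated[OF c1]])
  moreover have nf: "t c0 \<noteq> c0" "t (y c0) \<noteq> y c0" "t (y c1) \<noteq> y c1"
    using c0_regular group_regular[OF yG] alcove_regular[OF c1] tr unfolding regular_def by blast+
  ultimately have "t \<in> separating c0 (y c1)" using separating_trans[OF tr, of c0 "y c0" "y c1"] t(1) by blast
  then have "pairing c0 \<alpha> * pairing (y c1) \<alpha> < 0"
    using separating_iff[OF \<alpha>R(1), of k c0 "y c1"] nf unfolding \<alpha>(2) k by simp
  then have "pairing (y c1) \<alpha> < 0" using c0_in[OF \<alpha>(1)] by (auto simp: mult_less_0_iff)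
  moreover have "pairing (y c1 - \<rho>) \<alpha> \<in> \<nat>"
    using x(2) \<alpha>(1) by (simp add: dominant_weights_def dot_action_def c1_def)
  then have "0 \<le> pairing (y c1 - \<rho>) \<alpha>" by (auto elim: Nats_cases)
  ultimately show False using pairing_half_sum_nonneg[OF \<alpha>(1)] by (simp add: pairing_diff)
qed

lemma finite_simple_group_sub: "gen_group (finite_simple_reflections R Rp l) \<subseteq> weyl_group R"
proof
  fix w assume "w \<in> gen_group (finite_simple_reflections R Rp l)"
  then obtain ws where "set ws \<subseteq> finite_simple_reflections R Rp l" "w = word_prod ws" by (elim gen_groupE)
  moreover have "set ws \<subseteq> finite_simple_reflections R Rp l \<Longrightarrow> word_prod ws \<in> weyl_group R" for ws
    by (induction ws) (auto simp: finite_simple_reflections_def weyl_group.intros weyl_group_comp)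
  ultimately show "w \<in> weyl_group R" by simp
qed

end

theorem lemma2p6:
  fixes R Rp :: "'e::euclidean_space set" and l :: nat
    and d :: "'e hecke_elem \<Rightarrow> 'e hecke_elem"
    and m n minv :: "('e \<Rightarrow> 'e) \<Rightarrow> ('e \<Rightarrow> 'e) \<Rightarrow> laurent"
    and A B :: "'e \<Rightarrow> 'e"
  assumes "root_system R"
    and "positive_system R Rp"
    and "odd l"
    and "has_G2_component R \<Longrightarrow> l \<noteq> 3"
    and "is_dualization (simple_reflections Rp l) d"
    and "is_kl_family (simple_reflections Rp l) (finite_simple_reflections R Rp l)
           (dominant_elements R Rp l) (vpow (-1)) d m"
    and "is_kl_family (simple_reflections Rp l) (finite_simple_reflections R Rp l)
           (dominant_elements R Rp l) (- vpow 1) d n"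
    and "is_inverse_family (simple_reflections Rp l) (dominant_elements R Rp l) m minv"
    and "A \<in> dominant_elements R Rp l"
    and "B \<in> dominant_elements R Rp l"
  shows "bar (t_poly (dominant_elements R Rp l) n minv B A)
           = t_poly (dominant_elements R Rp l) n minv B A"
proof -
  \<comment> \<open>The base point comes from \<open>A\<close>: a dominant element moves some weight
    of the bottom alcove, so that alcove is nonempty. Adding the half sum passes from the dot action
    to the plain one.\<close>
  obtain x where x: "x \<in> bottom_alcove Rp l"
    using assms(9) unfolding dominant_elements_def by blast
  interpret A: affine_alcove R Rp l "x + half_sum Rp"
  proof
    show "0 < l" using assms(3) by (cases l) simp_all
    show "0 < pairing (x + half_sum Rp) \<alpha> \<and> pairing (x + half_sum Rp) \<alpha> < real l" if "\<alpha> \<in> Rp" for \<alpha>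
      using x that by (simp add: bottom_alcove_def open_bottom_alcove_def)
  qed (fact assms)+
  interpret C: reflection_cocycle "simple_reflections Rp l"
      "\<lambda>w. A.separating (x + half_sum Rp) (w (x + half_sum Rp))"
    by (rule A.reflection_cocycle)
  interpret P: parabolic_cocycle "simple_reflections Rp l"
      "\<lambda>w. A.separating (x + half_sum Rp) (w (x + half_sum Rp))"
      "finite_simple_reflections R Rp l" "dominant_elements R Rp l"
  proof
    show "finite_simple_reflections R Rp l \<subseteq> simple_reflections Rp l"
      by (simp add: finite_simple_reflections_def)
    show "finite (simple_reflections Rp l)" by (rule A.finite_S)
    show "dominant_elements R Rp l \<subseteq> gen_group (simple_reflections Rp l)"
      using A.affine_weyl_group_sub unfolding dominant_elements_def by blast
    show "A.separating (x + half_sum Rp) (y (x + half_sum Rp)) \<inter> gen_group (finite_simple_reflections R Rp l) = {}"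
      if "y \<in> dominant_elements R Rp l" for y
      using A.dominant_not_separated[OF that] A.finite_simple_group_sub by blast
  qed
  show ?thesis by (rule P.t_poly_self_dual[OF assms(5-10)])
qed

end
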